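(* Let $\boldsymbol p\in\mathbb N_0^2\setminus\{(0,0)\}$. The moduli space $\mathcal M_{\boldsymbol p}(\mathcal E)$ of symbol correspondences $\mathcal B(\mathcal H_{\boldsymbol p})\to C^\infty_{\mathbb C}(\mathcal E)$ is, via the assignment to each correspondence of its characteristic matrices $\mathbf C(\boldsymbol a)$, $$\Big(\prod_{a=1}^{|\boldsymbol p|}V_{\mathfrak m(\boldsymbol p;a,a)}(\mathbb R^{a+1})\Big)\times\Big(\prod_{a<b}V_{\mathfrak m(\boldsymbol p;a,b)}(\mathbb C^{a+1})\Big),$$ where the second product runs over pairs $a<b$ such that $(a,b)$ occurs in $\boldsymbol p\otimes\check{\boldsymbol p}$, and $V_k(\mathbb K^n)=GL_n(\mathbb K)/GL_{n,k}(\mathbb K)$, with $GL_{n,k}(\mathbb K)\subset GL_n(\mathbb K)$ the maximal subgroup that (pointwise) fixes a $k$-dimensional subspace, is the non compact Stiefel manifold of $k$-frames in $\mathbb K^n$.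
   Context: Representations. In a representation of $SU(3)$ (extended to $\mathfrak{sl}(3,\mathbb C)$) let $T_+,T_-,T_3,U_+,U_-,U_3$ be the images of $E_{12},E_{21},\tfrac12(E_{11}-E_{22}),E_{23},E_{32},\tfrac12(E_{22}-E_{33})$. For $\boldsymbol p=(p,q)\in\mathbb N_0^2$, "the irrep $\boldsymbol p$" is the unitary irrep $\rho$ on a Hilbert space $\mathcal H_{\boldsymbol p}$ whose highest weight vector has eigenvalue $p/2$ for $T_3$ and $q/2$ for $U_3$; $\dim(\boldsymbol p)=\frac{(p+1)(q+1)(p+q+2)}2$, $|\boldsymbol p|=p+q$, $\check{\boldsymbol p}=(q,p)$ (the dual irrep). Gelfand-Tsetlin (GT) basis: an orthonormal basis $\{\boldsymbol e(\boldsymbol p;\boldsymbol\nu,J)\}$ indexed by $\boldsymbol\nu=(\nu_1,\nu_2,\nu_3)$ and $J$ where, for integers $0\le r_-\le q\le r_+\le p+q$ and $r_-\le\nu_3\le r_+$: $\nu_1=p+2q-(r_++r_-)$, $\nu_2=r_++r_--\nu_3$, $J=\frac12(r_+-r_-)$. Put $t_{\boldsymbol\nu}=\frac{\nu_1-\nu_2}2$, $u_{\boldsymbol\nu}=\frac{\nu_2-\nu_3}2$ (the eigenvalues of $T_3,U_3$). The basis is determined by a unit highest weight vector $\boldsymbol e(\boldsymbol p;(p+q,q,0),q/2)$ via, with $u=u_{\boldsymbol\nu}$, $U_-\boldsymbol e(\boldsymbol p;\boldsymbol\nu,J)=\sqrt{(J+u)(J-u+1)}\,\boldsymbol e(\boldsymbol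 p;(\nu_1,\nu_2-1,\nu_3+1),J)$ and $T_-\boldsymbol e(\boldsymbol p;\boldsymbol\nu,J)=\sqrt{\tfrac{(J-u)(p+q+J-u-\nu_3+1)(q+J-u-\nu_3)(u-J+\nu_3+1)}{2J(2J+1)}}\,\boldsymbol e(\boldsymbol p;(\nu_1-1,\nu_2+1,\nu_3),J-\tfrac12)+\sqrt{\tfrac{(J+u+1)(p+q-J-u-\nu_3)(J+u+1+\nu_3-q)(J+u+2+\nu_3)}{2(J+1)(2J+1)}}\,\boldsymbol e(\boldsymbol p;(\nu_1-1,\nu_2+1,\nu_3),J+\tfrac12)$ (terms with zero numerator are $0$). For a GT label $\boldsymbol\nu$ of $\boldsymbol a$ put $\check{\boldsymbol\nu}=(|\boldsymbol a|,|\boldsymbol a|,|\boldsymbol a|)-\boldsymbol\nu$, a GT label of $\check{\boldsymbol a}$. Operators. $\mathcal B(\mathcal H_{\boldsymbol p})\simeq\mathcal H_{\boldsymbol p}\otimes\mathcal H_{\boldsymbol p}^*$ (the representation $\boldsymbol p\otimes\check{\boldsymbol p}$) carries the action $A^g=\rho(g)A\rho(g)^{-1}$ and the inner product $\operatorname{tr}(A^\dagger B)$. $\mathfrak m(\boldsymbol p;\boldsymbol a)=\mathfrak m(\boldsymbol p;a,b)$ is the multiplicity of $\boldsymbol a=(a,b)$ in $\boldsymbol p\otimes\check{\boldsymbol p}$. A decomposition of $\mathcal B(\mathcal H_{\boldsymbol p})$ into mutually orthogonal irreps $(\boldsymbol a;\sigma)$, $1\le\sigma\le\mathfrak m(\boldsymbol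 p;\boldsymbol a)$, together with GT bases $\boldsymbol e((\boldsymbol a;\sigma);\boldsymbol\nu,J)$, is fixed so that $\boldsymbol e((\boldsymbol a;\sigma);\boldsymbol\nu,J)^\dagger=(-1)^{2(t_{\boldsymbol\nu}+u_{\boldsymbol\nu})}\boldsymbol e((\check{\boldsymbol a};\sigma);\check{\boldsymbol\nu},J)$ and $\boldsymbol e((0,0);(0,0,0),0)=\mathds 1/\sqrt{\dim\boldsymbol p}$. Phase space. $\mathcal E\simeq SU(3)/T$ is the full flag manifold, $T$ the diagonal maximal torus, $\mathrm z_0\in\mathcal E$ a point with isotropy group $T$, with the $SU(3)$-invariant integral of total mass $1$. For $\boldsymbol a=(a,b)$ with $a\equiv b\pmod 3$ (every $\boldsymbol a$ occurring in $\boldsymbol p\otimes\check{\boldsymbol p}$ is such): $m(\boldsymbol a)=\min\{a,b\}+1$, $\boldsymbol 0_{\boldsymbol a}=(c,c,c)$ with $c=(a+2b)/3$, $J^\gamma_{\boldsymbol a}=\gamma-1+|a-b|/3$ for $1\le\gamma\le m(\boldsymbol a)$. For $K\in\mathcal B(\mathcal H_{\boldsymbol p})$ fixed by $T$, $K(g\mathrm z_0):=K^g$. A symbol correspondence $W:\mathcal B(\mathcal H_{\boldsymbol p})\to C^\infty_{\mathbb C}(\mathcal E)$ is an injective linear map with: (1) $W_{A^g}=(W_A)^g$ for all $g\in SU(3)$, where $f^g(\mathrm z)=f(g^{-1}\mathrm z)$; (2) $W_{A^\dagger}=\overline{W_A}$; (3) $\int_{\mathcal E}W_A\,d\mathrm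 z=\operatorname{tr}(A)/\dim(\boldsymbol p)$. Each is $W_A(\mathrm z)=\operatorname{tr}(AK(\mathrm z))$ for a unique $K$ fixed by $T$ (its operator kernel); $\mathcal M_{\boldsymbol p}(\mathcal E)\subset\mathcal B(\mathcal H_{\boldsymbol p})$ is the set of all operator kernels. Writing $K=\frac1{\dim\boldsymbol p}\mathds 1+\sum_{(\boldsymbol a;\sigma),\boldsymbol a\ne(0,0)}\sum_{\gamma=1}^{m(\boldsymbol a)}\overline{c^\sigma_\gamma(\boldsymbol a)}\sqrt{\dim\boldsymbol a/\dim\boldsymbol p}\;\boldsymbol e((\boldsymbol a;\sigma);\boldsymbol 0_{\boldsymbol a},J^\gamma_{\boldsymbol a})$, the characteristic matrix $\mathbf C(\boldsymbol a)$ is the $m(\boldsymbol a)\times\mathfrak m(\boldsymbol p;\boldsymbol a)$ matrix with $\gamma\times\sigma$ entry $c^\sigma_\gamma(\boldsymbol a)$, and $\mathbf C(0,0)=1$. These matrices satisfy $\overline{\mathbf C(\boldsymbol a)}=\mathbf C(\check{\boldsymbol a})$. *)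

theory Defs
  imports "HOL-Analysis.Analysis" "Jordan_Normal_Form.Matrix"
begin

text \<open>Fixed-size matrices (elements of SU(3), operators on the representation space) are those of
  HOL-Analysis; matrices whose size depends on the labels (characteristic matrices, frames) are
  those of the theory Jordan_Normal_Form.Matrix.\<close>

hide_const (open) Matrix.mat Matrix.vec Matrix.row Matrix.col
no_notation vec_index (infixl "$" 100)

section \<open>Smooth maps\<close>

primrec Ck_on :: "nat \<Rightarrow> 'a::euclidean_space set \<Rightarrow> ('a \<Rightarrow> 'b::real_normed_vector) \<Rightarrow> bool" where
  "Ck_on 0 U f = continuous_on U f"
| "Ck_on (Suc k) U f =
     (\<exists>f'. (\<forall>x\<in>U. (f has_derivative f' x) (at x)) \<and> (\<forall>v. Ck_on k U (\<lambda>x. f' x v)))"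

text \<open>Smoothness on an embedded submanifold: local smooth extensions to the ambient space.\<close>

definition smooth_submfd :: "'a::euclidean_space set \<Rightarrow> ('a \<Rightarrow> 'b::real_normed_vector) \<Rightarrow> bool" where
  "smooth_submfd S f \<longleftrightarrow>
     (\<forall>x\<in>S. \<exists>U F. open U \<and> x \<in> U \<and> (\<forall>k. Ck_on k U F) \<and> (\<forall>y\<in>U \<inter> S. F y = f y))"

section \<open>Quotient topology\<close>

definition quot_topology :: "'a topology \<Rightarrow> ('a \<Rightarrow> 'b) \<Rightarrow> 'b topology" where
  "quot_topology X f =
     topology (\<lambda>U. U \<subseteq> f ` topspace X \<and> openin X {x \<in> topspace X. f x \<in> U})"

lemma openin_quot_topology:
  "openin (quot_topology X f) U \<longleftrightarrow>
     U \<subseteq> f ` topspace X \<and> openin X {x \<in> topspace X. f x \<in> U}"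
proof -
  have "istopology (\<lambda>U. U \<subseteq> f ` topspace X \<and> openin X {x \<in> topspace X. f x \<in> U})"
    unfolding istopology_def
  proof (intro conjI allI impI)
    fix S T
    assume "S \<subseteq> f ` topspace X \<and> openin X {x \<in> topspace X. f x \<in> S}"
      and "T \<subseteq> f ` topspace X \<and> openin X {x \<in> topspace X. f x \<in> T}"
    moreover have "{x \<in> topspace X. f x \<in> S \<inter> T} =
        {x \<in> topspace X. f x \<in> S} \<inter> {x \<in> topspace X. f x \<in> T}"
      by auto
    ultimately show "S \<inter> T \<subseteq> f ` topspace X" "openin X {x \<in> topspace X. f x \<in> S \<inter> T}"
      by auto
  next
    fix \<U> assume *: "\<forall>U\<in>\<U>. U \<subseteq> f ` topspace X \<and> openin X {x \<in> topspace X. f x \<in> U}"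
    then show "\<Union>\<U> \<subseteq> f ` topspace X"
      by auto
    have "{x \<in> topspace X. f x \<in> \<Union>\<U>} = (\<Union>U\<in>\<U>. {x \<in> topspace X. f x \<in> U})"
      by auto
    with * show "openin X {x \<in> topspace X. f x \<in> \<Union>\<U>}"
      by auto
  qed
  then show ?thesis
    by (simp add: quot_topology_def topology_inverse')
qed

lemma quotient_map_quot_topology: "quotient_map X (quot_topology X f) f"
proof -
  have "openin X {x \<in> topspace X. f x \<in> f ` topspace X}"
    using openin_topspace[of X] by (simp cong: conj_cong)
  then have "topspace (quot_topology X f) = f ` topspace X"
    unfolding topspace_def[of "quot_topology X f"] openin_quot_topology by auto
  then show ?thesis
    by (auto simp: quotient_map_def openin_quot_topology)
qed

section \<open>SU(3), its maximal torus and the flag manifold\<close>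

definition adj :: "complex^'n^'m \<Rightarrow> complex^'m^'n" where
  "adj A = map_matrix cnj (transpose A)"

definition cscale :: "complex \<Rightarrow> complex^'n^'m \<Rightarrow> complex^'n^'m" where
  "cscale c A = map_matrix ((*) c) A"

definition SU3 :: "(complex^3^3) set" where
  "SU3 = {g. adj g ** g = mat 1 \<and> det g = 1}"

definition torus :: "(complex^3^3) set" where
  "torus = {t \<in> SU3. \<forall>i j. i \<noteq> j \<longrightarrow> t $ i $ j = 0}"

text \<open>Points of the flag manifold are the left cosets \<open>g T\<close>; the base point is \<open>T\<close> itself.\<close>

definition flag_proj :: "complex^3^3 \<Rightarrow> (complex^3^3) set" where
  "flag_proj g = (\<lambda>t. g ** t) ` torus"

definition flags :: "(complex^3^3) set set" where
  "flags = flag_proj ` SU3"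

definition flag_base :: "(complex^3^3) set" where
  "flag_base = torus"

definition flag_act :: "complex^3^3 \<Rightarrow> (complex^3^3) set \<Rightarrow> (complex^3^3) set" where
  "flag_act g z = (\<lambda>h. g ** h) ` z"

definition flag_topology :: "(complex^3^3) set topology" where
  "flag_topology = quot_topology (top_of_set SU3) flag_proj"

definition flag_borel :: "(complex^3^3) set measure" where
  "flag_borel = sigma flags {U. openin flag_topology U}"

definition invariant_prob :: "(complex^3^3) set measure \<Rightarrow> bool" where
  "invariant_prob \<mu> \<longleftrightarrow> sets \<mu> = sets flag_borel \<and> emeasure \<mu> flags = 1 \<and>
     (\<forall>g\<in>SU3. distr \<mu> \<mu> (flag_act g) = \<mu>)"

text \<open>Since \<open>SU3 \<rightarrow> SU3/T\<close> is a surjective submersion, a function on the quotient is smooth iff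
  its pullback is. Functions on the flag manifold are taken to be undefined off it.\<close>

definition Cinf_flags :: "((complex^3^3) set \<Rightarrow> complex) set" where
  "Cinf_flags = {f \<in> extensional flags. smooth_submfd SU3 (\<lambda>g. f (flag_proj g))}"

section \<open>Representations of SU(3) and of its complexified Lie algebra\<close>

text \<open>An action is a function \<open>\<alpha> g v\<close> on a real normed vector space that carries a complex scalar
  multiplication \<open>s\<close>; for the representation space itself \<open>s\<close> is \<open>(*s)\<close>, for operators it is
  \<open>cscale\<close>.\<close>

definition mexp :: "complex^3^3 \<Rightarrow> complex^3^3" where
  "mexp X = (\<Sum>k. (1 / fact k) *\<^sub>R (((**) X ^^ k) (mat 1)))"

definition lie_act :: "(complex^3^3 \<Rightarrow> 'v \<Rightarrow> 'v) \<Rightarrow> complex^3^3 \<Rightarrow> 'v \<Rightarrow> 'v::real_normed_vector" where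
  "lie_act \<alpha> X v = vector_derivative (\<lambda>t. \<alpha> (mexp (t *\<^sub>R X)) v) (at 0)"

text \<open>Complex-linear extension from su(3) to sl(3), via the decomposition \<open>Z = X + \<i> Y\<close> with
  \<open>X = (Z - Z\<^sup>\<dagger>) / 2\<close> and \<open>Y = (Z + Z\<^sup>\<dagger>) / (2 \<i>)\<close> antihermitian.\<close>

definition sl_act ::
  "(complex \<Rightarrow> 'v \<Rightarrow> 'v) \<Rightarrow> (complex^3^3 \<Rightarrow> 'v \<Rightarrow> 'v) \<Rightarrow> complex^3^3 \<Rightarrow> 'v \<Rightarrow> 'v::real_normed_vector" where
  "sl_act s \<alpha> Z v = lie_act \<alpha> (cscale (1/2) (Z - adj Z)) v
                    + s \<i> (lie_act \<alpha> (cscale (1 / (2 * \<i>)) (Z + adj Z)) v)"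

definition Eij :: "3 \<Rightarrow> 3 \<Rightarrow> complex^3^3" where
  "Eij i j = (\<chi> k l. if k = i \<and> l = j then 1 else 0)"

definition "T_plus s \<alpha> = sl_act s \<alpha> (Eij 1 2)"
definition "T_minus s \<alpha> = sl_act s \<alpha> (Eij 2 1)"
definition "T_three s \<alpha> = sl_act s \<alpha> (cscale (1/2) (Eij 1 1 - Eij 2 2))"
definition "U_plus s \<alpha> = sl_act s \<alpha> (Eij 2 3)"
definition "U_minus s \<alpha> = sl_act s \<alpha> (Eij 3 2)"
definition "U_three s \<alpha> = sl_act s \<alpha> (cscale (1/2) (Eij 2 2 - Eij 3 3))"

definition highest_weight_vec ::
  "(complex \<Rightarrow> 'v \<Rightarrow> 'v) \<Rightarrow> (complex^3^3 \<Rightarrow> 'v \<Rightarrow> 'v) \<Rightarrow> nat \<times> nat \<Rightarrow> 'v::real_normed_vector \<Rightarrow> bool" where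
  "highest_weight_vec s \<alpha> a v \<longleftrightarrow> v \<noteq> 0 \<and> T_plus s \<alpha> v = 0 \<and> U_plus s \<alpha> v = 0 \<and>
     T_three s \<alpha> v = s (of_nat (fst a) / 2) v \<and> U_three s \<alpha> v = s (of_nat (snd a) / 2) v"

definition invariant_subspace ::
  "(complex \<Rightarrow> 'v \<Rightarrow> 'v) \<Rightarrow> (complex^3^3 \<Rightarrow> 'v \<Rightarrow> 'v) \<Rightarrow> 'v::real_normed_vector set \<Rightarrow> bool" where
  "invariant_subspace s \<alpha> S \<longleftrightarrow> module.subspace s S \<and> (\<forall>g\<in>SU3. \<forall>v\<in>S. \<alpha> g v \<in> S)"

text \<open>The action restricts on \<open>S\<close> to an irreducible representation of highest weight \<open>a\<close>.\<close>

definition is_irrep ::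
  "(complex \<Rightarrow> 'v \<Rightarrow> 'v) \<Rightarrow> (complex^3^3 \<Rightarrow> 'v \<Rightarrow> 'v) \<Rightarrow> 'v::real_normed_vector set \<Rightarrow> nat \<times> nat \<Rightarrow> bool" where
  "is_irrep s \<alpha> S a \<longleftrightarrow> invariant_subspace s \<alpha> S \<and>
     (\<forall>R. R \<subseteq> S \<and> invariant_subspace s \<alpha> R \<longrightarrow> R = {0} \<or> R = S) \<and>
     (\<exists>v\<in>S. highest_weight_vec s \<alpha> a v)"

text \<open>Representations of the Lie group SU(3) are smooth homomorphisms. The Hilbert space of the
  irrep is identified with \<open>\<complex>\<^sup>n\<close> by an orthonormal basis indexed by \<open>'n\<close>.\<close>

definition unitary_irrep :: "nat \<times> nat \<Rightarrow> (complex^3^3 \<Rightarrow> complex^'n^'n) \<Rightarrow> bool" where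
  "unitary_irrep p \<rho> \<longleftrightarrow>
     \<rho> (mat 1) = mat 1 \<and> (\<forall>g\<in>SU3. \<forall>h\<in>SU3. \<rho> (g ** h) = \<rho> g ** \<rho> h) \<and>
     (\<forall>g\<in>SU3. adj (\<rho> g) ** \<rho> g = mat 1) \<and> smooth_submfd SU3 \<rho> \<and>
     is_irrep (*s) (\<lambda>g v. \<rho> g *v v) UNIV p"

definition irrep_dim :: "nat \<times> nat \<Rightarrow> real" where
  "irrep_dim a = (real (fst a) + 1) * (real (snd a) + 1) * (real (fst a) + real (snd a) + 2) / 2"

definition conj_act :: "(complex^3^3 \<Rightarrow> complex^'n^'n) \<Rightarrow> complex^3^3 \<Rightarrow> complex^'n^'n \<Rightarrow> complex^'n^'n" where
  "conj_act \<rho> g A = \<rho> g ** A ** matrix_inv (\<rho> g)"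

definition hs_inner :: "complex^'n^'n \<Rightarrow> complex^'n^'n \<Rightarrow> complex" where
  "hs_inner A B = trace (adj A ** B)"

section \<open>Gelfand-Tsetlin bases\<close>

type_synonym gt_label = "(int \<times> int \<times> int) \<times> real"

definition gt_labels :: "nat \<times> nat \<Rightarrow> gt_label set" where
  "gt_labels = (\<lambda>(p, q).
     {((int p + 2 * int q - (rp + rm), rp + rm - \<nu>3, \<nu>3), real_of_int (rp - rm) / 2) | rm rp \<nu>3.
        0 \<le> rm \<and> rm \<le> int q \<and> int q \<le> rp \<and> rp \<le> int p + int q \<and> rm \<le> \<nu>3 \<and> \<nu>3 \<le> rp})"

text \<open>The operator-valued case only, as the decomposition of \<open>B(H)\<close> is all that is needed. In the
  lowering formulas a vector whose label is not admissible has coefficient zero (in particular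
  \<open>0 / 0 = 0\<close> for \<open>J = 0\<close>).\<close>

definition gt_basis ::
  "(complex^3^3 \<Rightarrow> complex^'n^'n \<Rightarrow> complex^'n^'n) \<Rightarrow> (complex^'n^'n) set \<Rightarrow> nat \<times> nat \<Rightarrow>
   (int \<times> int \<times> int \<Rightarrow> real \<Rightarrow> complex^'n^'n) \<Rightarrow> bool" where
  "gt_basis \<alpha> S a e \<longleftrightarrow>
     module.span cscale {e \<nu> J | \<nu> J. (\<nu>, J) \<in> gt_labels a} = S \<and>
     (\<forall>(\<nu>, J)\<in>gt_labels a. \<forall>(\<nu>', J')\<in>gt_labels a.
        hs_inner (e \<nu> J) (e \<nu>' J') = (if (\<nu>, J) = (\<nu>', J') then 1 else 0)) \<and>
     highest_weight_vec cscale \<alpha> a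
       (e (int (fst a) + int (snd a), int (snd a), 0) (real (snd a) / 2)) \<and>
     (\<forall>((\<nu>1, \<nu>2, \<nu>3), J)\<in>gt_labels a.
        let p = real (fst a); q = real (snd a); u = real_of_int (\<nu>2 - \<nu>3) / 2; n3 = real_of_int \<nu>3 in
        U_minus cscale \<alpha> (e (\<nu>1, \<nu>2, \<nu>3) J) =
          cscale (of_real (sqrt ((J + u) * (J - u + 1)))) (e (\<nu>1, \<nu>2 - 1, \<nu>3 + 1) J) \<and>
        T_minus cscale \<alpha> (e (\<nu>1, \<nu>2, \<nu>3) J) =
          cscale (of_real (sqrt ((J - u) * (p + q + J - u - n3 + 1) * (q + J - u - n3) * (u - J + n3 + 1)
                                  / (2 * J * (2 * J + 1)))))
            (e (\<nu>1 - 1, \<nu>2 + 1, \<nu>3) (J - 1/2)) +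
          cscale (of_real (sqrt ((J + u + 1) * (p + q - J - u - n3) * (J + u + 1 + n3 - q) * (J + u + 2 + n3)
                                  / (2 * (J + 1) * (2 * J + 1)))))
            (e (\<nu>1 - 1, \<nu>2 + 1, \<nu>3) (J + 1/2)))"

definition dual_label :: "nat \<times> nat \<Rightarrow> int \<times> int \<times> int \<Rightarrow> int \<times> int \<times> int" where
  "dual_label = (\<lambda>(a, b) (\<nu>1, \<nu>2, \<nu>3).
     (int (a + b) - \<nu>1, int (a + b) - \<nu>2, int (a + b) - \<nu>3))"

text \<open>A fixed decomposition of \<open>B(H)\<close>: \<open>m a\<close> counts the summands of type \<open>a\<close>, i.e. it is the
  multiplicity of \<open>a\<close> in \<open>p \<otimes> p\<^sup>*\<close>; \<open>V a \<sigma>\<close>, \<open>1 \<le> \<sigma> \<le> m a\<close>, are these summands and \<open>e a \<sigma>\<close>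
  their Gelfand-Tsetlin bases. The exponent \<open>\<nu>1 - \<nu>3\<close> is \<open>2 (t + u)\<close>.\<close>

definition gt_decomposition ::
  "nat \<times> nat \<Rightarrow> (complex^3^3 \<Rightarrow> complex^'n^'n) \<Rightarrow> (nat \<times> nat \<Rightarrow> nat) \<Rightarrow>
   (nat \<times> nat \<Rightarrow> nat \<Rightarrow> (complex^'n^'n) set) \<Rightarrow>
   (nat \<times> nat \<Rightarrow> nat \<Rightarrow> int \<times> int \<times> int \<Rightarrow> real \<Rightarrow> complex^'n^'n) \<Rightarrow> bool" where
  "gt_decomposition p \<rho> m V e \<longleftrightarrow>
     (\<forall>a. \<forall>\<sigma>\<in>{1..m a}. is_irrep cscale (conj_act \<rho>) (V a \<sigma>) a) \<and>
     (\<forall>a b. \<forall>\<sigma>\<in>{1..m a}. \<forall>\<tau>\<in>{1..m b}. (a, \<sigma>) \<noteq> (b, \<tau>) \<longrightarrow>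
        (\<forall>A\<in>V a \<sigma>. \<forall>B\<in>V b \<tau>. hs_inner A B = 0)) \<and>
     module.span cscale (\<Union>a. \<Union>\<sigma>\<in>{1..m a}. V a \<sigma>) = UNIV \<and>
     (\<forall>a. \<forall>\<sigma>\<in>{1..m a}. gt_basis (conj_act \<rho>) (V a \<sigma>) a (e a \<sigma>)) \<and>
     (\<forall>a. \<forall>\<sigma>\<in>{1..m a}. \<forall>((\<nu>1, \<nu>2, \<nu>3), J)\<in>gt_labels a.
        adj (e a \<sigma> (\<nu>1, \<nu>2, \<nu>3) J) =
          cscale ((-1) powi (\<nu>1 - \<nu>3)) (e (prod.swap a) \<sigma> (dual_label a (\<nu>1, \<nu>2, \<nu>3)) J)) \<and>
     e (0, 0) 1 (0, 0, 0) 0 = cscale (of_real (1 / sqrt (irrep_dim p))) (mat 1)"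

section \<open>Symbol correspondences and operator kernels\<close>

definition symbol_correspondence ::
  "nat \<times> nat \<Rightarrow> (complex^3^3 \<Rightarrow> complex^'n^'n) \<Rightarrow> (complex^3^3) set measure \<Rightarrow>
   (complex^'n^'n \<Rightarrow> (complex^3^3) set \<Rightarrow> complex) \<Rightarrow> bool" where
  "symbol_correspondence p \<rho> \<mu> W \<longleftrightarrow>
     (\<forall>A. W A \<in> Cinf_flags) \<and>
     (\<forall>A B. \<forall>z\<in>flags. W (A + B) z = W A z + W B z) \<and>
     (\<forall>c A. \<forall>z\<in>flags. W (cscale c A) z = c * W A z) \<and>
     inj W \<and>
     (\<forall>g\<in>SU3. \<forall>A. \<forall>z\<in>flags. W (conj_act \<rho> g A) z = W A (flag_act (matrix_inv g) z)) \<and>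
     (\<forall>A. \<forall>z\<in>flags. W (adj A) z = cnj (W A z)) \<and>
     (\<forall>A. (\<integral>z. W A z \<partial>\<mu>) = trace A / of_real (irrep_dim p))"

definition operator_kernel ::
  "(complex^3^3 \<Rightarrow> complex^'n^'n) \<Rightarrow> (complex^'n^'n \<Rightarrow> (complex^3^3) set \<Rightarrow> complex) \<Rightarrow>
   complex^'n^'n \<Rightarrow> bool" where
  "operator_kernel \<rho> W K \<longleftrightarrow>
     (\<forall>t\<in>torus. conj_act \<rho> t K = K) \<and>
     (\<forall>A. \<forall>g\<in>SU3. W A (flag_act g flag_base) = trace (A ** conj_act \<rho> g K))"

definition moduli_space ::
  "nat \<times> nat \<Rightarrow> (complex^3^3 \<Rightarrow> complex^'n^'n) \<Rightarrow> (complex^3^3) set measure \<Rightarrow> (complex^'n^'n) set" where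
  "moduli_space p \<rho> \<mu> = {K. \<exists>W. symbol_correspondence p \<rho> \<mu> W \<and> operator_kernel \<rho> W K}"

section \<open>Characteristic matrices\<close>

definition zero_mult :: "nat \<times> nat \<Rightarrow> nat" where
  "zero_mult a = min (fst a) (snd a) + 1"

definition zero_label :: "nat \<times> nat \<Rightarrow> int \<times> int \<times> int" where
  "zero_label a = (let c = int ((fst a + 2 * snd a) div 3) in (c, c, c))"

definition zero_J :: "nat \<times> nat \<Rightarrow> nat \<Rightarrow> real" where
  "zero_J a \<gamma> = real \<gamma> - 1 + \<bar>real (fst a) - real (snd a)\<bar> / 3"

definition char_coeffs ::
  "nat \<times> nat \<Rightarrow> (nat \<times> nat \<Rightarrow> nat) \<Rightarrow>
   (nat \<times> nat \<Rightarrow> nat \<Rightarrow> int \<times> int \<times> int \<Rightarrow> real \<Rightarrow> complex^'n^'n) \<Rightarrow> complex^'n^'n \<Rightarrow>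
   nat \<times> nat \<Rightarrow> nat \<Rightarrow> nat \<Rightarrow> complex" where
  "char_coeffs p m e K = (SOME c.
     K = cscale (of_real (1 / irrep_dim p)) (mat 1) +
       (\<Sum>a | a \<noteq> (0, 0) \<and> 0 < m a. \<Sum>\<sigma>=1..m a. \<Sum>\<gamma>=1..zero_mult a.
          cscale (cnj (c a \<sigma> \<gamma>) * of_real (sqrt (irrep_dim a / irrep_dim p)))
            (e a \<sigma> (zero_label a) (zero_J a \<gamma>))))"

text \<open>Rows and columns of the matrix are numbered from 0, the indices \<open>\<gamma>\<close> and \<open>\<sigma>\<close> from 1.\<close>

definition char_matrix ::
  "nat \<times> nat \<Rightarrow> (nat \<times> nat \<Rightarrow> nat) \<Rightarrow>
   (nat \<times> nat \<Rightarrow> nat \<Rightarrow> int \<times> int \<times> int \<Rightarrow> real \<Rightarrow> complex^'n^'n) \<Rightarrow> complex^'n^'n \<Rightarrow>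
   nat \<times> nat \<Rightarrow> complex Matrix.mat" where
  "char_matrix p m e K a =
     (if a = (0, 0) then 1\<^sub>m 1
      else Matrix.mat (zero_mult a) (m a) (\<lambda>(i, j). char_coeffs p m e K a (j + 1) (i + 1)))"

section \<open>Noncompact Stiefel manifolds\<close>

definition GL :: "nat \<Rightarrow> 'a::real_normed_field Matrix.mat set" where
  "GL n = {A \<in> carrier_mat n n. invertible_mat A}"

text \<open>The subgroup fixing pointwise the span of the first \<open>k\<close> standard basis vectors; the choice of
  the \<open>k\<close>-dimensional subspace only changes the subgroup by conjugation.\<close>

definition GL_fix :: "nat \<Rightarrow> nat \<Rightarrow> 'a::real_normed_field Matrix.mat set" where
  "GL_fix n k = {h \<in> GL n. \<forall>v\<in>carrier_vec n.
     (\<forall>i. k \<le> i \<and> i < n \<longrightarrow> vec_index v i = 0) \<longrightarrow> h *\<^sub>v v = v}"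

definition stiefel_proj :: "nat \<Rightarrow> nat \<Rightarrow> 'a::real_normed_field Matrix.mat \<Rightarrow> 'a Matrix.mat set" where
  "stiefel_proj n k g = (\<lambda>h. g * h) ` GL_fix n k"

definition mat_topology :: "nat \<Rightarrow> nat \<Rightarrow> 'a::real_normed_field Matrix.mat topology" where
  "mat_topology n k = pullback_topology (carrier_mat n k)
     (\<lambda>A. restrict (\<lambda>ij. A $$ ij) ({..<n} \<times> {..<k}))
     (product_topology (\<lambda>_. euclidean) ({..<n} \<times> {..<k}))"

text \<open>\<open>V\<^sub>k(K\<^sup>n)\<close>: the set of left cosets \<open>g GL_fix n k\<close> with the quotient topology.\<close>

definition stiefel :: "nat \<Rightarrow> nat \<Rightarrow> 'a::real_normed_field Matrix.mat set topology" where
  "stiefel n k = quot_topology (subtopology (mat_topology n n) (GL n)) (stiefel_proj n k)"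

text \<open>The coset corresponding to a complex \<open>n \<times> k\<close> matrix \<open>C\<close>, viewed as the \<open>k\<close>-tuple of its
  columns: all invertible \<open>g\<close> over the field \<open>K\<close> (embedded in the complex numbers by \<open>\<iota>\<close>) that
  send the first \<open>k\<close> standard basis vectors to the columns of \<open>C\<close>. If the columns of \<open>C\<close> are not
  linearly independent, or not vectors over \<open>K\<close>, this set is empty, hence not a coset.\<close>

definition frame_coset ::
  "('a::real_normed_field \<Rightarrow> complex) \<Rightarrow> nat \<Rightarrow> nat \<Rightarrow> complex Matrix.mat \<Rightarrow> 'a Matrix.mat set" where
  "frame_coset \<iota> n k C = {g \<in> GL n. \<forall>i<n. \<forall>j<k. \<iota> (g $$ (i, j)) = C $$ (i, j)}"

end

theory Submission
  imports Defs "Jordan_Normal_Form.Determinant"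
begin

hide_const (open) Matrix.mat Matrix.vec Matrix.row Matrix.col Determinant.det
no_notation vec_index (infixl "$" 100)

text \<open>
  An operator \<open>K\<close> is an operator kernel iff it is fixed by the torus, Hermitian, of trace 1 and its orbit
  spans the operator space; the condition on the mean value is then automatic, because by irreducibility an
  invariant functional is a multiple of the trace. The operators fixed by the torus are the combinations
  of Gelfand-Tsetlin vectors of weight zero, and Hermiticity relates the coefficients for \<open>(a, b)\<close> to
  those for \<open>(b, a)\<close>. The operators orthogonal to the orbit of \<open>K\<close> form an invariant subspace; if
  it is nonzero, it contains a highest weight vector, that is, a combination over \<open>\<sigma>\<close> of highest weight
  vectors of the copies of one irrep \<open>(a, b)\<close>. Lowering it to weight zero turns orthogonality into a linear
  dependence between the columns of the characteristic matrix, so the orbit of \<open>K\<close> spans iff all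
  characteristic matrices have independent columns. A matrix with independent columns is a class of
  invertible matrices with the same first columns, and taking the first columns is an open map, whence
  the homeomorphism.
\<close>

section \<open>Complex matrices and SU(3)\<close>

text \<open>The data are given at group level: \<rho> is a smooth homomorphism, and of the
  Gelfand-Tsetlin vectors, besides orthonormality and the adjoint rule, only the highest weight and
  the lowering formulas are prescribed. The Lie algebra action, its brackets, the raising formulas
  and the weights of the vectors have to be derived. Exponentials occur only for real multiples of
  generators X with X^3 = -X, where they are trigonometric polynomials; linearity of the
  differential of \<rho> does the rest. Likewise \<open>m\<close> is merely the counting function of
  a decomposition. That it has finite support, is zero at (a, a) for a > |p|, is symmetric under
  duality and equals 1 at (0, 0) comes from weight bounds, from adjoints of lowest weight vectors
  and from Schur's lemma. Finally, reading cosets as frames requires \<open>m a\<close> <=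
  \<open>zero_mult a\<close>. No multiplicity is computed for this: one explicit operator kernel,
  the projection onto a highest weight vector, already forces all its characteristic matrices to
  have independent columns.\<close>

lemmas veq = Finite_Cartesian_Product.vec_eq_iff

lemma mat_nth: "mat c $ i $ j = (if i = j then c else 0)"
  by (simp add: Finite_Cartesian_Product.mat_def)

lemma scaleR_complex: "r *\<^sub>R (z::complex) = of_real r * z"
  by (simp add: scaleR_conv_of_real)

lemma adj_nth [simp]: "adj A $ i $ j = cnj (A $ j $ i)"
  by (simp add: adj_def transpose_def)

lemma cscale_nth [simp]: "cscale c A $ i $ j = c * A $ i $ j"
  by (simp add: cscale_def)

lemma adj_adj [simp]: "adj (adj A) = A"
  by (simp add: veq)

lemma adj_mult: "adj (A ** B) = adj B ** adj A"
  by (simp add: veq matrix_matrix_mult_def mult.commute)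

lemma adj_mat_one [simp]: "adj (mat 1) = mat 1"
  by (simp add: veq mat_nth)

lemma adj_add: "adj (A + B) = adj A + adj B"
  by (simp add: veq)

lemma adj_diff: "adj (A - B) = adj A - adj B"
  by (simp add: veq)

lemma adj_uminus: "adj (- A) = - adj A"
  by (simp add: veq)

lemma adj_scaleR: "adj (r *\<^sub>R A) = r *\<^sub>R adj A"
  by (simp add: veq scaleR_complex)

lemma adj_cscale: "adj (cscale c A) = cscale (cnj c) (adj A)"
  by (simp add: veq)

lemma linear_adj: "linear (adj :: complex^'n^'m \<Rightarrow> _)"
  by (simp add: linear_iff adj_add adj_scaleR)

lemma bounded_linear_adj: "bounded_linear (adj :: complex^'n^'m \<Rightarrow> _)"
  using linear_adj linear_conv_bounded_linear by blast

lemma cscale_scaleR: "cscale (of_real r) A = r *\<^sub>R A"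
  by (simp add: veq scaleR_complex)

lemma cscale_cscale: "cscale a (cscale b A) = cscale (a * b) A"
  by (simp add: veq)

lemma cscale_mult_left: "cscale c A ** B = cscale c (A ** B)"
  by (simp add: veq matrix_matrix_mult_def sum_distrib_left mult.assoc)

lemma cscale_mult_right: "A ** cscale c B = cscale c (A ** B)"
  by (simp add: veq matrix_matrix_mult_def sum_distrib_left algebra_simps)

lemma vector_space_cscale: "vector_space (cscale :: complex \<Rightarrow> complex^'n^'m \<Rightarrow> _)"
  by unfold_locales (simp_all add: veq algebra_simps)

lemma bounded_bilinear_matrix_mult:
  "bounded_bilinear ((**) :: complex^'n^'m \<Rightarrow> complex^'k^'n \<Rightarrow> complex^'k^'m)"
proof -
  have "bilinear ((**) :: complex^'n^'m \<Rightarrow> complex^'k^'n \<Rightarrow> complex^'k^'m)"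
    by (auto simp: bilinear_def linear_iff veq matrix_matrix_mult_def sum.distrib
        algebra_simps scaleR_sum_right)
  then show ?thesis
    by (simp add: bilinear_conv_bounded_bilinear)
qed

interpretation matmul: bounded_bilinear "(**) :: complex^'n^'m \<Rightarrow> complex^'k^'n \<Rightarrow> complex^'k^'m"
  by (rule bounded_bilinear_matrix_mult)

lemma unitary_right: "adj U ** U = mat 1 \<Longrightarrow> U ** adj U = mat 1" for U :: "complex^'n^'n"
  by (simp add: matrix_left_right_inverse)

lemma matrix_inv_unitary: "adj U ** U = mat 1 \<Longrightarrow> matrix_inv U = adj U" for U :: "complex^'n^'n"
proof -
  assume *: "adj U ** U = mat 1"
  have "U ** matrix_inv U = mat 1 \<and> matrix_inv U ** U = mat 1"
    unfolding matrix_inv_def by (rule someI[of _ "adj U"]) (simp add: * unitary_right)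
  then show ?thesis
    by (metis * matrix_mul_assoc matrix_mul_lid matrix_mul_rid)
qed

lemma det_adj: "det (adj A) = cnj (det A)" for A :: "complex^3^3"
  by (simp add: det_3 algebra_simps)

lemma SU3_one [simp]: "mat 1 \<in> SU3"
  by (simp add: SU3_def)

lemma SU3_mult: "g \<in> SU3 \<Longrightarrow> h \<in> SU3 \<Longrightarrow> g ** h \<in> SU3"
  unfolding SU3_def mem_Collect_eq adj_mult det_mul
  by (metis matrix_mul_assoc matrix_mul_lid mult_1)

lemma SU3_unitary: "g \<in> SU3 \<Longrightarrow> adj g ** g = mat 1" "g \<in> SU3 \<Longrightarrow> g ** adj g = mat 1"
  by (simp_all add: SU3_def unitary_right)

lemma SU3_adj: "g \<in> SU3 \<Longrightarrow> adj g \<in> SU3"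
  by (simp add: SU3_def det_adj unitary_right)

lemma SU3_matrix_inv: "g \<in> SU3 \<Longrightarrow> matrix_inv g = adj g"
  by (simp add: SU3_def matrix_inv_unitary)

definition mat3 :: "'a \<Rightarrow> 'a \<Rightarrow> 'a \<Rightarrow> 'a \<Rightarrow> 'a \<Rightarrow> 'a \<Rightarrow> 'a \<Rightarrow> 'a \<Rightarrow> 'a \<Rightarrow> 'a::zero^3^3" where
  "mat3 a b c d e f g h i = vector [vector [a, b, c], vector [d, e, f], vector [g, h, i]]"

lemma mat3_nth [simp]:
  "mat3 a b c d e f g h i $ 1 $ 1 = a" "mat3 a b c d e f g h i $ 1 $ 2 = b" "mat3 a b c d e f g h i $ 1 $ 3 = c"
  "mat3 a b c d e f g h i $ 2 $ 1 = d" "mat3 a b c d e f g h i $ 2 $ 2 = e" "mat3 a b c d e f g h i $ 2 $ 3 = f"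
  "mat3 a b c d e f g h i $ 3 $ 1 = g" "mat3 a b c d e f g h i $ 3 $ 2 = h" "mat3 a b c d e f g h i $ 3 $ 3 = i"
  by (simp_all add: mat3_def)

lemma eq_mat3_iff: "A = B \<longleftrightarrow>
    A $ 1 $ 1 = B $ 1 $ 1 \<and> A $ 1 $ 2 = B $ 1 $ 2 \<and> A $ 1 $ 3 = B $ 1 $ 3 \<and>
    A $ 2 $ 1 = B $ 2 $ 1 \<and> A $ 2 $ 2 = B $ 2 $ 2 \<and> A $ 2 $ 3 = B $ 2 $ 3 \<and>
    A $ 3 $ 1 = B $ 3 $ 1 \<and> A $ 3 $ 2 = B $ 3 $ 2 \<and> A $ 3 $ 3 = B $ 3 $ 3"
  for A B :: "'a^3^3"
  by (auto simp: veq forall_3)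

lemma Eij_mat3:
  "Eij 1 1 = mat3 1 0 0 0 0 0 0 0 0" "Eij 1 2 = mat3 0 1 0 0 0 0 0 0 0" "Eij 2 1 = mat3 0 0 0 1 0 0 0 0 0"
  "Eij 2 2 = mat3 0 0 0 0 1 0 0 0 0" "Eij 2 3 = mat3 0 0 0 0 0 1 0 0 0" "Eij 3 2 = mat3 0 0 0 0 0 0 0 1 0"
  "Eij 3 3 = mat3 0 0 0 0 0 0 0 0 1"
  by (simp_all add: eq_mat3_iff Eij_def)

lemmas mat3_simps = eq_mat3_iff matrix_matrix_mult_def sum_3 mat_nth Eij_mat3

section \<open>One-parameter subgroups\<close>

text \<open>If \<open>X\<^sup>3 = - X\<close>, then the exponential of \<open>t X\<close> is given by Rodrigues' formula.\<close>

definition rot :: "complex^3^3 \<Rightarrow> real \<Rightarrow> complex^3^3" where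
  "rot X t = mat 1 + sin t *\<^sub>R X + (1 - cos t) *\<^sub>R (X ** X)"

text \<open>The second condition stands in for X being antihermitian and traceless; on the explicit
  generators below it can be checked by computation.\<close>

definition rotgen :: "complex^3^3 \<Rightarrow> bool" where
  "rotgen X \<longleftrightarrow> X ** X ** X = - X \<and> (\<forall>t. rot X t \<in> SU3)"

lemma rot_0 [simp]: "rot X 0 = mat 1"
  by (simp add: rot_def)

text \<open>With X^3 = -X the product stays in the span of 1, X, X^2, where it reduces to the
  addition formulas of sine and cosine.\<close>

lemma rot_add:
  assumes "X ** X ** X = - X" shows "rot X (s + t) = rot X s ** rot X t"
proof -
  have 3: "X ** (X ** X) = - X" "X ** X ** (X ** X) = - (X ** X)"
    using assms by (simp_all add: matrix_mul_assoc matmul.minus_left)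
  have "rot X s ** rot X t = mat 1 + (sin s + sin t) *\<^sub>R X
     - (sin s * (1 - cos t) + sin t * (1 - cos s)) *\<^sub>R X
     + ((1 - cos s) + (1 - cos t) + sin s * sin t - (1 - cos s) * (1 - cos t)) *\<^sub>R (X ** X)"
    unfolding rot_def
    by (simp add: matmul.add_left matmul.add_right matmul.scaleR_left matmul.scaleR_right
        matmul.diff_left matmul.diff_right 3 assms algebra_simps)
  also have "\<dots> = mat 1 + sin (s + t) *\<^sub>R X + (1 - cos (s + t)) *\<^sub>R (X ** X)"
    unfolding sin_add cos_add by (simp add: algebra_simps)
  finally show ?thesis
    by (simp add: rot_def)
qed

lemma rot_has_vector_derivative_0: "(rot X has_vector_derivative X) (at 0)"
proof -
  have "((\<lambda>t. mat 1 + sin t *\<^sub>R X + (1 - cos t) *\<^sub>R (X ** X)) has_vector_derivative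
      (0 + cos 0 *\<^sub>R X + sin 0 *\<^sub>R (X ** X))) (at 0)"
    by (auto intro!: derivative_eq_intros simp: has_real_derivative_iff_has_vector_derivative[symmetric])
  then show ?thesis
    by (simp add: rot_def[abs_def])
qed

lemma mexp_rot:
  assumes "X ** X ** X = - X" shows "mexp (t *\<^sub>R X) = rot X t"
proof -
  have 3: "X ** (X ** X) = - X"
    using assms by (simp add: matrix_mul_assoc)
  \<comment> \<open>For k > 0 the powers of X alternate between multiples of X (odd k) and of X^2
    (even k), which \<open>sin_coeff\<close> and \<open>cos_coeff\<close> select with the right
    sign. At k = 0 that pattern would give -X^2 instead of 1, hence the correction term.\<close>
  have pow: "((**) (t *\<^sub>R X) ^^ k) (mat 1) =
     (if k = 0 then mat 1 + X ** X else 0) + (fact k * sin_coeff k * t ^ k) *\<^sub>R X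
       - (fact k * cos_coeff k * t ^ k) *\<^sub>R (X ** X)" for k
  proof (induction k)
    case 0
    show ?case by simp
  next
    case (Suc k)
    have s: "fact (Suc k) * sin_coeff (Suc k) = fact k * cos_coeff k"
      by (simp add: sin_coeff_Suc del: of_nat_Suc)
    have c: "fact (Suc k) * cos_coeff (Suc k) = - (fact k * sin_coeff k)"
      by (simp add: cos_coeff_Suc del: of_nat_Suc)
    have "((**) (t *\<^sub>R X) ^^ Suc k) (mat 1) = t *\<^sub>R (X **
        ((if k = 0 then mat 1 + X ** X else 0) + (fact k * sin_coeff k * t ^ k) *\<^sub>R X
       - (fact k * cos_coeff k * t ^ k) *\<^sub>R (X ** X)))"
      by (simp add: Suc matmul.scaleR_left)
    also have "\<dots> = (fact k * cos_coeff k * t ^ Suc k) *\<^sub>R X + (fact k * sin_coeff k * t ^ Suc k) *\<^sub>R (X ** X)"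
      by (simp add: matmul.add_right matmul.diff_right matmul.scaleR_right 3 algebra_simps)
    finally show ?case
      unfolding s c by (simp add: minus_mult_left[symmetric])
  qed
  have "(\<lambda>k. (1 / fact k) *\<^sub>R (((**) (t *\<^sub>R X) ^^ k) (mat 1))) =
     (\<lambda>k. (if k = 0 then mat 1 + X ** X else 0) + (sin_coeff k * t ^ k) *\<^sub>R X
       - (cos_coeff k * t ^ k) *\<^sub>R (X ** X))"
    unfolding pow by (auto simp: scaleR_add_right scaleR_diff_right)
  moreover have "(\<lambda>k. (if k = 0 then mat 1 + X ** X else 0) + (sin_coeff k * t ^ k) *\<^sub>R X
       - (cos_coeff k * t ^ k) *\<^sub>R (X ** X)) sums
     ((mat 1 + X ** X) + sin t *\<^sub>R X - cos t *\<^sub>R (X ** X))"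
    using sin_converges[of t] cos_converges[of t]
    by (intro sums_add sums_diff sums_scaleR_left sums_If_finite_set[of "{0}", simplified] sums_single)
       (auto intro: sums_single)
  ultimately show ?thesis
    unfolding mexp_def using sums_unique by (fastforce simp: rot_def algebra_simps)
qed

text \<open>The Pauli matrices times \<i>, embedded in the coordinates 1, 2 or 2, 3: A comes from
  the second, B from the first, C from the third Pauli matrix.\<close>

definition "genA12 = mat3 0 1 0 (-1) 0 0 0 0 (0::complex)"
definition "genB12 = mat3 0 \<i> 0 \<i> 0 0 0 0 (0::complex)"
definition "genC12 = mat3 \<i> 0 0 0 (-\<i>) 0 0 0 (0::complex)"
definition "genA23 = mat3 0 0 0 0 0 1 0 (-1) (0::complex)"
definition "genB23 = mat3 0 0 0 0 0 \<i> 0 \<i> (0::complex)"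
definition "genC23 = mat3 0 0 0 0 \<i> 0 0 0 (-\<i>::complex)"

lemmas gen_defs = genA12_def genB12_def genC12_def genA23_def genB23_def genC23_def

section \<open>Embedded copies of SU(2) and generation of SU(3)\<close>

definition "su12 a b = mat3 a b 0 (- cnj b) (cnj a) 0 0 0 (1::complex)"
definition "su23 a b = mat3 (1::complex) 0 0 0 a b 0 (- cnj b) (cnj a)"

lemma rot_gen:
  "rot genA12 t = su12 (of_real (cos t)) (of_real (sin t))"
  "rot genB12 t = su12 (of_real (cos t)) (\<i> * of_real (sin t))"
  "rot genC12 t = su12 (cis t) 0"
  "rot genA23 t = su23 (of_real (cos t)) (of_real (sin t))"
  "rot genB23 t = su23 (of_real (cos t)) (\<i> * of_real (sin t))"
  "rot genC23 t = su23 (cis t) 0"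
  by (simp_all add: rot_def gen_defs su12_def su23_def mat3_simps complex_eq_iff)

lemma gen_cubed:
  "genA12 ** genA12 ** genA12 = - genA12" "genB12 ** genB12 ** genB12 = - genB12"
  "genC12 ** genC12 ** genC12 = - genC12" "genA23 ** genA23 ** genA23 = - genA23"
  "genB23 ** genB23 ** genB23 = - genB23" "genC23 ** genC23 ** genC23 = - genC23"
  by (simp_all add: gen_defs mat3_simps)

lemma su12_SU3: "a * cnj a + b * cnj b = 1 \<Longrightarrow> su12 a b \<in> SU3"
  by (simp add: su12_def SU3_def mat3_simps det_3 mult.commute add.commute)

lemma su23_SU3: "a * cnj a + b * cnj b = 1 \<Longrightarrow> su23 a b \<in> SU3"
  by (simp add: su23_def SU3_def mat3_simps det_3 mult.commute add.commute)

lemma i_mult_cancel: "\<i> * x * (\<i> * y) = - (x * y)"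
  by (simp add: complex_eq_iff)

lemma sin_cos_squared_complex:
  "complex_of_real (cos t) * of_real (cos t) + of_real (sin t) * of_real (sin t) = 1"
  by (metis of_real_1 of_real_add of_real_mult power2_eq_square sin_cos_squared_add2)

lemma rotgen_gen: "rotgen genA12" "rotgen genB12" "rotgen genC12" "rotgen genA23" "rotgen genB23" "rotgen genC23"
  using sin_cos_squared_complex
  by (auto simp: rotgen_def gen_cubed rot_gen cis_cnj cis_mult i_mult_cancel
      intro!: su12_SU3 su23_SU3)

lemma rotgenD: "rotgen X \<Longrightarrow> X ** X ** X = - X" "rotgen X \<Longrightarrow> rot X t \<in> SU3"
  by (simp_all add: rotgen_def)

lemma mexp_rotgen: "rotgen X \<Longrightarrow> mexp (t *\<^sub>R (r *\<^sub>R X)) = rot X (t * r)"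
  by (metis mexp_rot rotgenD(1) scaleR_scaleR)

text \<open>Euler angles: an element of SU(2) is \<open>d(\<phi>) R(\<theta>) d(\<psi>)\<close> with \<open>R\<close> a real rotation and
  \<open>d(\<phi>)\<close> diagonal, and \<open>d(\<phi>)\<close> is conjugate by \<open>R(\<pi>/4)\<close> to a rotation generated by \<open>B\<close>.\<close>

lemma unit_pair_polar:
  fixes a b :: complex assumes "a * cnj a + b * cnj b = 1"
  obtains \<phi> \<theta> \<psi> where "a = cis (\<phi> + \<psi>) * of_real (cos \<theta>)" "b = cis (\<phi> - \<psi>) * of_real (sin \<theta>)"
proof -
  have "(cmod a)\<^sup>2 + (cmod b)\<^sup>2 = 1"
    using assms unfolding complex_norm_square[symmetric] of_real_add[symmetric] by (metis of_real_eq_1_iff)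
  then obtain \<theta> where \<theta>: "cmod a = cos \<theta>" "cmod b = sin \<theta>"
    by (rule sincos_total_2pi)
  define \<phi> where "\<phi> = (Arg a + Arg b) / 2"
  define \<psi> where "\<psi> = (Arg a - Arg b) / 2"
  have "\<phi> + \<psi> = Arg a" "\<phi> - \<psi> = Arg b"
    by (simp_all add: \<phi>_def \<psi>_def field_simps)
  then have "a = cis (\<phi> + \<psi>) * of_real (cos \<theta>)" "b = cis (\<phi> - \<psi>) * of_real (sin \<theta>)"
    using rcis_cmod_Arg[of a] rcis_cmod_Arg[of b]
    by (simp_all add: \<theta>[symmetric] rcis_def mult.commute)
  then show ?thesis
    by (rule that)
qed

text \<open>Column reduction: a product of an element of each embedded SU(2) can be given any unit
  vector as first column. If it shares the first column of g, the quotient fixes the first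
  coordinate and lies in the lower SU(2). Each SU(2) factor is a product of rotations by Euler
  angles.\<close>

lemma SU3_induct [consumes 1, case_names mult A12 B12 A23 B23]:
  assumes "g \<in> SU3"
    and mult: "\<And>g h. g \<in> SU3 \<Longrightarrow> h \<in> SU3 \<Longrightarrow> P g \<Longrightarrow> P h \<Longrightarrow> P (g ** h)"
    and A12: "\<And>t. P (rot genA12 t)" and B12: "\<And>t. P (rot genB12 t)"
    and A23: "\<And>t. P (rot genA23 t)" and B23: "\<And>t. P (rot genB23 t)"
  shows "P g"
proof -
  have c4: "complex_of_real (cos (pi/4)) * of_real (sin (pi/4)) = 1/2" "complex_of_real (sin (pi/4)) = of_real (cos (pi/4))"
    by (simp_all add: cos_45 sin_45 complex_eq_iff)
  have c4': "complex_of_real (cos (pi/4)) * (complex_of_real (cos (pi/4)) * x) = x / 2" for x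
    using c4 by (metis mult.assoc mult.commute times_divide_eq_right mult_1_right)
  have c5: "cos (pi/4) * cos (pi/4) = 1/2"
    by (simp add: cos_45)
  have P_mult: "P (g ** h)" "g ** h \<in> SU3" if "P g" "g \<in> SU3" "P h" "h \<in> SU3" for g h
    using that mult SU3_mult by auto
  note S = rotgenD(2)[OF rotgen_gen(1)] rotgenD(2)[OF rotgen_gen(2)] rotgenD(2)[OF rotgen_gen(4)] rotgenD(2)[OF rotgen_gen(5)]
  have cs: "cis t = of_real (cos t) + \<i> * of_real (sin t)" for t
    by (simp add: complex_eq_iff)
  have d12: "su12 (cis t) 0 = rot genA12 (pi/4) ** rot genB12 t ** rot genA12 (- (pi/4))" for t
    unfolding rot_gen by (simp add: su12_def mat3_simps c4 cs algebra_simps c4' c5 complex_eq_iff)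
  have d23: "su23 (cis t) 0 = rot genA23 (pi/4) ** rot genB23 t ** rot genA23 (- (pi/4))" for t
    unfolding rot_gen by (simp add: su23_def mat3_simps c4 cs algebra_simps c4' c5 complex_eq_iff)
  have cdd: "cis (s + t) = cis s * cis t" "cis (s - t) = cis s * cnj (cis t)" for s t
    by (simp_all add: cis_cnj cis_mult)
  have D12: "P (su12 (cis t) 0)" "su12 (cis t) 0 \<in> SU3" for t
    unfolding d12 by (intro P_mult A12 B12 S)+
  have D23: "P (su23 (cis t) 0)" "su23 (cis t) 0 \<in> SU3" for t
    unfolding d23 by (intro P_mult A23 B23 S)+
  have P12: "P (su12 a b)" if "a * cnj a + b * cnj b = 1" for a b
  proof -
    from unit_pair_polar[OF that] obtain \<phi> \<theta> \<psi>
      where ab: "a = cis (\<phi> + \<psi>) * of_real (cos \<theta>)" "b = cis (\<phi> - \<psi>) * of_real (sin \<theta>)" .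
    have "su12 a b = su12 (cis \<phi>) 0 ** rot genA12 \<theta> ** su12 (cis \<psi>) 0"
      unfolding rot_gen ab
      by (simp add: su12_def mat3_simps cdd algebra_simps)
    then show ?thesis
      by (simp only:) (intro P_mult D12 A12 S)
  qed
  have P23: "P (su23 a b)" if "a * cnj a + b * cnj b = 1" for a b
  proof -
    from unit_pair_polar[OF that] obtain \<phi> \<theta> \<psi>
      where ab: "a = cis (\<phi> + \<psi>) * of_real (cos \<theta>)" "b = cis (\<phi> - \<psi>) * of_real (sin \<theta>)" .
    have "su23 a b = su23 (cis \<phi>) 0 ** rot genA23 \<theta> ** su23 (cis \<psi>) 0"
      unfolding rot_gen ab
      by (simp add: su23_def mat3_simps cdd algebra_simps)
    then show ?thesis
      by (simp only:) (intro P_mult D23 A23 S)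
  qed
  define x y z where "x = g $ 1 $ 1" and "y = g $ 2 $ 1" and "z = g $ 3 $ 1"
  have "(adj g ** g) $ 1 $ 1 = 1"
    using SU3_unitary(1)[OF assms(1)] by (simp add: mat_nth)
  then have n: "x * cnj x + y * cnj y + z * cnj z = 1"
    by (simp add: x_def y_def z_def matrix_matrix_mult_def sum_3 mult.commute)
  define b where "b = sqrt ((cmod y)\<^sup>2 + (cmod z)\<^sup>2)"
  have b: "complex_of_real b * of_real b = y * cnj y + z * cnj z"
    unfolding complex_norm_square[symmetric] b_def by (simp flip: of_real_mult of_real_add of_real_power)
  \<comment> \<open>The first column of \<open>su12 x b\<close> is (x, -b, 0); multiplying by
    \<open>su23 c d\<close> must turn it into (x, y, z). If b = 0, then y = z = 0 and any unit pair
    serves.\<close>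
  obtain c d where cd: "c * cnj c + d * cnj d = 1" "c * of_real b = - y" "cnj d * of_real b = z"
  proof (cases "b = 0")
    case True
    then have "(cmod y)\<^sup>2 + (cmod z)\<^sup>2 = 0"
      by (simp add: b_def)
    then have "y = 0 \<and> z = 0"
      by (simp add: sum_power2_eq_zero_iff)
    then show ?thesis
      using that[of 1 0] True by simp
  next
    case False
    then have "y * cnj y / (y * cnj y + z * cnj z) + z * cnj z / (y * cnj y + z * cnj z) = 1"
      using b by (metis add_divide_distrib divide_self mult_eq_0_iff of_real_eq_0_iff)
    with False show ?thesis
      using that[of "- y / of_real b" "cnj z / of_real b"] b
      by (auto simp: mult.commute[of "cnj z"])
  qed
  define h where "h = su23 c d ** su12 x (of_real b)"
  have xb: "x * cnj x + of_real b * cnj (of_real b) = 1"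
    using n b by (simp add: add.assoc)
  have h: "P h" "h \<in> SU3"
    unfolding h_def by (intro P_mult P12 P23 cd(1) xb su12_SU3 su23_SU3)+
  have h1: "h $ 1 $ 1 = x" "h $ 2 $ 1 = y" "h $ 3 $ 1 = z"
    using cd(2,3) by (simp_all add: h_def su12_def su23_def matrix_matrix_mult_def sum_3)
  define k where "k = adj h ** g"
  have k: "k \<in> SU3"
    unfolding k_def using SU3_mult SU3_adj h assms(1) by blast
  have k1: "k $ 1 $ 1 = 1" "k $ 2 $ 1 = 0" "k $ 3 $ 1 = 0"
  proof -
    have "k $ i $ 1 = (adj h ** h) $ i $ 1" for i
      by (simp add: k_def matrix_matrix_mult_def sum_3 h1 x_def y_def z_def)
    then show "k $ 1 $ 1 = 1" "k $ 2 $ 1 = 0" "k $ 3 $ 1 = 0"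
      using SU3_unitary(1)[OF h(2)] by (simp_all add: mat_nth)
  qed
  have ku: "adj k ** k = mat 1" and dk: "det k = 1"
    using k by (simp_all add: SU3_def)
  have k12: "k $ 1 $ 2 = 0" "k $ 1 $ 3 = 0"
    using ku k1 by (simp_all add: mat3_simps)
  have dk': "k $ 2 $ 2 * k $ 3 $ 3 - k $ 2 $ 3 * k $ 3 $ 2 = 1"
    using dk k1 k12 by (simp add: det_3)
  have u: "cnj (k$2$2) * k$2$2 + cnj (k$3$2) * k$3$2 = 1" "cnj (k$2$2) * k$2$3 + cnj (k$3$2) * k$3$3 = 0"
    "cnj (k$2$3) * k$2$2 + cnj (k$3$3) * k$3$2 = 0" "cnj (k$2$3) * k$2$3 + cnj (k$3$3) * k$3$3 = 1"
    using ku k12 by (simp_all add: mat3_simps)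
  \<comment> \<open>Multiplying by the determinant 1 and using orthonormality of the columns is
    Cramer's rule: the adjoint of the lower block equals its cofactor matrix.\<close>
  have e1: "cnj (k$2$2) = k$3$3"
  proof -
    have "cnj (k$2$2) = cnj (k$2$2) * (k $ 2 $ 2 * k $ 3 $ 3 - k $ 2 $ 3 * k $ 3 $ 2)"
      by (simp add: dk')
    also have "\<dots> = (cnj (k$2$2) * k$2$2) * k$3$3 - (cnj (k$2$2) * k$2$3) * k$3$2"
      by (simp add: algebra_simps)
    also have "cnj (k$2$2) * k$2$3 = - (cnj (k$3$2) * k$3$3)"
      using u(2) by (simp add: eq_neg_iff_add_eq_0)
    also have "(cnj (k$2$2) * k$2$2) * k$3$3 - - (cnj (k$3$2) * k$3$3) * k$3$2
        = (cnj (k$2$2) * k$2$2 + cnj (k$3$2) * k$3$2) * k$3$3"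
      by (simp add: algebra_simps)
    finally show ?thesis
      by (simp add: u)
  qed
  have e2: "cnj (k$2$3) = - (k$3$2)"
  proof -
    have "cnj (k$2$3) = cnj (k$2$3) * (k $ 2 $ 2 * k $ 3 $ 3 - k $ 2 $ 3 * k $ 3 $ 2)"
      by (simp add: dk')
    also have "\<dots> = (cnj (k$2$3) * k$2$2) * k$3$3 - (cnj (k$2$3) * k$2$3) * k$3$2"
      by (simp add: algebra_simps)
    also have "cnj (k$2$3) * k$2$2 = - (cnj (k$3$3) * k$3$2)"
      using u(3) by (simp add: eq_neg_iff_add_eq_0)
    also have "- (cnj (k$3$3) * k$3$2) * k$3$3 - (cnj (k$2$3) * k$2$3) * k$3$2
        = - (cnj (k$2$3) * k$2$3 + cnj (k$3$3) * k$3$3) * k$3$2"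
      by (simp add: algebra_simps)
    finally show ?thesis
      by (simp add: u)
  qed
  have "k = su23 (k$2$2) (k$2$3)"
    by (simp add: su23_def mat3_simps k1 k12 e1 e2)
  moreover have "k$2$2 * cnj (k$2$2) + k$2$3 * cnj (k$2$3) = 1"
    using dk' by (simp add: e1 e2)
  ultimately have "P k"
    using P23 by metis
  moreover have "g = h ** k"
    unfolding k_def by (simp add: matrix_mul_assoc SU3_unitary(2)[OF h(2)])
  ultimately show ?thesis
    using mult h k by simp
qed

section \<open>Unitary representations of SU(3)\<close>

definition srot :: "complex^3^3 \<Rightarrow> bool" where
  "srot X \<longleftrightarrow> (\<exists>r Y. rotgen Y \<and> X = r *\<^sub>R Y)"

definition antiherm_part :: "complex^3^3 \<Rightarrow> complex^3^3" where
  "antiherm_part Z = cscale (1/2) (Z - adj Z)"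

definition herm_part :: "complex^3^3 \<Rightarrow> complex^3^3" where
  "herm_part Z = cscale (1 / (2 * \<i>)) (Z + adj Z)"

text \<open>On these matrices the exponentials occurring in \<open>sl_act\<close> are explicit; the
  six ladder and Cartan matrices are among them.\<close>

definition good :: "complex^3^3 \<Rightarrow> bool" where
  "good Z \<longleftrightarrow> srot (antiherm_part Z) \<and> srot (herm_part Z)"

lemma herm_part_alt: "herm_part Z = cscale (- \<i> / 2) (Z + adj Z)"
proof -
  have "1 / (2 * \<i>) = - \<i> / 2"
    by (simp add: field_simps)
  then show ?thesis
    by (simp add: herm_part_def)
qed

lemma srotI: "rotgen Y \<Longrightarrow> X = r *\<^sub>R Y \<Longrightarrow> srot X"
  by (auto simp: srot_def)

lemma sl2_parts:
  "antiherm_part (Eij 1 2) = (1/2) *\<^sub>R genA12" "herm_part (Eij 1 2) = (-1/2) *\<^sub>R genB12"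
  "antiherm_part (Eij 2 1) = (-1/2) *\<^sub>R genA12" "herm_part (Eij 2 1) = (-1/2) *\<^sub>R genB12"
  "antiherm_part (Eij 2 3) = (1/2) *\<^sub>R genA23" "herm_part (Eij 2 3) = (-1/2) *\<^sub>R genB23"
  "antiherm_part (Eij 3 2) = (-1/2) *\<^sub>R genA23" "herm_part (Eij 3 2) = (-1/2) *\<^sub>R genB23"
  "antiherm_part (cscale (1/2) (Eij 1 1 - Eij 2 2)) = 0 *\<^sub>R genA12"
  "herm_part (cscale (1/2) (Eij 1 1 - Eij 2 2)) = (-1/2) *\<^sub>R genC12"
  "antiherm_part (cscale (1/2) (Eij 2 2 - Eij 3 3)) = 0 *\<^sub>R genA23"
  "herm_part (cscale (1/2) (Eij 2 2 - Eij 3 3)) = (-1/2) *\<^sub>R genC23"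
  by (simp_all add: mat3_simps gen_defs antiherm_part_def herm_part_def scaleR_complex complex_eq_iff)

lemma good_Eij: "good (Eij 1 2)" "good (Eij 2 1)" "good (Eij 2 3)" "good (Eij 3 2)"
  "good (cscale (1/2) (Eij 1 1 - Eij 2 2))" "good (cscale (1/2) (Eij 2 2 - Eij 3 3))"
  unfolding good_def sl2_parts using rotgen_gen by (blast intro: srotI)+

lemma parts_cscale:
  "antiherm_part (cscale c Z) = Re c *\<^sub>R antiherm_part Z - Im c *\<^sub>R herm_part Z"
  "herm_part (cscale c Z) = Re c *\<^sub>R herm_part Z + Im c *\<^sub>R antiherm_part Z"
  by (simp_all add: antiherm_part_def herm_part_alt veq complex_eq_iff field_simps)

lemma parts_adj: "antiherm_part (adj Z) = - antiherm_part Z" "herm_part (adj Z) = herm_part Z"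
  by (simp_all add: antiherm_part_def herm_part_def veq algebra_simps)

lemma parts_sum: "Z = antiherm_part Z + cscale \<i> (herm_part Z)"
  by (simp add: antiherm_part_def herm_part_def veq complex_eq_iff field_simps)

lemma parts_antiherm: "adj (antiherm_part Z) = - antiherm_part Z" "adj (herm_part Z) = - herm_part Z"
  by (simp_all add: antiherm_part_def herm_part_alt veq complex_eq_iff field_simps)

lemma parts_unique:
  assumes "adj X = - X" "adj Y = - Y"
  shows "antiherm_part (X + cscale \<i> Y) = X" "herm_part (X + cscale \<i> Y) = Y"
proof -
  have a: "adj (X + cscale \<i> Y) = - X + cscale \<i> Y"
    by (simp add: adj_add adj_cscale assms) (simp add: veq)
  show "antiherm_part (X + cscale \<i> Y) = X" "herm_part (X + cscale \<i> Y) = Y"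
    by (simp_all add: antiherm_part_def herm_part_def a) (simp_all add: veq)
qed

text \<open>Expand the commutator of P + iQ and P' + iQ'. The terms without and with the factor i
  are both antihermitian, so by uniqueness they are the two components.\<close>

lemma parts_bracket:
  fixes Z W defines "P \<equiv> antiherm_part Z" and "Q \<equiv> herm_part Z" and "P' \<equiv> antiherm_part W" and "Q' \<equiv> herm_part W"
  shows "antiherm_part (Z ** W - W ** Z) = (P ** P' - P' ** P) - (Q ** Q' - Q' ** Q)"
    and "herm_part (Z ** W - W ** Z) = (P ** Q' - Q' ** P) + (Q ** P' - P' ** Q)"
proof -
  define X where "X = (P ** P' - P' ** P) - (Q ** Q' - Q' ** Q)"
  define Y where "Y = (P ** Q' - Q' ** P) + (Q ** P' - P' ** Q)"
  have a: "adj P = - P" "adj Q = - Q" "adj P' = - P'" "adj Q' = - Q'"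
    by (simp_all add: assms parts_antiherm)
  have ax: "adj X = - X" "adj Y = - Y"
    by (simp_all add: X_def Y_def adj_diff adj_add adj_mult a matmul.minus_left matmul.minus_right)
  have Z: "Z = P + cscale \<i> Q" and W: "W = P' + cscale \<i> Q'"
    unfolding assms by (rule parts_sum)+
  have "Z ** W - W ** Z = X + cscale \<i> Y"
    unfolding Z W X_def Y_def
    by (simp add: matmul.add_left matmul.add_right cscale_mult_left cscale_mult_right cscale_cscale)
       (simp add: veq algebra_simps)
  then show "antiherm_part (Z ** W - W ** Z) = (P ** P' - P' ** P) - (Q ** Q' - Q' ** Q)"
    "herm_part (Z ** W - W ** Z) = (P ** Q' - Q' ** P) + (Q ** P' - P' ** Q)"
    using parts_unique[OF ax] by (simp_all add: X_def Y_def)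
qed

text \<open>General curves rather than one-parameter subgroups: conjugating a curve or reversing its
  time again gives a curve of this kind, with the expected velocity.\<close>

definition tangent :: "(real \<Rightarrow> complex^3^3) \<Rightarrow> complex^3^3 \<Rightarrow> bool" where
  "tangent c X \<longleftrightarrow> (\<forall>t. c t \<in> SU3) \<and> c 0 = mat 1 \<and> (c has_vector_derivative X) (at 0)"

lemma tangent_rot: "rotgen X \<Longrightarrow> tangent (\<lambda>t. rot X (t * r)) (r *\<^sub>R X)"
proof -
  assume X: "rotgen X"
  have "((rot X \<circ> (\<lambda>t. t * r)) has_vector_derivative r *\<^sub>R X) (at 0)"
    using rot_has_vector_derivative_0[of X]
    by (intro vector_diff_chain_at) (auto intro!: derivative_eq_intros simp: has_vector_derivative_def)
  with X show ?thesis
    by (auto simp: tangent_def rotgen_def o_def)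
qed

lemma srot_tangent: "srot X \<Longrightarrow> \<exists>c. tangent c X"
  using tangent_rot by (auto simp: srot_def)

text \<open>The common interface of the irrep on vectors and of the conjugation action on operators;
  both are interpretations below. Smoothness enters only through \<open>act_diff\<close>: one real
  linear map yields the velocity along every curve, so that additivity in the Lie algebra element
  comes for free.\<close>

locale urep =
  fixes s :: "complex \<Rightarrow> 'v \<Rightarrow> 'v::euclidean_space"
    and ip :: "'v \<Rightarrow> 'v \<Rightarrow> complex"
    and \<alpha> :: "complex^3^3 \<Rightarrow> 'v \<Rightarrow> 'v"
  assumes vector_space_s: "vector_space s"
    and s_real: "s (of_real r) x = r *\<^sub>R x"
    and ip_add_right: "ip x (y + z) = ip x y + ip x z"
    and ip_scale_right: "ip x (s c y) = c * ip x y"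
    and ip_cnj: "ip y x = cnj (ip x y)"
    and ip_Re: "Re (ip x y) = x \<bullet> y"
    and act_add: "g \<in> SU3 \<Longrightarrow> \<alpha> g (x + y) = \<alpha> g x + \<alpha> g y"
    and act_scale: "g \<in> SU3 \<Longrightarrow> \<alpha> g (s c x) = s c (\<alpha> g x)"
    and act_mult: "g \<in> SU3 \<Longrightarrow> h \<in> SU3 \<Longrightarrow> \<alpha> (g ** h) x = \<alpha> g (\<alpha> h x)"
    and act_one: "\<alpha> (mat 1) x = x"
    and act_ip: "g \<in> SU3 \<Longrightarrow> ip (\<alpha> g x) (\<alpha> g y) = ip x y"
    and act_diff: "\<exists>F'. linear F' \<and> (\<forall>c X. tangent c X \<longrightarrow>
        ((\<lambda>t. \<alpha> (c t) x) has_vector_derivative F' X) (at 0))"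
begin

sublocale vs: vector_space s
  by (rule vector_space_s)

lemma ip_add_left: "ip (x + y) z = ip x z + ip y z"
  by (metis complex_cnj_add ip_add_right ip_cnj)

lemma ip_scale_left: "ip (s c x) y = cnj c * ip x y"
  by (metis complex_cnj_mult ip_cnj ip_scale_right)

lemma s_minus_one: "s (-1) x = - x"
  using s_real[of "-1" x] by simp

lemma ip_zero [simp]: "ip x 0 = 0" "ip 0 x = 0"
  using ip_scale_right[of x 0 0] ip_scale_left[of 0 0 x] by simp_all

lemma ip_minus: "ip x (- y) = - ip x y" "ip (- x) y = - ip x y"
  using ip_scale_right[of x "-1" y] ip_scale_left[of "-1" x y] by (simp_all add: s_minus_one)

lemma ip_diff: "ip x (y - z) = ip x y - ip x z" "ip (x - y) z = ip x z - ip y z"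
  using ip_add_right[of x y "-z"] ip_add_left[of x "-y" z] by (simp_all add: ip_minus)

lemma ip_sum_right: "ip x (sum f A) = (\<Sum>i\<in>A. ip x (f i))"
  by (induction A rule: infinite_finite_induct) (simp_all add: ip_add_right)

lemma ip_sum_left: "ip (sum f A) x = (\<Sum>i\<in>A. ip (f i) x)"
  by (induction A rule: infinite_finite_induct) (simp_all add: ip_add_left)

lemma ip_self_eq_0 [simp]: "ip x x = 0 \<longleftrightarrow> x = 0"
  by (metis inner_eq_zero_iff ip_Re ip_zero(1) zero_complex.sel(1))

lemma ip_ext: "(\<And>y. ip y a = ip y b) \<Longrightarrow> a = b"
  by (metis eq_iff_diff_eq_0 ip_diff(1) ip_self_eq_0)

lemma linear_s: "linear (s c)"
proof (rule linearI)
  show "s c (x + y) = s c x + s c y" for x y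
    by (rule vs.scale_right_distrib)
  show "s c (r *\<^sub>R x) = r *\<^sub>R s c x" for r x
    by (simp add: mult.commute flip: s_real)
qed

lemma bounded_linear_s: "bounded_linear (s c)"
  using linear_s linear_conv_bounded_linear by blast

lemma bounded_bilinear_ip: "bounded_bilinear ip"
proof -
  have "bilinear ip"
    by (auto simp: bilinear_def linear_iff ip_add_left ip_add_right ip_scale_left ip_scale_right scaleR_complex
        simp flip: s_real)
  then show ?thesis
    by (simp add: bilinear_conv_bounded_bilinear)
qed

lemma act_zero: "g \<in> SU3 \<Longrightarrow> \<alpha> g 0 = 0"
  using act_scale[of g 0 0] by simp

lemma act_linear: "g \<in> SU3 \<Longrightarrow> linear (\<alpha> g)"
  by (rule linearI) (simp_all add: act_add act_scale flip: s_real)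

lemma act_bounded_linear: "g \<in> SU3 \<Longrightarrow> bounded_linear (\<alpha> g)"
  using act_linear linear_conv_bounded_linear by blast

lemma act_adj: "g \<in> SU3 \<Longrightarrow> \<alpha> (adj g) (\<alpha> g x) = x" "g \<in> SU3 \<Longrightarrow> \<alpha> g (\<alpha> (adj g) x) = x"
  by (simp_all add: SU3_adj SU3_unitary act_one flip: act_mult)

lemma ip_act: "g \<in> SU3 \<Longrightarrow> ip (\<alpha> g x) y = ip x (\<alpha> (adj g) y)"
  by (metis act_adj(2) act_ip)

subsection \<open>The derived action\<close>

text \<open>The differential at the identity of the orbit map of x. Its values off the tangent space
  of SU(3) depend on the choice, so facts about the action itself carry a hypothesis
  \<open>tangent c X\<close>.\<close>

definition dact :: "complex^3^3 \<Rightarrow> 'v \<Rightarrow> 'v" where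
  "dact X x = (SOME F'. linear F' \<and> (\<forall>c X. tangent c X \<longrightarrow>
        ((\<lambda>t. \<alpha> (c t) x) has_vector_derivative F' X) (at 0))) X"

lemma dact_spec:
  "linear (\<lambda>X. dact X x)"
  "tangent c X \<Longrightarrow> ((\<lambda>t. \<alpha> (c t) x) has_vector_derivative dact X x) (at 0)"
  using someI_ex[OF act_diff[of x]] unfolding dact_def by auto

lemma dact_eqI:
  "tangent c X \<Longrightarrow> ((\<lambda>t. \<alpha> (c t) x) has_vector_derivative y) (at 0) \<Longrightarrow> dact X x = y"
  using dact_spec(2) vector_derivative_unique_at by blast

lemma dact_add_left: "dact (X + Y) x = dact X x + dact Y x"
  using dact_spec(1)[of x] by (simp add: linear_iff)

lemma dact_scaleR_left: "dact (r *\<^sub>R X) x = r *\<^sub>R dact X x"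
  using dact_spec(1)[of x] by (simp add: linear_iff)

lemma dact_minus_left: "dact (- X) x = - dact X x"
  using dact_scaleR_left[of "-1"] by simp

lemma dact_diff_left: "dact (X - Y) x = dact X x - dact Y x"
  using dact_add_left[of X "-Y"] by (simp add: dact_minus_left)

lemma dact_add: "tangent c X \<Longrightarrow> dact X (x + y) = dact X x + dact X y"
  by (rule dact_eqI, assumption)
     (use has_vector_derivative_add[OF dact_spec(2)[of c X x] dact_spec(2)[of c X y]] in
       \<open>simp add: tangent_def act_add\<close>)

lemma dact_scale: "tangent c X \<Longrightarrow> dact X (s a x) = s a (dact X x)"
  by (rule dact_eqI, assumption)
     (use bounded_linear.has_vector_derivative[OF bounded_linear_s dact_spec(2)[of c X x]] in
       \<open>simp add: tangent_def act_scale\<close>)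

lemma dact_linear: "tangent c X \<Longrightarrow> linear (dact X)"
  by (rule linearI) (simp_all add: dact_add dact_scale flip: s_real)

text \<open>Product rule for the constant function t \<mapsto>
  \<open>ip (\<alpha> (c t) x) (\<alpha> (c t) y)\<close>.\<close>

lemma dact_skew:
  assumes "tangent c X" shows "ip (dact X x) y = - ip x (dact X y)"
proof -
  have c: "c t \<in> SU3" "c 0 = mat 1" for t
    using assms by (auto simp: tangent_def)
  have "((\<lambda>t. ip (\<alpha> (c t) x) (\<alpha> (c t) y)) has_vector_derivative
      (ip (\<alpha> (c 0) x) (dact X y) + ip (dact X x) (\<alpha> (c 0) y))) (at 0)"
    by (rule bounded_bilinear.has_vector_derivative[OF bounded_bilinear_ip dact_spec(2) dact_spec(2)])
       (rule assms)+
  moreover have "((\<lambda>t. ip (\<alpha> (c t) x) (\<alpha> (c t) y)) has_vector_derivative 0) (at 0)"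
    by (simp add: c act_ip)
  ultimately have "ip x (dact X y) + ip (dact X x) y = 0"
    using vector_derivative_unique_at by (fastforce simp: c act_one)
  then show ?thesis
    by (simp add: add_eq_0_iff)
qed

lemma dact_conj:
  assumes "tangent c X" "g \<in> SU3"
  shows "dact (g ** X ** adj g) x = \<alpha> g (dact X (\<alpha> (adj g) x))"
proof (rule dact_eqI)
  have c: "c t \<in> SU3" "c 0 = mat 1" "(c has_vector_derivative X) (at 0)" for t
    using assms(1) by (auto simp: tangent_def)
  have "((\<lambda>t. g ** c t ** adj g) has_vector_derivative (g ** X ** adj g)) (at 0)"
    by (intro bounded_linear.has_vector_derivative[OF matmul.bounded_linear_left]
        bounded_linear.has_vector_derivative[OF matmul.bounded_linear_right] c)
  then show "tangent (\<lambda>t. g ** c t ** adj g) (g ** X ** adj g)"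
    by (auto simp: tangent_def c assms(2) SU3_mult SU3_adj SU3_unitary)
  show "((\<lambda>t. \<alpha> (g ** c t ** adj g) x) has_vector_derivative \<alpha> g (dact X (\<alpha> (adj g) x))) (at 0)"
    using bounded_linear.has_vector_derivative[OF act_bounded_linear[OF assms(2)]
        dact_spec(2)[OF assms(1), of "\<alpha> (adj g) x"]]
    by (simp add: act_mult c assms(2) SU3_mult SU3_adj)
qed

lemma rotgen_tangent: "rotgen X \<Longrightarrow> tangent (rot X) X"
  using tangent_rot[of X 1] by simp

text \<open>The group law for rotations transports the derivative from time 0 to time t.\<close>

lemma act_rot_derivative:
  assumes "rotgen X"
  shows "((\<lambda>t. \<alpha> (rot X t) x) has_vector_derivative dact X (\<alpha> (rot X t) x)) (at t)"
proof -
  have "((\<lambda>u. \<alpha> (rot X u) (\<alpha> (rot X t) x)) has_vector_derivative dact X (\<alpha> (rot X t) x)) (at (t - t))"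
    using dact_spec(2)[OF rotgen_tangent[OF assms]] by simp
  moreover have "((\<lambda>u. u - t) has_vector_derivative 1) (at t)"
    by (auto intro!: derivative_eq_intros simp: has_vector_derivative_def)
  ultimately have "(((\<lambda>u. \<alpha> (rot X u) (\<alpha> (rot X t) x)) \<circ> (\<lambda>u. u - t)) has_vector_derivative
      1 *\<^sub>R dact X (\<alpha> (rot X t) x)) (at t)"
    by (intro vector_diff_chain_at)
  moreover have "\<alpha> (rot X (u - t)) (\<alpha> (rot X t) x) = \<alpha> (rot X u) x" for u
    using rot_add[OF rotgenD(1)[OF assms], of "u - t" t] rotgenD(2)[OF assms]
    by (simp flip: act_mult)
  ultimately show ?thesis
    by (simp add: o_def)
qed

lemma adj_rot: "rotgen X \<Longrightarrow> adj (rot X t) = rot X (- t)"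
  using rot_add[OF rotgenD(1), of X "-t" t] SU3_unitary(2)[OF rotgenD(2), of X t]
  by (metis add.left_inverse matrix_mul_assoc matrix_mul_lid matrix_mul_rid rot_0)

lemma tangent_rot_minus: "rotgen X \<Longrightarrow> tangent (\<lambda>t. rot X (- t)) (- X)"
  using tangent_rot[of X "-1"] by simp

text \<open>Differentiate at 0 the action of the conjugate of X by \<open>rot Y t\<close>, once
  inside \<open>dact\<close>, which is linear in the matrix, and once after writing it as a
  conjugated operator. Pairing with y moves one group element to the left slot, so that the product
  rule for \<open>ip\<close> suffices.\<close>

lemma dact_bracket_rotgen:
  assumes Y: "rotgen Y" and X: "tangent c X"
  shows "dact (Y ** X - X ** Y) x = dact Y (dact X x) - dact X (dact Y x)"
proof (rule ip_ext)
  fix y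
  have rY: "rot Y t \<in> SU3" for t
    using Y by (rule rotgenD)
  have bl: "bounded_linear (\<lambda>Z. ip y (dact Z x))"
    using bounded_linear_compose[OF bounded_bilinear.bounded_linear_right[OF bounded_bilinear_ip]
        linear_conv_bounded_linear[THEN iffD1, OF dact_spec(1)]] .
  have blX: "bounded_linear (dact X)"
    using dact_linear[OF X] linear_conv_bounded_linear by blast
  have dY: "(rot Y has_vector_derivative Y) (at 0)" "((\<lambda>t. rot Y (- t)) has_vector_derivative - Y) (at 0)"
    using rotgen_tangent[OF Y] tangent_rot_minus[OF Y] by (simp_all add: tangent_def)
  have "((\<lambda>t. (rot Y t ** X) ** rot Y (- t)) has_vector_derivative
      ((rot Y 0 ** X) ** (- Y) + (Y ** X) ** rot Y (- 0))) (at 0)"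
    by (intro bounded_bilinear.has_vector_derivative[OF bounded_bilinear_matrix_mult] dY
        bounded_linear.has_vector_derivative[OF matmul.bounded_linear_left])
  then have "((\<lambda>t. rot Y t ** X ** rot Y (- t)) has_vector_derivative (Y ** X - X ** Y)) (at 0)"
    by (simp add: matmul.minus_right)
  from bounded_linear.has_vector_derivative[OF bl this]
  have 1: "((\<lambda>t. ip y (dact (rot Y t ** X ** rot Y (- t)) x)) has_vector_derivative
      ip y (dact (Y ** X - X ** Y) x)) (at 0)" .
  have "ip y (dact (rot Y t ** X ** rot Y (- t)) x) =
      ip (\<alpha> (rot Y (- t)) y) (dact X (\<alpha> (rot Y (- t)) x))" for t
    using dact_conj[OF X rY, of t x] adj_rot[OF Y, of t] adj_rot[OF Y, of "- t"] ip_act[OF rY, of "- t"]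
    by simp
  moreover have "((\<lambda>t. ip (\<alpha> (rot Y (- t)) y) (dact X (\<alpha> (rot Y (- t)) x))) has_vector_derivative
      (ip (\<alpha> (rot Y (- 0)) y) (dact X (dact (- Y) x)) + ip (dact (- Y) y) (dact X (\<alpha> (rot Y (- 0)) x)))) (at 0)"
    by (intro bounded_bilinear.has_vector_derivative[OF bounded_bilinear_ip]
        bounded_linear.has_vector_derivative[OF blX] dact_spec(2)[OF tangent_rot_minus[OF Y]])
  ultimately have "ip y (dact (Y ** X - X ** Y) x) = ip y (dact X (dact (- Y) x)) + ip (dact (- Y) y) (dact X x)"
    using 1 vector_derivative_unique_at by (fastforce simp: act_one)
  also have "\<dots> = ip y (dact Y (dact X x) - dact X (dact Y x))"
    using linear_neg[OF dact_linear[OF X]] dact_skew[OF rotgen_tangent[OF Y], of y]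
    by (simp add: dact_minus_left ip_diff ip_minus)
  finally show "ip y (dact (Y ** X - X ** Y) x) = ip y (dact Y (dact X x) - dact X (dact Y x))" .
qed

lemma dact_bracket:
  assumes "srot Y" and X: "srot X"
  shows "dact (Y ** X - X ** Y) x = dact Y (dact X x) - dact X (dact Y x)"
proof -
  obtain r Y' where Y': "rotgen Y'" "Y = r *\<^sub>R Y'"
    using assms(1) by (auto simp: srot_def)
  obtain c where c: "tangent c X"
    using srot_tangent[OF X] by blast
  have "Y ** X - X ** Y = r *\<^sub>R (Y' ** X - X ** Y')"
    by (simp add: Y' matmul.scaleR_left matmul.scaleR_right scaleR_diff_right)
  then have "dact (Y ** X - X ** Y) x = r *\<^sub>R (dact Y' (dact X x) - dact X (dact Y' x))"
    by (simp only: dact_scaleR_left dact_bracket_rotgen[OF Y'(1) c])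
  then show ?thesis
    using linear_scale[OF dact_linear[OF c]]
    by (simp add: Y' dact_scaleR_left scaleR_diff_right)
qed

lemma lie_act_eq: "srot X \<Longrightarrow> lie_act \<alpha> X x = dact X x"
proof -
  assume "srot X"
  then obtain r Y where Y: "rotgen Y" "X = r *\<^sub>R Y"
    by (auto simp: srot_def)
  have "((\<lambda>t. \<alpha> (mexp (t *\<^sub>R X)) x) has_vector_derivative dact X x) (at 0)"
    using dact_spec(2)[OF tangent_rot[OF Y(1)], of r x] by (simp only: Y(2) mexp_rotgen[OF Y(1)])
  then show ?thesis
    by (simp add: lie_act_def vector_derivative_at)
qed

section \<open>Complex linear extension of the derived action\<close>

definition sl :: "complex^3^3 \<Rightarrow> 'v \<Rightarrow> 'v" where
  "sl Z x = dact (antiherm_part Z) x + s \<i> (dact (herm_part Z) x)"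

lemma sl_act_eq: "good Z \<Longrightarrow> sl_act s \<alpha> Z x = sl Z x"
  by (simp add: good_def sl_act_def sl_def lie_act_eq antiherm_part_def herm_part_def)

lemma sl_cscale_left: "sl (cscale c Z) x = s c (sl Z x)"
proof -
  have c: "s c y = Re c *\<^sub>R y + Im c *\<^sub>R s \<i> y" for y
  proof -
    have "c = of_real (Re c) + of_real (Im c) * \<i>"
      by (simp add: complex_eq_iff)
    then show ?thesis
      by (metis s_real vs.scale_left_distrib vs.scale_scale)
  qed
  have ii: "s \<i> (s \<i> y) = - y" for y
    by (simp add: s_minus_one)
  show ?thesis
    unfolding sl_def parts_cscale c[of "dact _ _ + _"]
    by (simp add: dact_add_left dact_diff_left dact_scaleR_left vs.scale_right_distrib
        linear_scale[OF linear_s] ii scaleR_add_right scaleR_diff_right)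
qed

lemma good_tangents:
  assumes "good Z" obtains c d where "tangent c (antiherm_part Z)" "tangent d (herm_part Z)"
  using assms srot_tangent unfolding good_def by blast

lemma sl_add: "good Z \<Longrightarrow> sl Z (x + y) = sl Z x + sl Z y"
  by (erule good_tangents) (simp add: sl_def dact_add vs.scale_right_distrib)

lemma sl_scale: "good Z \<Longrightarrow> sl Z (s a x) = s a (sl Z x)"
  by (erule good_tangents) (simp add: sl_def dact_scale vs.scale_right_distrib mult.commute)

lemma sl_zero: "good Z \<Longrightarrow> sl Z 0 = 0"
  using sl_scale[of Z 0 0] by simp

lemma sl_minus: "good Z \<Longrightarrow> sl Z (- x) = - sl Z x"
  using sl_scale[of Z "-1" x] by (simp add: s_minus_one)

lemma sl_diff: "good Z \<Longrightarrow> sl Z (x - y) = sl Z x - sl Z y"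
  using sl_add[of Z x "-y"] by (simp add: sl_minus)

lemma sl_sum: "good Z \<Longrightarrow> sl Z (sum f A) = (\<Sum>i\<in>A. sl Z (f i))"
  by (induction A rule: infinite_finite_induct) (simp_all add: sl_add sl_zero)

lemma ip_sl: "good Z \<Longrightarrow> ip (sl Z x) y = ip x (sl (adj Z) y)"
  by (erule good_tangents)
     (simp add: sl_def parts_adj dact_minus_left ip_add_left ip_add_right ip_scale_left ip_scale_right
        dact_skew ip_minus ip_diff)

lemma sl_bracket:
  assumes "good Z" "good W"
  shows "sl (Z ** W - W ** Z) x = sl Z (sl W x) - sl W (sl Z x)"
proof -
  obtain c d where Z: "tangent c (antiherm_part Z)" "tangent d (herm_part Z)"
    using good_tangents[OF assms(1)] .
  obtain c' d' where W: "tangent c' (antiherm_part W)" "tangent d' (herm_part W)"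
    using good_tangents[OF assms(2)] .
  have ii: "s \<i> (s \<i> y) = - y" for y
    by (simp add: s_minus_one)
  have sr: "srot (antiherm_part Z)" "srot (herm_part Z)" "srot (antiherm_part W)" "srot (herm_part W)"
    using assms by (auto simp: good_def)
  show ?thesis
    unfolding sl_def parts_bracket dact_add_left
      dact_diff_left[of "antiherm_part Z ** antiherm_part W - antiherm_part W ** antiherm_part Z"]
      dact_bracket[OF sr(1,3)] dact_bracket[OF sr(2,4)] dact_bracket[OF sr(1,4)] dact_bracket[OF sr(2,3)]
    by (simp add: dact_add[OF Z(1)] dact_add[OF Z(2)] dact_add[OF W(1)] dact_add[OF W(2)]
        dact_scale[OF Z(1)] dact_scale[OF Z(2)] dact_scale[OF W(1)] dact_scale[OF W(2)]
        vs.scale_right_distrib vs.scale_right_diff_distrib ii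
        algebra_simps del: vs.scale_scale)
qed

end

text \<open>P is the orthogonal projection along R. Membership in R becomes the linear condition P x
  = 0, which can be differentiated along a curve.\<close>

lemma subspace_projection:
  fixes R :: "'v::euclidean_space set" assumes "subspace R"
  shows "\<exists>P. linear P \<and> (\<forall>x. P x = 0 \<longleftrightarrow> x \<in> R) \<and> (\<forall>x. x - P x \<in> R) \<and> (\<forall>x. \<forall>y\<in>R. y \<bullet> P x = 0)"
proof -
  obtain B where B: "B \<subseteq> R" "pairwise real_inner_class.orthogonal B" "\<And>x. x \<in> B \<Longrightarrow> norm x = 1" "independent B" "span B = R"
    using orthonormal_basis_subspace[OF assms] by metis
  define P where "P x = x - (\<Sum>b\<in>B. (b \<bullet> x) *\<^sub>R b)" for x
  have fin: "finite B"
    using B(4) by (rule independent_imp_finite)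
  have "linear P"
    by (rule linearI) (simp_all add: P_def inner_right_distrib scaleR_add_left sum.distrib scaleR_sum_right
        algebra_simps)
  moreover have r: "x - P x \<in> R" for x
    using B(1) by (auto simp: P_def intro!: subspace_sum[OF assms] subspace_scale[OF assms])
  moreover have o: "y \<bullet> P x = 0" if "y \<in> R" for x y
  proof -
    have yB: "y \<bullet> P x = 0" if b: "y \<in> B" for y
    proof -
      have "y \<bullet> (\<Sum>b\<in>B. (b \<bullet> x) *\<^sub>R b) = (\<Sum>b\<in>B. if b = y then y \<bullet> x else 0)"
        unfolding inner_sum_right using B(2,3) b
        by (intro sum.cong) (auto simp: pairwise_def real_inner_class.orthogonal_def norm_eq_1)
      also have "\<dots> = y \<bullet> x"
        using b fin by simp
      finally show ?thesis
        by (simp add: P_def inner_diff_right)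
    qed
    have "y \<in> span B"
      using that B(5) by simp
    then show ?thesis
      by (induction y rule: span_induct_alt) (auto simp: inner_add_left yB)
  qed
  moreover have "P x = 0 \<longleftrightarrow> x \<in> R" for x
  proof
    assume "P x = 0"
    then show "x \<in> R"
      using r[of x] by simp
  next
    assume "x \<in> R"
    then have "P x \<in> R"
      using subspace_diff[OF assms _ r[of x]] by fastforce
    then show "P x = 0"
      using o[of "P x" x] by simp
  qed
  ultimately show ?thesis
    by (intro exI[of _ P]) simp
qed

context urep
begin

subsection \<open>Raising and lowering operators\<close>

abbreviation "Tp \<equiv> sl (Eij 1 2)"
abbreviation "Tm \<equiv> sl (Eij 2 1)"
abbreviation "Up \<equiv> sl (Eij 2 3)"
abbreviation "Um \<equiv> sl (Eij 3 2)"
abbreviation "T3 \<equiv> sl (cscale (1/2) (Eij 1 1 - Eij 2 2))"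
abbreviation "U3 \<equiv> sl (cscale (1/2) (Eij 2 2 - Eij 3 3))"

lemma ladder_eq:
  "T_plus s \<alpha> = Tp" "T_minus s \<alpha> = Tm" "U_plus s \<alpha> = Up" "U_minus s \<alpha> = Um"
  "T_three s \<alpha> = T3" "U_three s \<alpha> = U3"
  by (simp_all add: fun_eq_iff T_plus_def T_minus_def U_plus_def U_minus_def T_three_def U_three_def
      sl_act_eq good_Eij)

lemma ladder_adj:
  "ip (Tp x) y = ip x (Tm y)" "ip (Tm x) y = ip x (Tp y)"
  "ip (Up x) y = ip x (Um y)" "ip (Um x) y = ip x (Up y)"
  "ip (T3 x) y = ip x (T3 y)" "ip (U3 x) y = ip x (U3 y)"
proof -
  have "adj (Eij 1 2) = Eij 2 1" "adj (Eij 2 1) = Eij 1 2" "adj (Eij 2 3) = Eij 3 2" "adj (Eij 3 2) = Eij 2 3"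
    "adj (cscale (1/2) (Eij 1 1 - Eij 2 2)) = cscale (1/2) (Eij 1 1 - Eij 2 2)"
    "adj (cscale (1/2) (Eij 2 2 - Eij 3 3)) = cscale (1/2) (Eij 2 2 - Eij 3 3)"
    by (simp_all add: mat3_simps)
  then show "ip (Tp x) y = ip x (Tm y)" "ip (Tm x) y = ip x (Tp y)"
    "ip (Up x) y = ip x (Um y)" "ip (Um x) y = ip x (Up y)"
    "ip (T3 x) y = ip x (T3 y)" "ip (U3 x) y = ip x (U3 y)"
    by (simp_all add: ip_sl good_Eij)
qed

lemma ladder_brackets:
  "Tp (Tm x) = Tm (Tp x) + s 2 (T3 x)"
  "Tp (Um x) = Um (Tp x)"
  "Up (Tm x) = Tm (Up x)"
  "Up (Um x) = Um (Up x) + s 2 (U3 x)"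
  "T3 (Tm x) = Tm (T3 x) + s (-1) (Tm x)"
  "T3 (Um x) = Um (T3 x) + s (1/2) (Um x)"
  "U3 (Tm x) = Tm (U3 x) + s (1/2) (Tm x)"
  "U3 (Um x) = Um (U3 x) + s (-1) (Um x)"
proof -
  let ?H = "cscale (1/2) (Eij 1 1 - Eij 2 2)" and ?K = "cscale (1/2) (Eij 2 2 - Eij 3 3)"
  have *: "sl Z (sl W x) = sl W (sl Z x) + s c (sl Y x)"
    if "good Z" "good W" "Z ** W - W ** Z = cscale c Y" for Z W Y c
    using sl_bracket[OF that(1,2), of x] sl_cscale_left[of c Y x] unfolding that(3) by simp
  have m: "Eij 1 2 ** Eij 2 1 - Eij 2 1 ** Eij 1 2 = cscale 2 ?H"
    "Eij 1 2 ** Eij 3 2 - Eij 3 2 ** Eij 1 2 = cscale 0 ?H"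
    "Eij 2 3 ** Eij 2 1 - Eij 2 1 ** Eij 2 3 = cscale 0 ?H"
    "Eij 2 3 ** Eij 3 2 - Eij 3 2 ** Eij 2 3 = cscale 2 ?K"
    "?H ** Eij 2 1 - Eij 2 1 ** ?H = cscale (-1) (Eij 2 1)"
    "?H ** Eij 3 2 - Eij 3 2 ** ?H = cscale (1/2) (Eij 3 2)"
    "?K ** Eij 2 1 - Eij 2 1 ** ?K = cscale (1/2) (Eij 2 1)"
    "?K ** Eij 3 2 - Eij 3 2 ** ?K = cscale (-1) (Eij 3 2)"
    by (simp_all add: mat3_simps)
  show "Tp (Tm x) = Tm (Tp x) + s 2 (T3 x)"
    "Up (Um x) = Um (Up x) + s 2 (U3 x)"
    "T3 (Tm x) = Tm (T3 x) + s (-1) (Tm x)"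
    "T3 (Um x) = Um (T3 x) + s (1/2) (Um x)"
    "U3 (Tm x) = Tm (U3 x) + s (1/2) (Tm x)"
    "U3 (Um x) = Um (U3 x) + s (-1) (Um x)"
    by (intro * good_Eij m)+
  show "Tp (Um x) = Um (Tp x)" "Up (Tm x) = Tm (Up x)"
    using *[OF good_Eij(1,4) m(2)] *[OF good_Eij(3,2) m(3)] by simp_all
qed

lemma dact_ladder:
  "dact genA12 x = Tp x - Tm x" "dact genB12 x = s \<i> (Tp x + Tm x)"
  "dact genA23 x = Up x - Um x" "dact genB23 x = s \<i> (Up x + Um x)"
  "dact genC12 x = s (2 * \<i>) (T3 x)" "dact genC23 x = s (2 * \<i>) (U3 x)"
proof -
  have half: "(1/2) *\<^sub>R y + (-1/2) *\<^sub>R z - ((-1/2) *\<^sub>R y + (-1/2) *\<^sub>R z) = y"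
    "(1/2) *\<^sub>R y + (-1/2) *\<^sub>R z + ((-1/2) *\<^sub>R y + (-1/2) *\<^sub>R z) = - z" for y z :: 'v
  proof -
    have "(1/2) *\<^sub>R y + (-1/2) *\<^sub>R z - ((-1/2) *\<^sub>R y + (-1/2) *\<^sub>R z) = (1/2 - (-1/2)) *\<^sub>R y"
      by (simp only: scaleR_diff_left) simp
    then show "(1/2) *\<^sub>R y + (-1/2) *\<^sub>R z - ((-1/2) *\<^sub>R y + (-1/2) *\<^sub>R z) = y"
      by simp
    have "(1/2) *\<^sub>R y + (-1/2) *\<^sub>R z + ((-1/2) *\<^sub>R y + (-1/2) *\<^sub>R z) = (-1/2 + (-1/2)) *\<^sub>R z"
      by (simp only: scaleR_add_left) simp
    then show "(1/2) *\<^sub>R y + (-1/2) *\<^sub>R z + ((-1/2) *\<^sub>R y + (-1/2) *\<^sub>R z) = - z"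
      by simp
  qed
  have ii: "s \<i> (s \<i> y) = - y" for y
    by (simp add: s_minus_one)
  show "dact genA12 x = Tp x - Tm x" "dact genA23 x = Up x - Um x"
    by (simp_all only: sl_def sl2_parts dact_scaleR_left linear_scale[OF linear_s] half)
  have "Tp x + Tm x = - s \<i> (dact genB12 x)" "Up x + Um x = - s \<i> (dact genB23 x)"
    by (simp_all only: sl_def sl2_parts dact_scaleR_left linear_scale[OF linear_s] half)
  then show "dact genB12 x = s \<i> (Tp x + Tm x)" "dact genB23 x = s \<i> (Up x + Um x)"
    by (simp_all only: linear_neg[OF linear_s] ii minus_minus)
  have "T3 x = - ((1/2) *\<^sub>R s \<i> (dact genC12 x))" "U3 x = - ((1/2) *\<^sub>R s \<i> (dact genC23 x))"
    by (simp_all only: sl_def sl2_parts dact_scaleR_left linear_scale[OF linear_s]) simp_all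
  moreover have "s (2 * \<i>) (- ((1/2) *\<^sub>R s \<i> y)) = y" for y
    by (simp add: linear_neg[OF linear_s] s_minus_one flip: s_real)
  ultimately show "dact genC12 x = s (2 * \<i>) (T3 x)" "dact genC23 x = s (2 * \<i>) (U3 x)"
    by simp_all
qed

subsection \<open>Invariant subspaces\<close>

lemma subspace_real: "vs.subspace R \<Longrightarrow> subspace R"
  unfolding subspace_def by (metis s_real vs.subspace_0 vs.subspace_add vs.subspace_scale)

lemma Re_ip_skew: "tangent c X \<Longrightarrow> x \<bullet> dact X x = 0"
  using dact_skew[of c X x x] ip_cnj[of x "dact X x"] by (auto simp: complex_eq_iff simp flip: ip_Re)

lemma inner_dact: "tangent c X \<Longrightarrow> dact X x \<bullet> y = - (x \<bullet> dact X y)"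
  using dact_skew[of c X x y] by (simp flip: ip_Re)

text \<open>Skewness makes the orthogonal complement of R stable as well, so P commutes with
  \<open>dact X\<close>, and the squared norm of P along the orbit has derivative zero. It starts at
  zero.\<close>

lemma flow_invariant:
  assumes X: "rotgen X" and R: "vs.subspace R" "\<And>x. x \<in> R \<Longrightarrow> dact X x \<in> R" and x: "x \<in> R"
  shows "\<alpha> (rot X t) x \<in> R"
proof -
  note tX = rotgen_tangent[OF X]
  obtain P where P: "linear P" "\<And>x. P x = 0 \<longleftrightarrow> x \<in> R" "\<And>x. x - P x \<in> R" "\<And>x y. y \<in> R \<Longrightarrow> y \<bullet> P x = 0"
    using subspace_projection[OF subspace_real[OF R(1)]] by auto
  have blP: "bounded_linear P"
    using P(1) linear_conv_bounded_linear by blast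
  have P_id: "P y = y" if "\<And>z. z \<in> R \<Longrightarrow> z \<bullet> y = 0" for y
  proof -
    have "(y - P y) \<bullet> (y - P y) = 0"
      using that[OF P(3)[of y]] P(4)[OF P(3)[of y], of y] by (simp add: inner_diff_right)
    then show ?thesis by simp
  qed
  have comm: "P (dact X y) = dact X (P y)" for y
  proof -
    have "y = P y + (y - P y)"
      by simp
    then have "dact X y = dact X (P y) + dact X (y - P y)"
      using dact_add[OF tX] by metis
    moreover have "P (dact X (y - P y)) = 0"
      using P(2,3) R(2) by blast
    moreover have "P (dact X (P y)) = dact X (P y)"
    proof (rule P_id)
      fix z assume "z \<in> R"
      then show "z \<bullet> dact X (P y) = 0"
        using inner_dact[OF tX, of z "P y"] P(4) R(2) by fastforce
    qed
    ultimately show ?thesis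
      using P(1) by (simp add: linear_add)
  qed
  define f where "f t = P (\<alpha> (rot X t) x) \<bullet> P (\<alpha> (rot X t) x)" for t
  have "(f has_real_derivative 0) (at t)" for t
  proof -
    have d: "((\<lambda>t. P (\<alpha> (rot X t) x)) has_vector_derivative P (dact X (\<alpha> (rot X t) x))) (at t)"
      by (rule bounded_linear.has_vector_derivative[OF blP act_rot_derivative[OF X]])
    show ?thesis
      using bounded_bilinear.has_vector_derivative[OF bounded_bilinear_inner d d]
      by (simp add: f_def[abs_def] has_real_derivative_iff_has_vector_derivative comm Re_ip_skew[OF tX]
          inner_commute)
  qed
  then have "f t = f 0"
    by (intro DERIV_isconst_all) auto
  also have "\<dots> = 0"
    using P(2)[of x] x by (simp add: f_def act_one)
  finally show ?thesis
    by (simp add: f_def P(2))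
qed

text \<open>The rotations of type A and B generate SU(3), and their generators are combinations of
  the four ladder operators.\<close>

lemma stable_imp_invariant:
  assumes R: "vs.subspace R" "\<And>x. x \<in> R \<Longrightarrow> Tp x \<in> R" "\<And>x. x \<in> R \<Longrightarrow> Tm x \<in> R"
    "\<And>x. x \<in> R \<Longrightarrow> Up x \<in> R" "\<And>x. x \<in> R \<Longrightarrow> Um x \<in> R"
  shows "invariant_subspace s \<alpha> R"
proof -
  have "\<forall>x\<in>R. \<alpha> g x \<in> R" if "g \<in> SU3" for g
    using that
  proof (induction rule: SU3_induct)
    case (mult g h)
    then show ?case
      by (auto simp: act_mult)
  qed (auto intro!: flow_invariant rotgen_gen R vs.subspace_diff vs.subspace_add vs.subspace_scale
      simp: dact_ladder)
  then show ?thesis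
    using R(1) by (simp add: invariant_subspace_def)
qed

lemma invariant_imp_dact:
  assumes R: "invariant_subspace s \<alpha> R" and X: "tangent c X" and x: "x \<in> R"
  shows "dact X x \<in> R"
proof -
  have sR: "subspace R"
    using R by (simp add: invariant_subspace_def subspace_real)
  obtain P :: "'v \<Rightarrow> 'v" where P: "linear P" "\<forall>x. P x = 0 \<longleftrightarrow> x \<in> R"
    using subspace_projection[OF sR] by auto
  have blP: "bounded_linear P"
    using P(1) linear_conv_bounded_linear by blast
  have "P (\<alpha> (c t) x) = 0" for t
    using R X x by (simp add: P(2) invariant_subspace_def tangent_def)
  with bounded_linear.has_vector_derivative[OF blP dact_spec(2)[OF X, of x]]
  have "((\<lambda>t. 0) has_vector_derivative P (dact X x)) (at (0::real))"
    by simp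
  then have "P (dact X x) = 0"
    using vector_derivative_unique_at has_vector_derivative_const by blast
  then show ?thesis
    by (simp add: P(2))
qed

lemma invariant_imp_sl:
  assumes "invariant_subspace s \<alpha> R" "good Z" "x \<in> R"
  shows "sl Z x \<in> R"
proof -
  have "vs.subspace R"
    using assms(1) by (simp add: invariant_subspace_def)
  then show ?thesis
    using good_tangents[OF assms(2)] invariant_imp_dact[OF assms(1) _ assms(3)]
    unfolding sl_def by (metis vs.subspace_add vs.subspace_scale)
qed

subsection \<open>Words in the lowering operators\<close>

text \<open>The numbers i and j count the letters \<open>Tm\<close> and \<open>Um\<close>. They
  determine the weight whatever the order of the letters, so words need not be brought into a normal
  form.\<close>

inductive lw :: "'v \<Rightarrow> nat \<Rightarrow> nat \<Rightarrow> 'v \<Rightarrow> bool" for v where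
  lw_base: "lw v 0 0 v"
| lw_T: "lw v i j x \<Longrightarrow> lw v (Suc i) j (Tm x)"
| lw_U: "lw v i j x \<Longrightarrow> lw v i (Suc j) (Um x)"

abbreviation lws :: "'v \<Rightarrow> 'v set" where
  "lws v \<equiv> {x. \<exists>i j. lw v i j x}"

definition hw :: "nat \<times> nat \<Rightarrow> 'v \<Rightarrow> bool" where
  "hw a v \<longleftrightarrow> v \<noteq> 0 \<and> Tp v = 0 \<and> Up v = 0 \<and>
     T3 v = s (of_real (real (fst a) / 2)) v \<and> U3 v = s (of_real (real (snd a) / 2)) v"

lemma hw_eq: "highest_weight_vec s \<alpha> a v \<longleftrightarrow> hw a v"
  by (simp add: highest_weight_vec_def hw_def ladder_eq)

lemma lw_weights:
  assumes "hw a v" "lw v i j x"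
  shows "T3 x = s (of_real (real (fst a) / 2 - i + j / 2)) x"
    and "U3 x = s (of_real (real (snd a) / 2 + i / 2 - j)) x"
  using assms(2)
proof (induction rule: lw.induct)
  case lw_base
  case 1 show ?case using assms(1) by (simp add: hw_def)
  case 2 show ?case using assms(1) by (simp add: hw_def)
next
  case (lw_T i j x)
  case 1 show ?case
    unfolding ladder_brackets lw_T sl_scale[OF good_Eij(2)] vs.scale_left_distrib[symmetric]
    by (rule arg_cong2[of _ _ _ _ s]) (simp_all add: algebra_simps)
  case 2 show ?case
    unfolding ladder_brackets lw_T sl_scale[OF good_Eij(2)] vs.scale_left_distrib[symmetric]
    by (rule arg_cong2[of _ _ _ _ s]) (simp_all add: field_simps)
next
  case (lw_U i j x)
  case 1 show ?case
    unfolding ladder_brackets lw_U sl_scale[OF good_Eij(4)] vs.scale_left_distrib[symmetric]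
    by (rule arg_cong2[of _ _ _ _ s]) (simp_all add: field_simps)
  case 2 show ?case
    unfolding ladder_brackets lw_U sl_scale[OF good_Eij(4)] vs.scale_left_distrib[symmetric]
    by (rule arg_cong2[of _ _ _ _ s]) (simp_all add: algebra_simps)
qed

lemma span_map_closed:
  assumes "good Z" "\<And>x. x \<in> B \<Longrightarrow> sl Z x \<in> vs.span C" "x \<in> vs.span B"
  shows "sl Z x \<in> vs.span C"
  using assms(3)
  by (induction rule: vs.span_induct_alt)
     (auto simp: sl_zero sl_add sl_scale assms(1,2) vs.span_zero vs.span_add vs.span_scale)

lemma lws_lower: "x \<in> vs.span (lws v) \<Longrightarrow> Tm x \<in> vs.span (lws v)" "x \<in> vs.span (lws v) \<Longrightarrow> Um x \<in> vs.span (lws v)"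
  by (rule span_map_closed[where B = "lws v"]; auto intro: good_Eij vs.span_base lw_T lw_U)+

text \<open>Moving a raising operator to the right through a word costs only Cartan operators, which
  act on words by scalars; at the end it meets v and vanishes.\<close>

lemma lw_raise:
  assumes "hw a v" "lw v i j x"
  shows "Tp x \<in> vs.span (lws v)" "Up x \<in> vs.span (lws v)"
  using assms(2)
proof (induction rule: lw.induct)
  case lw_base
  case 1 show ?case using assms(1) by (simp add: hw_def vs.span_zero)
  case 2 show ?case using assms(1) by (simp add: hw_def vs.span_zero)
next
  case (lw_T i j x)
  have x: "x \<in> vs.span (lws v)"
    using lw_T(1) by (auto intro: vs.span_base)
  case 1 show ?case
    unfolding ladder_brackets lw_weights[OF assms(1) lw_T(1)]
    using lw_T x by (auto intro!: vs.span_add vs.span_scale lws_lower)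
  case 2 show ?case
    unfolding ladder_brackets using lw_T by (auto intro!: lws_lower)
next
  case (lw_U i j x)
  have x: "x \<in> vs.span (lws v)"
    using lw_U(1) by (auto intro: vs.span_base)
  case 1 show ?case
    unfolding ladder_brackets using lw_U by (auto intro!: lws_lower)
  case 2 show ?case
    unfolding ladder_brackets lw_weights[OF assms(1) lw_U(1)]
    using lw_U x by (auto intro!: vs.span_add vs.span_scale lws_lower)
qed

lemma lws_invariant:
  assumes "hw a v" shows "invariant_subspace s \<alpha> (vs.span (lws v))"
  by (rule stable_imp_invariant)
     (auto intro: lws_lower span_map_closed[OF good_Eij(1), of "lws v"] span_map_closed[OF good_Eij(3), of "lws v"]
        lw_raise[OF assms])

lemma irrep_words:
  assumes V: "is_irrep s \<alpha> V a" and v: "hw b v" "v \<in> V"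
  shows "V = vs.span (lws v)"
proof -
  have iV: "invariant_subspace s \<alpha> V"
    using V by (simp add: is_irrep_def)
  have "x \<in> V" if "lw v i j x" for i j x
    using that by induction (auto intro: v invariant_imp_sl[OF iV] good_Eij)
  then have sub: "vs.span (lws v) \<subseteq> V"
    using iV by (intro vs.span_minimal) (auto simp: invariant_subspace_def)
  moreover have "v \<in> vs.span (lws v)"
    by (auto intro: vs.span_base lw_base)
  moreover have "v \<noteq> 0"
    using v by (simp add: hw_def)
  ultimately have "vs.span (lws v) \<noteq> {0}"
    by blast
  moreover have "vs.span (lws v) = {0} \<or> vs.span (lws v) = V"
    using V lws_invariant[OF v(1)] sub by (simp add: is_irrep_def)
  ultimately show ?thesis
    by simp
qed

text \<open>The outermost letter of a word other than v is a lowering operator, and its adjoint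
  annihilates y.\<close>

lemma lw_orthogonal:
  assumes "lw v i j x" "Tp y = 0" "Up y = 0" "x \<noteq> v"
  shows "ip x y = 0"
  using assms(1)
proof cases
  case lw_base
  with assms(4) show ?thesis by simp
next
  case (lw_T i x')
  then show ?thesis by (simp only: ladder_adj(2) assms(2) ip_zero)
next
  case (lw_U j x')
  then show ?thesis by (simp only: ladder_adj(4) assms(3) ip_zero)
qed

lemma ip_span_zero:
  assumes "\<And>x. x \<in> B \<Longrightarrow> ip x y = 0" "x \<in> vs.span B"
  shows "ip x y = 0"
  using assms(2) by (induction rule: vs.span_induct_alt) (simp_all add: ip_add_left ip_scale_left assms(1))

text \<open>After subtracting the component along v, the remainder is orthogonal to v and to all
  other words, hence to the space V in which it lies.\<close>

lemma hw_unique: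
  assumes V: "V = vs.span (lws v)" and v: "hw a v"
    and x: "x \<in> V" "Tp x = 0" "Up x = 0"
  shows "\<exists>c. x = s c v"
proof -
  define c where "c = ip v x / ip v v"
  have v0: "ip v v \<noteq> 0"
    using v by (simp add: hw_def)
  define y where "y = x - s c v"
  have y: "Tp y = 0" "Up y = 0"
    using x v by (simp_all add: y_def sl_diff sl_scale good_Eij hw_def)
  have yv: "ip v y = 0"
    using v0 by (simp add: y_def ip_diff ip_scale_right c_def)
  have "y \<in> V"
    using x(1) unfolding V y_def
    by (rule vs.span_diff) (auto intro!: vs.span_scale intro: vs.span_base lw_base)
  moreover have "ip z y = 0" if "z \<in> lws v" for z
    using that lw_orthogonal[OF _ y, of v _ _ z] yv by (cases "z = v") auto
  ultimately have "ip y y = 0"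
    using ip_span_zero[of "lws v" y y] V by blast
  then show ?thesis
    by (auto simp: y_def)
qed

lemma T3_ortho:
  assumes "T3 x = s (of_real a) x" "T3 y = s (of_real b) y" "ip x y \<noteq> 0" shows "a = b"
  using ladder_adj(5)[of x y] assms by (auto simp: ip_scale_left ip_scale_right)

lemma U3_ortho:
  assumes "U3 x = s (of_real a) x" "U3 y = s (of_real b) y" "ip x y \<noteq> 0" shows "a = b"
  using ladder_adj(6)[of x y] assms by (auto simp: ip_scale_left ip_scale_right)

lemma weights_in_lattice:
  assumes "is_irrep s \<alpha> UNIV a" and x: "x \<noteq> 0" "T3 x = s (of_real t) x" "U3 x = s (of_real u) x"
  obtains i j :: nat where "t = real (fst a) / 2 - i + j / 2" "u = real (snd a) / 2 + i / 2 - j"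
proof -
  obtain v where v: "hw a v"
    using assms(1) by (auto simp: is_irrep_def hw_eq)
  have "x \<in> vs.span (lws v)"
    using irrep_words[OF assms(1) v] by simp
  then obtain i j y where y: "lw v i j y" "ip y x \<noteq> 0"
    using ip_span_zero[of "lws v" x x] x(1) by auto
  show ?thesis
    using T3_ortho[OF lw_weights(1)[OF v y(1)] x(2) y(2)] U3_ortho[OF lw_weights(2)[OF v y(1)] x(3) y(2)]
    by (intro that[of i j]) auto
qed

text \<open>The Weyl group element exchanging the first and third coordinate turns the upper bound for the
  weights of \<open>T3 + U3\<close> into a lower bound.\<close>

lemma sl_conj:
  assumes "good Z" "g \<in> SU3" shows "sl (g ** Z ** adj g) (\<alpha> g x) = \<alpha> g (sl Z x)"
proof -
  have "antiherm_part (g ** Z ** adj g) = g ** antiherm_part Z ** adj g"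
    "herm_part (g ** Z ** adj g) = g ** herm_part Z ** adj g"
    by (simp_all add: antiherm_part_def herm_part_def adj_mult matrix_mul_assoc cscale_mult_left cscale_mult_right
        matmul.add_left matmul.add_right matmul.diff_left matmul.diff_right)
  moreover obtain c d where t: "tangent c (antiherm_part Z)" "tangent d (herm_part Z)"
    using good_tangents[OF assms(1)] .
  ultimately show ?thesis
    by (simp add: sl_def dact_conj[OF t(1) assms(2)] dact_conj[OF t(2) assms(2)] act_adj act_add act_scale assms(2))
qed

lemma weights_bounded:
  assumes "is_irrep s \<alpha> UNIV a" and x: "x \<noteq> 0" "T3 x = s (of_real t) x" "U3 x = s (of_real u) x"
  shows "\<bar>t + u\<bar> \<le> (real (fst a) + real (snd a)) / 2"
proof -
  \<comment> \<open>Each letter of a word, \<open>Tm\<close> or \<open>Um\<close>, lowers t + u by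
    1/2.\<close>
  have up: "t + u \<le> (real (fst a) + real (snd a)) / 2"
    if "x \<noteq> 0" "T3 x = s (of_real t) x" "U3 x = s (of_real u) x" for x t u
    by (rule weights_in_lattice[OF assms(1) that]) (simp add: field_simps)
  \<comment> \<open>The middle sign makes the determinant of this permutation matrix equal to
    1.\<close>
  let ?w = "mat3 0 0 1 0 (-1) 0 1 0 (0::complex)"
  let ?H = "cscale (1/2) (Eij 1 1 - Eij 2 2)" and ?K = "cscale (1/2) (Eij 2 2 - Eij 3 3)"
  have w: "?w \<in> SU3"
    by (simp add: SU3_def mat3_simps det_3)
  have conj: "?w ** ?H ** adj ?w = cscale (-1) ?K" "?w ** ?K ** adj ?w = cscale (-1) ?H"
    by (simp_all add: mat3_simps)
  have "- U3 (\<alpha> ?w x) = s (of_real t) (\<alpha> ?w x)" "- T3 (\<alpha> ?w x) = s (of_real u) (\<alpha> ?w x)"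
    using sl_conj[OF good_Eij(5) w, of x] sl_conj[OF good_Eij(6) w, of x]
    by (simp_all only: conj sl_cscale_left[of "-1"] s_minus_one x act_scale[OF w])
  then have "U3 (\<alpha> ?w x) = s (of_real (-t)) (\<alpha> ?w x)" "T3 (\<alpha> ?w x) = s (of_real (-u)) (\<alpha> ?w x)"
    by (simp_all add: minus_equation_iff eq_commute[of "- _"])
  moreover have "\<alpha> ?w x \<noteq> 0"
    using act_adj(1)[OF w, of x] act_zero[OF SU3_adj[OF w]] x(1) by metis
  ultimately have "- u + - t \<le> (real (fst a) + real (snd a)) / 2"
    by (intro up)
  with up[OF x] show ?thesis
    by linarith
qed

section \<open>Schur's lemma and totality of orbits\<close>

lemma commute_dact:
  assumes "linear B" "\<And>g x. g \<in> SU3 \<Longrightarrow> B (\<alpha> g x) = \<alpha> g (B x)" "tangent c X"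
  shows "dact X (B x) = B (dact X x)"
proof (rule dact_eqI[OF assms(3)])
  have "bounded_linear B"
    using assms(1) linear_conv_bounded_linear by blast
  from bounded_linear.has_vector_derivative[OF this dact_spec(2)[OF assms(3), of x]]
  show "((\<lambda>t. \<alpha> (c t) (B x)) has_vector_derivative B (dact X x)) (at 0)"
    using assms(2,3) by (simp add: tangent_def)
qed

text \<open>B preserves annihilation by the raising operators, so it maps the highest weight vector
  v to a multiple of v. The corresponding eigenspace is invariant and nonzero.\<close>

lemma schur:
  assumes V: "is_irrep s \<alpha> UNIV a"
    and B: "\<And>x y. B (x + y) = B x + B y" "\<And>c x. B (s c x) = s c (B x)"
    and comm: "\<And>g x. g \<in> SU3 \<Longrightarrow> B (\<alpha> g x) = \<alpha> g (B x)"
  obtains c where "\<And>x. B x = s c x"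
proof -
  have lB: "linear B"
    by (rule linearI) (simp_all add: B flip: s_real)
  obtain v where v: "hw a v"
    using V by (auto simp: is_irrep_def hw_eq)
  have sl: "sl Z (B x) = B (sl Z x)" if Z: "good Z" for Z x
    using good_tangents[OF Z] commute_dact[OF lB comm] unfolding sl_def B by metis
  have B0: "B 0 = 0"
    using B(2)[of 0 0] by simp
  have "Tp (B v) = 0" "Up (B v) = 0"
    using v by (simp_all add: sl good_Eij hw_def B0)
  then obtain c where c: "B v = s c v"
    using hw_unique[OF irrep_words[OF V v] v] by auto
  have "invariant_subspace s \<alpha> {x. B x = s c x}"
    unfolding invariant_subspace_def vs.subspace_def
    by (auto simp: B B0 comm act_scale vs.scale_right_distrib mult.commute)
  then have "{x. B x = s c x} = {0} \<or> {x. B x = s c x} = UNIV"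
    using V by (simp add: is_irrep_def)
  moreover have "v \<in> {x. B x = s c x}" "v \<noteq> 0"
    using c v by (auto simp: hw_def)
  ultimately show ?thesis
    by (intro that[of c]) auto
qed

text \<open>The vectors orthogonal to the whole orbit form an invariant subspace that misses
  v.\<close>

lemma orbit_total:
  assumes V: "is_irrep s \<alpha> UNIV a" and v: "v \<noteq> 0" and x: "\<And>g. g \<in> SU3 \<Longrightarrow> ip (\<alpha> g v) x = 0"
  shows "x = 0"
proof -
  let ?R = "{x. \<forall>g\<in>SU3. ip (\<alpha> g v) x = 0}"
  have "ip (\<alpha> h v) (\<alpha> g y) = 0" if "y \<in> ?R" "g \<in> SU3" "h \<in> SU3" for g h y
    using ip_act[OF SU3_adj[OF that(2)], of "\<alpha> h v" y] that
    by (simp add: SU3_adj SU3_mult flip: act_mult)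
  then have "invariant_subspace s \<alpha> ?R"
    unfolding invariant_subspace_def vs.subspace_def by (auto simp: ip_add_right ip_scale_right)
  moreover have "v \<notin> ?R"
    using v by (auto simp: act_one intro!: bexI[of _ "mat 1"])
  ultimately have "?R = {0}"
    using V by (auto simp: is_irrep_def)
  with x show ?thesis
    by blast
qed

subsection \<open>Vectors fixed by the torus\<close>

lemma rot_C_torus: "rot genC12 t \<in> torus" "rot genC23 t \<in> torus"
  using rotgenD(2)[OF rotgen_gen(3)] rotgenD(2)[OF rotgen_gen(6)]
  by (simp_all add: torus_def forall_3 rot_gen su12_def su23_def)

lemma torus_rot:
  assumes "t \<in> torus" obtains \<theta> \<phi> where "t = rot genC12 \<theta> ** rot genC23 \<phi>"
proof -
  have t: "t \<in> SU3" "t $ 1 $ 2 = 0" "t $ 1 $ 3 = 0" "t $ 2 $ 1 = 0" "t $ 2 $ 3 = 0" "t $ 3 $ 1 = 0" "t $ 3 $ 2 = 0"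
    using assms by (auto simp: torus_def)
  have u: "cnj (t$1$1) * t$1$1 = 1" "cnj (t$2$2) * t$2$2 = 1" "cnj (t$3$3) * t$3$3 = 1"
    using SU3_unitary(1)[OF t(1)] by (simp_all add: mat3_simps t)
  have d: "t$1$1 * t$2$2 * t$3$3 = 1"
    using t by (simp add: SU3_def det_3)
  have ex: "\<exists>x. z = cis x" if "cnj z * z = 1" for z
  proof -
    have "of_real ((cmod z)\<^sup>2) = (1::complex)"
      using that complex_norm_square[of z] by (simp add: mult.commute)
    then have "(cmod z)\<^sup>2 = 1"
      using of_real_eq_1_iff by blast
    then have "cmod z = 1"
      using norm_ge_zero[of z] by (auto simp: power2_eq_1_iff)
    then show ?thesis
      using rcis_cmod_Arg[of z] by (metis mult_1 of_real_1 rcis_def)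
  qed
  obtain \<theta> \<psi> where th: "t$1$1 = cis \<theta>" "t$3$3 = cis \<psi>"
    using ex u by blast
  have "t$2$2 = cis (- \<theta> - \<psi>)"
  proof -
    have "t$2$2 = t$2$2 * (cis \<theta> * cis (- \<theta>)) * (cis \<psi> * cis (- \<psi>))"
      by (simp add: cis_mult)
    also have "\<dots> = cis (- \<theta>) * cis (- \<psi>)"
      using d th by (simp add: algebra_simps)
    finally show ?thesis
      by (simp add: cis_mult)
  qed
  then have "t = rot genC12 \<theta> ** rot genC23 (- \<psi>)"
    by (simp add: rot_gen su12_def su23_def mat3_simps t th cis_cnj cis_mult)
  then show ?thesis
    by (rule that)
qed

text \<open>A rotation commutes with its generator, so the derivative of the orbit, zero at time 0,
  is zero at all times.\<close>

lemma flow_fixed: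
  assumes "rotgen X" "dact X x = 0" shows "\<alpha> (rot X t) x = x"
proof -
  have "((\<lambda>t. \<alpha> (rot X t) x) has_vector_derivative 0) (at t)" for t
  proof -
    have "X ** (X ** X) = X ** X ** X"
      by (rule matrix_mul_assoc)
    then have "rot X t ** X = X ** rot X t"
      by (simp add: rot_def matmul.add_left matmul.add_right matmul.scaleR_left matmul.scaleR_right)
    then have "rot X t ** X ** adj (rot X t) = X"
      using SU3_unitary(2)[OF rotgenD(2)[OF assms(1)], of t] by (simp flip: matrix_mul_assoc)
    then have "dact X (\<alpha> (rot X t) x) = \<alpha> (rot X t) (dact X x)"
      using dact_conj[OF rotgen_tangent[OF assms(1)] rotgenD(2)[OF assms(1)], of t "\<alpha> (rot X t) x"]
      by (simp add: act_adj rotgenD(2)[OF assms(1)])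
    then show ?thesis
      using act_rot_derivative[OF assms(1), of x t] by (simp add: assms act_zero rotgenD(2)[OF assms(1)])
  qed
  then have "\<alpha> (rot X t) x = \<alpha> (rot X 0) x"
    by (intro has_derivative_zero_unique[of UNIV]) (auto simp: has_vector_derivative_def)
  then show ?thesis
    by (simp add: act_one)
qed

text \<open>The torus is the product of the two rotation groups of type C, and their generators act
  as 2i times \<open>T3\<close> and \<open>U3\<close>. This turns the torus condition on kernels
  into weight zero.\<close>

lemma torus_fixed_iff: "(\<forall>t\<in>torus. \<alpha> t x = x) \<longleftrightarrow> T3 x = 0 \<and> U3 x = 0"
proof
  assume *: "\<forall>t\<in>torus. \<alpha> t x = x"
  have "dact X x = 0" if "rotgen X" "\<And>t. rot X t \<in> torus" for X
    using dact_eqI[OF rotgen_tangent[OF that(1)], of x 0] * that(2) by simp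
  then have "dact genC12 x = 0" "dact genC23 x = 0"
    using rot_C_torus rotgen_gen by blast+
  then show "T3 x = 0 \<and> U3 x = 0"
    by (simp add: dact_ladder)
next
  assume "T3 x = 0 \<and> U3 x = 0"
  then have "dact genC12 x = 0" "dact genC23 x = 0"
    by (simp_all add: dact_ladder)
  then have "\<alpha> (rot genC12 t) x = x" "\<alpha> (rot genC23 t) x = x" for t
    by (simp_all add: flow_fixed rotgen_gen)
  then show "\<forall>t\<in>torus. \<alpha> t x = x"
    by (auto elim!: torus_rot simp: act_mult rotgenD rotgen_gen)
qed

end

section \<open>The irrep and its operators\<close>

definition vip :: "complex^'n \<Rightarrow> complex^'n \<Rightarrow> complex" where
  "vip x y = (\<Sum>i\<in>UNIV. cnj (x $ i) * y $ i)"

definition rank1 :: "complex^'n \<Rightarrow> complex^'n^'n" where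
  "rank1 v = (\<chi> i j. v $ i * cnj (v $ j))"

lemma vip_mult_vec: "vip (A *v x) y = vip x (adj A *v y)"
proof -
  have "vip (A *v x) y = (\<Sum>i\<in>UNIV. \<Sum>j\<in>UNIV. cnj (x $ j) * (cnj (A $ i $ j) * y $ i))"
    by (simp add: vip_def matrix_vector_mult_def sum_distrib_right sum_distrib_left mult_ac)
  also have "\<dots> = vip x (adj A *v y)"
    by (subst sum.swap) (simp add: vip_def matrix_vector_mult_def sum_distrib_left)
  finally show ?thesis .
qed

lemma hs_inner_sum: "hs_inner A B = (\<Sum>i\<in>UNIV. \<Sum>j\<in>UNIV. cnj (A $ i $ j) * B $ i $ j)"
  unfolding hs_inner_def trace_def matrix_matrix_mult_def by (subst sum.swap) simp

lemma hs_inner_adj: "hs_inner (adj A) (adj B) = hs_inner B A"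
  unfolding hs_inner_sum by (subst sum.swap) (simp add: mult.commute)

lemma trace_mult_hs: "trace (A ** B) = hs_inner (adj A) B"
  by (simp add: hs_inner_def)

lemma trace_mult_rank1: "trace (A ** rank1 v) = vip v (A *v v)"
  by (simp add: trace_def matrix_matrix_mult_def rank1_def vip_def matrix_vector_mult_def sum_distrib_left mult_ac)

lemma rank1_conj: "A ** rank1 v ** adj A = rank1 (A *v v)"
  by (simp add: veq rank1_def matrix_matrix_mult_def matrix_vector_mult_def sum_distrib_left sum_distrib_right mult_ac)

lemma bounded_bilinear_mult_vec: "bounded_bilinear ((*v) :: complex^'n^'m \<Rightarrow> _)"
proof -
  have "bilinear ((*v) :: complex^'n^'m \<Rightarrow> complex^'n \<Rightarrow> complex^'m)"
    by (auto simp: bilinear_def linear_iff veq matrix_vector_mult_def sum.distrib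
        algebra_simps scaleR_sum_right)
  then show ?thesis
    by (simp add: bilinear_conv_bounded_bilinear)
qed

interpretation matvec: bounded_bilinear "(*v) :: complex^'n^'m \<Rightarrow> _"
  by (rule bounded_bilinear_mult_vec)

lemma mult_vec_scale: "A *v (c *s x) = c *s (A *v x)" for A :: "complex^'n^'m"
  by (simp add: veq matrix_vector_mult_def sum_distrib_left mult_ac)

lemma cscale_mult_vec: "cscale c A *v x = c *s (A *v x)"
  by (simp add: veq matrix_vector_mult_def sum_distrib_left mult_ac)

lemma matrix_eq_vec: "(\<And>x. A *v x = B *v x) \<Longrightarrow> A = B" for A B :: "complex^'n^'m"
  by (simp add: matrix_eq)

locale su3_irrep =
  fixes p :: "nat \<times> nat" and \<rho> :: "complex^3^3 \<Rightarrow> complex^'n^'n"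
  assumes unitary_irrep: "unitary_irrep p \<rho>"
begin

lemma rho_one: "\<rho> (mat 1) = mat 1"
  and rho_mult: "g \<in> SU3 \<Longrightarrow> h \<in> SU3 \<Longrightarrow> \<rho> (g ** h) = \<rho> g ** \<rho> h"
  and rho_unitary: "g \<in> SU3 \<Longrightarrow> adj (\<rho> g) ** \<rho> g = mat 1"
  and rho_smooth: "smooth_submfd SU3 \<rho>"
  and rho_irrep: "is_irrep (*s) (\<lambda>g v. \<rho> g *v v) UNIV p"
  using unitary_irrep by (auto simp: unitary_irrep_def)

lemma rho_unitary': "g \<in> SU3 \<Longrightarrow> \<rho> g ** adj (\<rho> g) = mat 1"
  by (simp add: rho_unitary unitary_right)

lemma rho_adj: "g \<in> SU3 \<Longrightarrow> \<rho> (adj g) = adj (\<rho> g)"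
  by (metis SU3_adj SU3_unitary(1) matrix_mul_assoc matrix_mul_lid matrix_mul_rid rho_mult rho_one rho_unitary')

lemma conj_act_eq: "g \<in> SU3 \<Longrightarrow> conj_act \<rho> g A = \<rho> g ** A ** adj (\<rho> g)"
  by (simp add: conj_act_def matrix_inv_unitary rho_unitary)

text \<open>The linear map is the derivative at the identity of a local smooth extension of \<rho>
  to the ambient matrices. The chain rule applies to every curve, since near time 0 the curve stays
  where the extension agrees with \<rho>.\<close>

lemma rho_diff: "\<exists>F'. linear F' \<and> (\<forall>c X. tangent c X \<longrightarrow>
        ((\<lambda>t. \<rho> (c t)) has_vector_derivative F' X) (at 0))"
proof -
  obtain U F where U: "open U" "mat 1 \<in> U" "\<forall>k. Ck_on k U F" "\<forall>y\<in>U \<inter> SU3. F y = \<rho> y"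
    using rho_smooth SU3_one unfolding smooth_submfd_def by blast
  have "Ck_on (Suc 0) U F"
    using U(3) by blast
  then obtain f' where "\<forall>x\<in>U. (F has_derivative f' x) (at x)"
    by auto
  then have F: "(F has_derivative f' (mat 1)) (at (mat 1))"
    using U(2) by blast
  have "((\<lambda>t. \<rho> (c t)) has_vector_derivative f' (mat 1) X) (at 0)" if "tangent c X" for c X
  proof -
    have c: "c t \<in> SU3" "c 0 = mat 1" "(c has_vector_derivative X) (at 0)" for t
      using that by (auto simp: tangent_def)
    have "((F \<circ> c) has_derivative (f' (mat 1) \<circ> (\<lambda>t. t *\<^sub>R X))) (at 0)"
      using c F by (intro diff_chain_at) (auto simp: has_vector_derivative_def)
    moreover have "linear (f' (mat 1))"
      using F has_derivative_linear by blast
    ultimately have d: "((\<lambda>t. F (c t)) has_vector_derivative f' (mat 1) X) (at 0)"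
      by (simp add: has_vector_derivative_def o_def linear_scale)
    have "isCont c 0"
      using c(3) has_vector_derivative_continuous by blast
    then obtain T where T: "open T" "0 \<in> T" "\<forall>t\<in>T. c t \<in> U"
      unfolding continuous_at_open using U(1,2) c(2) by metis
    show ?thesis
      using d T U(4) c(1)
      by (auto intro: has_vector_derivative_transform_within_open[of _ _ _ T])
  qed
  moreover have "linear (f' (mat 1))"
    using F has_derivative_linear by blast
  ultimately show ?thesis
    by blast
qed

sublocale H: urep "(*s)" vip "\<lambda>g v. \<rho> g *v v"
proof
  show "of_real r *s x = r *\<^sub>R x" for r and x :: "complex^'n"
    by (simp add: veq scaleR_complex)
  show "vip x (y + z) = vip x y + vip x z" "vip x (c *s y) = c * vip x y" for x y z :: "complex^'n" and c
    by (simp_all add: vip_def sum.distrib sum_distrib_left algebra_simps)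
  show "vip y x = cnj (vip x y)" for x y :: "complex^'n"
    by (simp add: vip_def mult.commute)
  show "Re (vip x y) = x \<bullet> y" for x y :: "complex^'n"
    by (simp add: vip_def inner_vec_def inner_complex_def)
  show "\<rho> g *v (x + y) = \<rho> g *v x + \<rho> g *v y" "\<rho> g *v (c *s x) = c *s (\<rho> g *v x)" for g x y c
    by (simp_all add: matvec.add_right mult_vec_scale)
  show "\<rho> (g ** h) *v x = \<rho> g *v (\<rho> h *v x)" if "g \<in> SU3" "h \<in> SU3" for g h x
    by (simp add: rho_mult that matrix_vector_mul_assoc)
  show "\<rho> (mat 1) *v x = x" for x
    by (simp add: rho_one)
  show "vip (\<rho> g *v x) (\<rho> g *v y) = vip x y" if "g \<in> SU3" for g x y
    by (simp add: vip_mult_vec matrix_vector_mul_assoc rho_unitary that)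
  show "\<exists>F'. linear F' \<and> (\<forall>c X. tangent c X \<longrightarrow>
        ((\<lambda>t. \<rho> (c t) *v x) has_vector_derivative F' X) (at 0))" for x
  proof -
    obtain F' where F': "linear F'" "\<And>c X. tangent c X \<Longrightarrow> ((\<lambda>t. \<rho> (c t)) has_vector_derivative F' X) (at 0)"
      using rho_diff by blast
    have "linear (\<lambda>X. F' X *v x)"
      using F'(1) by (simp add: linear_iff matvec.add_left matvec.scaleR_left)
    moreover have "((\<lambda>t. \<rho> (c t) *v x) has_vector_derivative F' X *v x) (at 0)" if "tangent c X" for c X
      by (rule bounded_linear.has_vector_derivative[OF matvec.bounded_linear_left F'(2)[OF that]])
    ultimately show ?thesis
      by (intro exI[of _ "\<lambda>X. F' X *v x"]) blast
  qed
qed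

sublocale B: urep cscale hs_inner "conj_act \<rho>"
proof (intro urep.intro)
  show "vector_space (cscale :: complex \<Rightarrow> complex^'n^'n \<Rightarrow> _)"
    by (rule vector_space_cscale)
  show "cscale (of_real r) x = r *\<^sub>R x" for r and x :: "complex^'n^'n"
    by (rule cscale_scaleR)
  show "hs_inner x (y + z) = hs_inner x y + hs_inner x z" "hs_inner x (cscale c y) = c * hs_inner x y"
    for x y z :: "complex^'n^'n" and c
    by (simp_all add: hs_inner_sum sum.distrib sum_distrib_left algebra_simps)
  show "hs_inner y x = cnj (hs_inner x y)" for x y :: "complex^'n^'n"
    by (simp add: hs_inner_sum mult.commute)
  show "Re (hs_inner x y) = x \<bullet> y" for x y :: "complex^'n^'n"
    by (simp add: hs_inner_sum inner_vec_def inner_complex_def)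
  show "conj_act \<rho> g (x + y) = conj_act \<rho> g x + conj_act \<rho> g y" if "g \<in> SU3" for g x y
    by (simp add: conj_act_eq that matmul.add_left matmul.add_right)
  show "conj_act \<rho> g (cscale c x) = cscale c (conj_act \<rho> g x)" if "g \<in> SU3" for g x c
    by (simp add: conj_act_eq that cscale_mult_left cscale_mult_right)
  show "conj_act \<rho> (g ** h) x = conj_act \<rho> g (conj_act \<rho> h x)" if "g \<in> SU3" "h \<in> SU3" for g h x
    by (simp add: conj_act_eq that SU3_mult rho_mult adj_mult matrix_mul_assoc)
  show "conj_act \<rho> (mat 1) x = x" for x
    by (simp add: conj_act_eq rho_one)
  show "hs_inner (conj_act \<rho> g x) (conj_act \<rho> g y) = hs_inner x y" if "g \<in> SU3" for g x y
  proof -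
    have "adj (\<rho> g ** x ** adj (\<rho> g)) ** (\<rho> g ** y ** adj (\<rho> g)) =
        \<rho> g ** adj x ** (adj (\<rho> g) ** \<rho> g) ** y ** adj (\<rho> g)"
      by (simp add: adj_mult matrix_mul_assoc)
    also have "\<dots> = \<rho> g ** (adj x ** y ** adj (\<rho> g))"
      by (simp add: rho_unitary that matrix_mul_assoc)
    finally have "hs_inner (conj_act \<rho> g x) (conj_act \<rho> g y) = trace (\<rho> g ** (adj x ** y ** adj (\<rho> g)))"
      by (simp only: hs_inner_def conj_act_eq[OF that])
    also have "\<dots> = trace (adj x ** y ** adj (\<rho> g) ** \<rho> g)"
      by (rule trace_mul_sym)
    finally show ?thesis
      by (simp add: hs_inner_def rho_unitary that flip: matrix_mul_assoc)
  qed
  show "\<exists>F'. linear F' \<and> (\<forall>c X. tangent c X \<longrightarrow>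
        ((\<lambda>t. conj_act \<rho> (c t) A) has_vector_derivative F' X) (at 0))" for A
  proof -
    obtain F' where F': "linear F'" "\<And>c X. tangent c X \<Longrightarrow> ((\<lambda>t. \<rho> (c t)) has_vector_derivative F' X) (at 0)"
      using rho_diff by blast
    define G where "G X = \<rho> (mat 1) ** A ** adj (F' X) + F' X ** A ** adj (\<rho> (mat 1))" for X
    have "linear G"
      using F'(1) by (simp add: linear_iff G_def rho_one adj_add adj_scaleR matmul.add_left matmul.add_right
          matmul.scaleR_left matmul.scaleR_right algebra_simps)
    moreover have "((\<lambda>t. conj_act \<rho> (c t) A) has_vector_derivative G X) (at 0)" if "tangent c X" for c X
    proof -
      have c: "c t \<in> SU3" "c 0 = mat 1" for t
        using that by (auto simp: tangent_def)
      have "((\<lambda>t. \<rho> (c t) ** A ** adj (\<rho> (c t))) has_vector_derivative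
          (\<rho> (c 0) ** A ** adj (F' X) + F' X ** A ** adj (\<rho> (c 0)))) (at 0)"
        by (intro bounded_bilinear.has_vector_derivative[OF bounded_bilinear_matrix_mult]
            bounded_linear.has_vector_derivative[OF matmul.bounded_linear_left]
            bounded_linear.has_vector_derivative[OF bounded_linear_adj] F'(2) that)
      then show ?thesis
        by (simp add: G_def c conj_act_eq)
    qed
    ultimately show ?thesis
      by blast
  qed
qed

section \<open>Operators under conjugation: commutators and weights\<close>

lemma dact_commutator:
  assumes "tangent c X"
  shows "B.dact X A *v x = H.dact X (A *v x) - A *v H.dact X x"
proof -
  obtain F' where F': "linear F'" "\<And>c X. tangent c X \<Longrightarrow> ((\<lambda>t. \<rho> (c t)) has_vector_derivative F' X) (at 0)"
    using rho_diff by blast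
  have c: "c t \<in> SU3" "c 0 = mat 1" for t
    using assms by (auto simp: tangent_def)
  have d: "((\<lambda>t. \<rho> (c t) ** M ** adj (\<rho> (c t))) has_vector_derivative
      (\<rho> (c 0) ** M ** adj (F' X) + F' X ** M ** adj (\<rho> (c 0)))) (at 0)" for M
    by (intro bounded_bilinear.has_vector_derivative[OF bounded_bilinear_matrix_mult]
        bounded_linear.has_vector_derivative[OF matmul.bounded_linear_left]
        bounded_linear.has_vector_derivative[OF bounded_linear_adj] F'(2) assms)
  \<comment> \<open>The identity operator has a constant orbit, so this case of the formula shows
    that the differential of \<rho> is antihermitian.\<close>
  have "((\<lambda>t. mat 1) has_vector_derivative adj (F' X) + F' X) (at (0::real))"
    using d[of "mat 1"] by (simp add: c rho_unitary' rho_one)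
  then have "adj (F' X) + F' X = 0"
    using vector_derivative_unique_at has_vector_derivative_const by blast
  then have skew: "adj (F' X) = - F' X"
    by (simp add: eq_neg_iff_add_eq_0)
  have "B.dact X A = A ** adj (F' X) + F' X ** A"
    using d[of A] by (intro B.dact_eqI[OF assms]) (simp add: c conj_act_eq rho_one)
  moreover have "H.dact X y = F' X *v y" for y
    by (rule H.dact_eqI[OF assms])
       (rule bounded_linear.has_vector_derivative[OF matvec.bounded_linear_left F'(2)[OF assms]])
  ultimately show ?thesis
    by (simp add: skew matvec.diff_left matrix_vector_mul_assoc matmul.minus_right matvec.minus_left matvec.add_left)
qed

lemma sl_commutator:
  assumes "good Z" shows "B.sl Z A *v x = H.sl Z (A *v x) - A *v H.sl Z x"
proof -
  obtain c d where t: "tangent c (antiherm_part Z)" "tangent d (herm_part Z)"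
    using H.good_tangents[OF assms] .
  show ?thesis
    by (simp add: B.sl_def H.sl_def dact_commutator[OF t(1)] dact_commutator[OF t(2)] matvec.add_left
        cscale_mult_vec matvec.add_right mult_vec_scale vec.scale_right_diff_distrib)
qed

lemma invariant_operator_scalar:
  assumes "\<And>g. g \<in> SU3 \<Longrightarrow> conj_act \<rho> g A = A"
  obtains c where "A = cscale c (mat 1)"
proof -
  have "A *v (\<rho> g *v x) = \<rho> g *v (A *v x)" if g: "g \<in> SU3" for g x
  proof -
    have "A ** \<rho> g = \<rho> g ** A ** (adj (\<rho> g) ** \<rho> g)"
      using assms[OF g] by (simp add: conj_act_eq g matrix_mul_assoc)
    then show ?thesis
      by (simp add: rho_unitary g matrix_vector_mul_assoc)
  qed
  then obtain c where "\<And>x. A *v x = c *s x"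
    using H.schur[OF rho_irrep, of "(*v) A"] by (auto simp: matvec.add_right mult_vec_scale)
  then have "A = cscale c (mat 1)"
    by (intro matrix_eq_vec) (simp add: cscale_mult_vec)
  then show ?thesis
    by (rule that)
qed

text \<open>A maps some weight vector x of the irrep to a nonzero weight vector with weight shifted
  by (t, u). Both weights obey the bound |p|/2, hence the bound |p| for the difference. A letter
  \<open>Tm\<close> or \<open>Um\<close> changes 2t - 2u by -3 or +3, whence the
  divisibility.\<close>

lemma operator_weights:
  assumes "A \<noteq> 0" "B.T3 A = cscale (of_real t) A" "B.U3 A = cscale (of_real u) A"
  shows "\<bar>t + u\<bar> \<le> real (fst p) + real (snd p)" and "\<exists>k::int. 2 * t - 2 * u = 3 * of_int k"
proof -
  obtain v where v: "H.hw p v"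
    using rho_irrep by (auto simp: is_irrep_def H.hw_eq)
  obtain x0 where "A *v x0 \<noteq> 0"
    using assms(1) matrix_eq_vec[of A 0] by (auto simp: matvec.zero_left)
  moreover have "A *v x = 0" if "\<And>i j x. H.lw v i j x \<Longrightarrow> A *v x = 0" for x
  proof -
    have "x \<in> vec.span (H.lws v)"
      using H.irrep_words[OF rho_irrep v] by simp
    then show ?thesis
      by (induction rule: vec.span_induct_alt) (auto simp: that matvec.add_right mult_vec_scale)
  qed
  ultimately obtain i j x where x: "H.lw v i j x" "A *v x \<noteq> 0"
    by blast
  define t' u' where "t' = real (fst p) / 2 - i + j / 2" and "u' = real (snd p) / 2 + i / 2 - j"
  have x': "H.T3 x = of_real t' *s x" "H.U3 x = of_real u' *s x" "x \<noteq> 0"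
    using H.lw_weights[OF v x(1)] x(2) by (auto simp: t'_def u'_def)
  have "H.T3 (A *v x) = of_real (t + t') *s (A *v x)" "H.U3 (A *v x) = of_real (u + u') *s (A *v x)"
    using sl_commutator[OF good_Eij(5), of A x] sl_commutator[OF good_Eij(6), of A x]
    by (simp_all add: assms x' cscale_mult_vec mult_vec_scale vec.scale_left_distrib)
  note Ax = x(2) this
  show "\<bar>t + u\<bar> \<le> real (fst p) + real (snd p)"
    using H.weights_bounded[OF rho_irrep Ax] H.weights_bounded[OF rho_irrep x'(3,1,2)] by argo
  obtain i' j' where ij: "t + t' = real (fst p) / 2 - real i' + real j' / 2"
      "u + u' = real (snd p) / 2 + real i' / 2 - real j'"
    using H.weights_in_lattice[OF rho_irrep Ax] by metis
  have "2 * t - 2 * u = 3 * of_int ((int j' - int i') - (int j - int i))"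
    using ij unfolding t'_def u'_def by (simp add: field_simps)
  then show "\<exists>k::int. 2 * t - 2 * u = 3 * of_int k"
    by blast
qed

text \<open>The symbol defined by a highest weight projection is injective: if \<open>\<langle>v, A\<^sup>g v\<rangle> = 0\<close> for all
  \<open>g\<close>, then lowering operators can be moved past \<open>A\<close> so that \<open>\<langle>v, A w\<rangle> = 0\<close> for all \<open>w\<close>.\<close>

lemma rank1_injective:
  assumes v: "H.hw p v" and A: "\<And>g. g \<in> SU3 \<Longrightarrow> trace (A ** conj_act \<rho> g (rank1 v)) = 0"
  shows "A = 0"
proof -
  define R where "R = {A. \<forall>g\<in>SU3. vip (\<rho> g *v v) (A *v (\<rho> g *v v)) = 0}"
  have AR: "A \<in> R"
    using A by (simp add: R_def conj_act_eq rank1_conj trace_mult_rank1)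
  have inv: "invariant_subspace cscale (conj_act \<rho>) R"
    unfolding invariant_subspace_def B.vs.subspace_def
  proof (intro conjI ballI allI)
    fix h C assume h: "h \<in> SU3" and C: "C \<in> R"
    have "vip (\<rho> g *v v) (conj_act \<rho> h C *v (\<rho> g *v v)) = 0" if g: "g \<in> SU3" for g
    proof -
      have "vip (\<rho> g *v v) (conj_act \<rho> h C *v (\<rho> g *v v)) =
          vip (\<rho> (adj h ** g) *v v) (C *v (\<rho> (adj h ** g) *v v))"
        using h g SU3_adj[OF h]
        by (simp add: conj_act_eq rho_mult rho_adj vip_mult_vec[of "\<rho> _ ** _"] adj_mult
            vip_mult_vec[of "adj _ ** _"] matrix_vector_mul_assoc vip_mult_vec matrix_mul_assoc)
      also have "\<dots> = 0"
        using C h g by (simp add: R_def SU3_mult SU3_adj)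
      finally show ?thesis .
    qed
    then show "conj_act \<rho> h C \<in> R"
      by (simp add: R_def)
  qed (auto simp: R_def matvec.zero_left matvec.add_left H.ip_add_right cscale_mult_vec H.ip_scale_right)
  \<comment> \<open>All C in R must be treated at once: moving a lowering operator past C produces
    the commutator, a different element of the invariant subspace R.\<close>
  have word: "\<forall>C\<in>R. vip v (C *v x) = 0" if "H.lw v i j x" for i j x
    using that
  proof (induction rule: H.lw.induct)
    case lw_base
    show ?case
      by (auto simp: R_def rho_one dest!: bspec[of _ _ "mat 1"])
  next
    case (lw_T i j x)
    have "vip v (C *v H.Tm x) = 0" if C: "C \<in> R" for C
    proof -
      have "C *v H.Tm x = H.Tm (C *v x) - B.Tm C *v x"
        by (simp add: sl_commutator good_Eij)
      moreover have "vip v (H.Tm (C *v x)) = 0"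
        using v by (simp add: H.hw_def flip: H.ladder_adj(1))
      moreover have "vip v (B.Tm C *v x) = 0"
        using lw_T B.invariant_imp_sl[OF inv good_Eij(2) C] by blast
      ultimately show ?thesis
        by (simp add: H.ip_diff)
    qed
    then show ?case by blast
  next
    case (lw_U i j x)
    have "vip v (C *v H.Um x) = 0" if C: "C \<in> R" for C
    proof -
      have "C *v H.Um x = H.Um (C *v x) - B.Um C *v x"
        by (simp add: sl_commutator good_Eij)
      moreover have "vip v (H.Um (C *v x)) = 0"
        using v by (simp add: H.hw_def flip: H.ladder_adj(3))
      moreover have "vip v (B.Um C *v x) = 0"
        using lw_U B.invariant_imp_sl[OF inv good_Eij(4) C] by blast
      ultimately show ?thesis
        by (simp add: H.ip_diff)
    qed
    then show ?case by blast
  qed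
  have all: "vip v (C *v x) = 0" if "C \<in> R" for C x
  proof -
    have "x \<in> vec.span (H.lws v)"
      using H.irrep_words[OF rho_irrep v] by simp
    then show ?thesis
      by (induction rule: vec.span_induct_alt)
         (use word that in \<open>auto simp: matvec.add_right mult_vec_scale H.ip_add_right H.ip_scale_right\<close>)
  qed
  have v0: "v \<noteq> 0"
    using v by (simp add: H.hw_def)
  show "A = 0"
  proof (rule matrix_eq_vec)
    fix y
    \<comment> \<open>Invariance of R replaces v by any point of its orbit, and the orbit is
      total.\<close>
    have "vip (\<rho> g *v v) (A *v y) = 0" if g: "g \<in> SU3" for g
    proof -
      have "conj_act \<rho> (adj g) A \<in> R"
        using inv AR SU3_adj[OF g] by (simp add: invariant_subspace_def)
      then have "vip v (conj_act \<rho> (adj g) A *v (adj (\<rho> g) *v y)) = 0"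
        by (rule all)
      then show ?thesis
        using g by (simp add: conj_act_eq SU3_adj rho_adj vip_mult_vec matrix_vector_mul_assoc
            rho_unitary' flip: matrix_mul_assoc)
    qed
    then have "A *v y = 0"
      by (rule H.orbit_total[OF rho_irrep v0])
    then show "A *v y = 0 *v y"
      by (simp add: matvec.zero_left)
  qed
qed

end

section \<open>Gelfand-Tsetlin labels\<close>

text \<open>The coordinates r_-, r_+, \<nu>_3 of the pattern: here admissibility is a chain of
  inequalities, and each lowering step increases exactly one coordinate by 1.\<close>

definition lbl :: "nat \<times> nat \<Rightarrow> int \<Rightarrow> int \<Rightarrow> int \<Rightarrow> gt_label" where
  "lbl a rm rp n = ((int (fst a) + 2 * int (snd a) - (rp + rm), rp + rm - n, n), real_of_int (rp - rm) / 2)"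

definition lbl_ok :: "nat \<times> nat \<Rightarrow> int \<Rightarrow> int \<Rightarrow> int \<Rightarrow> bool" where
  "lbl_ok a rm rp n \<longleftrightarrow> 0 \<le> rm \<and> rm \<le> int (snd a) \<and> int (snd a) \<le> rp \<and> rp \<le> int (fst a) + int (snd a) \<and>
     rm \<le> n \<and> n \<le> rp"

lemma gt_labels_iff: "l \<in> gt_labels a \<longleftrightarrow> (\<exists>rm rp n. lbl_ok a rm rp n \<and> l = lbl a rm rp n)"
  unfolding gt_labels_def lbl_def lbl_ok_def by (cases a) auto

lemma lbl_in: "lbl_ok a rm rp n \<Longrightarrow> lbl a rm rp n \<in> gt_labels a"
  by (auto simp: gt_labels_iff)

lemma gt_labelsE:
  assumes "l \<in> gt_labels a" obtains rm rp n where "lbl_ok a rm rp n" "l = lbl a rm rp n"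
  using assms by (auto simp: gt_labels_iff)

lemma finite_gt_labels: "finite (gt_labels a)"
proof -
  let ?I = "{0..int (fst a) + int (snd a)}"
  have "gt_labels a \<subseteq> (\<lambda>(rm, rp, n). lbl a rm rp n) ` (?I \<times> ?I \<times> ?I)"
  proof
    fix l assume "l \<in> gt_labels a"
    then obtain rm rp n where *: "lbl_ok a rm rp n" "l = lbl a rm rp n"
      by (rule gt_labelsE)
    then have "(rm, rp, n) \<in> ?I \<times> ?I \<times> ?I"
      by (auto simp: lbl_ok_def)
    then show "l \<in> (\<lambda>(rm, rp, n). lbl a rm rp n) ` (?I \<times> ?I \<times> ?I)"
      using *(2) by force
  qed
  then show ?thesis
    by (rule finite_subset) simp
qed

section \<open>Weights of labels and the lowering steps on them\<close>

definition lab_t :: "gt_label \<Rightarrow> real" where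
  "lab_t l = (case l of ((\<nu>1, \<nu>2, \<nu>3), J) \<Rightarrow> real_of_int (\<nu>1 - \<nu>2) / 2)"

definition lab_u :: "gt_label \<Rightarrow> real" where
  "lab_u l = (case l of ((\<nu>1, \<nu>2, \<nu>3), J) \<Rightarrow> real_of_int (\<nu>2 - \<nu>3) / 2)"

definition lab_n :: "gt_label \<Rightarrow> real" where
  "lab_n l = (case l of ((\<nu>1, \<nu>2, \<nu>3), J) \<Rightarrow> real_of_int \<nu>3)"

text \<open>Up to a constant depending on the irrep, the number of lowering steps from the highest
  weight label. Both entries are nonnegative on admissible labels, so \<open>nat\<close> loses
  nothing there.\<close>

definition grade :: "gt_label \<Rightarrow> nat" where
  "grade l = (case l of ((\<nu>1, \<nu>2, \<nu>3), J) \<Rightarrow> nat (\<nu>2 + 2 * \<nu>3))"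

definition lowU :: "gt_label \<Rightarrow> gt_label" where
  "lowU l = (case l of ((\<nu>1, \<nu>2, \<nu>3), J) \<Rightarrow> ((\<nu>1, \<nu>2 - 1, \<nu>3 + 1), J))"

definition lowT1 :: "gt_label \<Rightarrow> gt_label" where
  "lowT1 l = (case l of ((\<nu>1, \<nu>2, \<nu>3), J) \<Rightarrow> ((\<nu>1 - 1, \<nu>2 + 1, \<nu>3), J - 1/2))"

definition lowT2 :: "gt_label \<Rightarrow> gt_label" where
  "lowT2 l = (case l of ((\<nu>1, \<nu>2, \<nu>3), J) \<Rightarrow> ((\<nu>1 - 1, \<nu>2 + 1, \<nu>3), J + 1/2))"

definition coefU :: "gt_label \<Rightarrow> real" where
  "coefU l = (let J = snd l; u = lab_u l in sqrt ((J + u) * (J - u + 1)))"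

definition coefT1 :: "nat \<times> nat \<Rightarrow> gt_label \<Rightarrow> real" where
  "coefT1 a l = (let p = real (fst a); q = real (snd a); J = snd l; u = lab_u l; n3 = lab_n l in
     sqrt ((J - u) * (p + q + J - u - n3 + 1) * (q + J - u - n3) * (u - J + n3 + 1) / (2 * J * (2 * J + 1))))"

definition coefT2 :: "nat \<times> nat \<Rightarrow> gt_label \<Rightarrow> real" where
  "coefT2 a l = (let p = real (fst a); q = real (snd a); J = snd l; u = lab_u l; n3 = lab_n l in
     sqrt ((J + u + 1) * (p + q - J - u - n3) * (J + u + 1 + n3 - q) * (J + u + 2 + n3)
       / (2 * (J + 1) * (2 * J + 1))))"

lemma lbl_J_u:
  "snd (lbl a rm rp n) + lab_u (lbl a rm rp n) = real_of_int (rp - n)"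
  "snd (lbl a rm rp n) - lab_u (lbl a rm rp n) = real_of_int (n - rm)"
  "lab_n (lbl a rm rp n) = real_of_int n"
  by (simp_all add: lbl_def lab_u_def lab_n_def field_simps)

lemma coefU_lbl: "coefU (lbl a rm rp n) = sqrt (real_of_int (rp - n) * (real_of_int (n - rm) + 1))"
  by (simp only: coefU_def Let_def lbl_J_u)

text \<open>Two factors under the root are \<nu>_3 - r_- and q - r_-. They vanish where increasing
  r_- would violate r_- <= \<nu>_3 or r_- <= q.\<close>

lemma coefT1_factor:
  "n = rm \<or> int (snd a) = rm \<Longrightarrow> coefT1 a (lbl a rm rp n) = 0"
proof -
  have "real (snd a) + snd (lbl a rm rp n) - lab_u (lbl a rm rp n) - lab_n (lbl a rm rp n) = real_of_int (int (snd a) - rm)"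
    using lbl_J_u[of a rm rp n] by simp
  moreover assume "n = rm \<or> int (snd a) = rm"
  ultimately show ?thesis
    using lbl_J_u(2)[of a rm rp n] by (auto simp: coefT1_def Let_def)
qed

lemma coefT2_factor:
  "int (fst a) + int (snd a) = rp \<Longrightarrow> coefT2 a (lbl a rm rp n) = 0"
proof -
  have "real (fst a) + real (snd a) - snd (lbl a rm rp n) - lab_u (lbl a rm rp n) - lab_n (lbl a rm rp n)
      = real_of_int (int (fst a) + int (snd a) - rp)"
    using lbl_J_u(1,3)[of a rm rp n] by simp
  moreover assume "int (fst a) + int (snd a) = rp"
  ultimately show ?thesis
    by (simp add: coefT2_def Let_def)
qed

lemma low_lbl:
  "lowU (lbl a rm rp n) = lbl a rm rp (n + 1)"
  "lowT1 (lbl a rm rp n) = lbl a (rm + 1) rp n"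
  "lowT2 (lbl a rm rp n) = lbl a rm (rp + 1) n"
  by (simp_all add: lowU_def lowT1_def lowT2_def lbl_def field_simps)

text \<open>A step out of the label set carries coefficient zero, so the arbitrary values of
  \<open>e\<close> at inadmissible labels never contribute.\<close>

lemma low_in_labels:
  assumes "l \<in> gt_labels a"
  shows "coefU l \<noteq> 0 \<Longrightarrow> lowU l \<in> gt_labels a"
    and "coefT1 a l \<noteq> 0 \<Longrightarrow> lowT1 l \<in> gt_labels a"
    and "coefT2 a l \<noteq> 0 \<Longrightarrow> lowT2 l \<in> gt_labels a"
proof -
  obtain rm rp n where l: "lbl_ok a rm rp n" "l = lbl a rm rp n"
    using assms by (rule gt_labelsE)
  show "lowU l \<in> gt_labels a" if "coefU l \<noteq> 0"
    using that l unfolding l(2) low_lbl coefU_lbl by (intro lbl_in) (auto simp: lbl_ok_def)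
  show "lowT1 l \<in> gt_labels a" if "coefT1 a l \<noteq> 0"
  proof -
    have "n \<noteq> rm" "int (snd a) \<noteq> rm"
      using that coefT1_factor[of n rm a rp] by (auto simp: l(2))
    with l(1) show ?thesis
      unfolding l(2) low_lbl by (intro lbl_in, unfold lbl_ok_def) presburger
  qed
  show "lowT2 l \<in> gt_labels a" if "coefT2 a l \<noteq> 0"
  proof -
    have "int (fst a) + int (snd a) \<noteq> rp"
      using that coefT2_factor[of a rp rm n] by (auto simp: l(2))
    with l(1) show ?thesis
      unfolding l(2) low_lbl by (intro lbl_in, unfold lbl_ok_def) presburger
  qed
qed

lemma lab_low:
  "lab_t (lowU l) = lab_t l + 1/2" "lab_u (lowU l) = lab_u l - 1"
  "lab_t (lowT1 l) = lab_t l - 1" "lab_u (lowT1 l) = lab_u l + 1/2"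
  "lab_t (lowT2 l) = lab_t l - 1" "lab_u (lowT2 l) = lab_u l + 1/2"
  by (simp_all add: lab_t_def lab_u_def lowU_def lowT1_def lowT2_def field_simps split: prod.splits)

lemma grade_low:
  assumes "l \<in> gt_labels a"
  shows "grade (lowU l) = Suc (grade l)" "grade (lowT1 l) = Suc (grade l)" "grade (lowT2 l) = Suc (grade l)"
  using assms by (auto simp: gt_labels_iff lbl_def lbl_ok_def grade_def lowU_def lowT1_def lowT2_def)

definition hwl :: "nat \<times> nat \<Rightarrow> gt_label" where
  "hwl a = ((int (fst a) + int (snd a), int (snd a), 0), real (snd a) / 2)"

text \<open>The lowest weight label: all three lowering coefficients vanish there, and the adjoint
  rule carries it to the highest weight label of the dual irrep.\<close>

definition lwl :: "nat \<times> nat \<Rightarrow> gt_label" where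
  "lwl a = ((0, int (snd a), int (fst a) + int (snd a)), real (fst a) / 2)"

lemma hwl_lbl: "hwl a = lbl a 0 (int (snd a)) 0"
  by (simp add: hwl_def lbl_def)

lemma lwl_lbl: "lwl a = lbl a (int (snd a)) (int (fst a) + int (snd a)) (int (fst a) + int (snd a))"
  by (simp add: lwl_def lbl_def)

lemma hwl_in: "hwl a \<in> gt_labels a"
  unfolding hwl_lbl by (rule lbl_in) (simp add: lbl_ok_def)

lemma lwl_in: "lwl a \<in> gt_labels a"
  unfolding lwl_lbl by (rule lbl_in) (simp add: lbl_ok_def)

lemma lwl_coef: "coefU (lwl a) = 0" "coefT1 a (lwl a) = 0" "coefT2 a (lwl a) = 0"
  unfolding lwl_lbl by (simp_all add: coefU_lbl coefT1_factor coefT2_factor)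

lemma lab_hwl: "lab_t (hwl a) = real (fst a) / 2" "lab_u (hwl a) = real (snd a) / 2"
  by (simp_all add: hwl_def lab_t_def lab_u_def)

lemma lab_lwl: "lab_t (lwl a) = - real (snd a) / 2" "lab_u (lwl a) = - real (fst a) / 2"
  by (simp_all add: lwl_def lab_t_def lab_u_def)

section \<open>Labels of weight zero\<close>

definition zlab :: "nat \<times> nat \<Rightarrow> nat \<Rightarrow> gt_label" where
  "zlab a \<gamma> = (zero_label a, zero_J a \<gamma>)"

text \<open>Weight zero means \<open>r\<^sub>+ + r\<^sub>- = 2 c\<close> with \<open>c = (a + 2 b) / 3\<close>.\<close>

lemma zlab_lbl:
  assumes "3 dvd int (fst a) - int (snd a)" "\<gamma> \<in> {1..zero_mult a}"
  obtains rm rp n where "lbl_ok a rm rp n" "zlab a \<gamma> = lbl a rm rp n" "2 * n = rm + rp"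
    "3 * n = int (fst a) + 2 * int (snd a)"
proof (cases "snd a \<le> fst a")
  case True
  obtain d where d: "int (fst a) - int (snd a) = 3 * int d"
  proof -
    obtain k where k: "int (fst a) - int (snd a) = 3 * k"
      using assms(1) by (rule dvdE)
    then have "k = int (nat k)"
      using True by linarith
    with k show ?thesis
      by (intro that[of "nat k"]) simp
  qed
  then have a: "fst a = snd a + 3 * d"
    by linarith
  \<comment> \<open>The witnesses are r_- = c - J, r_+ = c + J and \<nu>_3 = c, with J = d +
    \<gamma> - 1 and c = b + d for the pair (a, b). The other case is the same with c = a +
    2d.\<close>
  show ?thesis
    by (rule that[of "int (snd a) - (int \<gamma> - 1)" "int (snd a) + 2 * int d + (int \<gamma> - 1)" "int (snd a) + int d"])
       (use assms(2) in \<open>auto simp: lbl_ok_def zlab_def zero_label_def zero_J_def lbl_def a zero_mult_def Let_def field_simps\<close>)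
next
  case False
  obtain d where d: "int (snd a) - int (fst a) = 3 * int d"
  proof -
    obtain k where k: "int (fst a) - int (snd a) = 3 * k"
      using assms(1) by (rule dvdE)
    then have "- k = int (nat (- k))"
      using False by linarith
    with k show ?thesis
      by (intro that[of "nat (- k)"]) simp
  qed
  then have a: "snd a = fst a + 3 * d"
    by linarith
  show ?thesis
    by (rule that[of "int (fst a) + int d - (int \<gamma> - 1)" "int (snd a) + (int \<gamma> - 1)" "int (fst a) + 2 * int d"])
       (use assms(2) in \<open>auto simp: lbl_ok_def zlab_def zero_label_def zero_J_def lbl_def a zero_mult_def Let_def field_simps\<close>)
qed

lemma zlab_in: "3 dvd int (fst a) - int (snd a) \<Longrightarrow> \<gamma> \<in> {1..zero_mult a} \<Longrightarrow> zlab a \<gamma> \<in> gt_labels a"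
  using zlab_lbl lbl_in by metis

lemma zlab_weight:
  assumes "3 dvd int (fst a) - int (snd a)" "\<gamma> \<in> {1..zero_mult a}"
  shows "lab_t (zlab a \<gamma>) = 0" "lab_u (zlab a \<gamma>) = 0"
proof -
  obtain rm rp n where *: "lbl_ok a rm rp n" "zlab a \<gamma> = lbl a rm rp n" "2 * n = rm + rp"
    "3 * n = int (fst a) + 2 * int (snd a)"
    using zlab_lbl[OF assms] .
  have z: "int (fst a) + 2 * int (snd a) - (rp + rm) - (rp + rm - n) = 0" "rp + rm - n - n = 0"
    using *(3,4) by linarith+
  show "lab_t (zlab a \<gamma>) = 0" "lab_u (zlab a \<gamma>) = 0"
    by (simp_all only: *(2) lbl_def lab_t_def lab_u_def prod.case z of_int_0 div_0)
qed

lemma zlab_inj: "zlab a \<gamma> = zlab a \<gamma>' \<longleftrightarrow> \<gamma> = \<gamma>'"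
  by (simp add: zlab_def zero_J_def)

lemma zlab_surj:
  assumes "l \<in> gt_labels a" "lab_t l = 0" "lab_u l = 0"
  obtains \<gamma> where "\<gamma> \<in> {1..zero_mult a}" "l = zlab a \<gamma>"
proof -
  obtain rm rp n where l: "lbl_ok a rm rp n" "l = lbl a rm rp n"
    using assms(1) by (rule gt_labelsE)
  have n: "2 * n = rm + rp" "3 * n = int (fst a) + 2 * int (snd a)"
    using assms(2,3) l(2) by (auto simp: lab_t_def lab_u_def lbl_def)
  have c: "int ((fst a + 2 * snd a) div 3) = n"
    using n(2) by linarith
  have "rp = 2 * n - rm"
    using n(1) by simp
  then have J: "real_of_int (rp - rm) / 2 = of_int (n - rm)"
    by simp
  have e: "int (fst a) + 2 * int (snd a) - (rp + rm) = n" "rp + rm - n = n"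
    using n by linarith+
  have zl: "zero_label a = (n, n, n)"
    using c by (simp add: zero_label_def Let_def)
  \<comment> \<open>Here J = n - rm, and \<gamma> is solved from J = \<gamma> - 1 + d.\<close>
  have lz: "l = zlab a (nat (n - rm - d + 1))"
    if "\<bar>real (fst a) - real (snd a)\<bar> / 3 = of_int d" "0 \<le> n - rm - d" for d
    unfolding l(2) lbl_def zlab_def zl zero_J_def e J that(1) using that(2) by simp
  show ?thesis
  proof (cases "snd a \<le> fst a")
    case True
    define d where "d = n - int (snd a)"
    have d: "int (fst a) - int (snd a) = 3 * d" "0 \<le> d"
      using n(2) True by (auto simp: d_def)
    have "real (fst a) - real (snd a) = 3 * of_int d"
      using d(1) by linarith
    then have rd: "\<bar>real (fst a) - real (snd a)\<bar> / 3 = of_int d"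
      using d(2) by simp
    have g: "0 \<le> n - rm - d" "n - rm - d \<le> int (snd a)" "min (fst a) (snd a) = snd a"
      using l(1) True by (auto simp: d_def lbl_ok_def)
    then show ?thesis
      by (intro that[OF _ lz[OF rd]]) (auto simp: zero_mult_def)
  next
    case False
    define d where "d = int (snd a) - n"
    have d: "int (snd a) - int (fst a) = 3 * d" "0 \<le> d"
      using n(2) False by (auto simp: d_def)
    have "real (snd a) - real (fst a) = 3 * of_int d"
      using d(1) by linarith
    then have rd: "\<bar>real (fst a) - real (snd a)\<bar> / 3 = of_int d"
      using d(2) by simp
    have "n - rm - d = rp - int (snd a)"
      using n(1) by (simp add: d_def)
    then have g: "0 \<le> n - rm - d" "n - rm - d \<le> int (fst a)" "min (fst a) (snd a) = fst a"
      using l(1) False by (auto simp: lbl_ok_def)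
    then show ?thesis
      by (intro that[OF _ lz[OF rd]]) (auto simp: zero_mult_def)
  qed
qed

lemma dual_hwl: "dual_label a (fst (lwl a)) = fst (hwl (prod.swap a))" "snd (lwl a) = snd (hwl (prod.swap a))"
  by (cases a; simp add: dual_label_def lwl_def hwl_def)+

lemma dual_zlab:
  assumes "3 dvd int (fst a) - int (snd a)"
  shows "dual_label a (zero_label a) = zero_label (prod.swap a)"
    "zero_J (prod.swap a) \<gamma> = zero_J a \<gamma>"
proof -
  obtain k where k: "int (fst a) = int (snd a) + 3 * k"
    using assms by (auto elim!: dvdE simp: algebra_simps)
  have "int ((fst a + 2 * snd a) div 3) = int (snd a) + k" "int ((snd a + 2 * fst a) div 3) = int (snd a) + 2 * k"
    using k by (simp_all add: zdiv_int)
  then show "dual_label a (zero_label a) = zero_label (prod.swap a)"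
    using k by (cases a) (simp add: dual_label_def zero_label_def Let_def)
  show "zero_J (prod.swap a) \<gamma> = zero_J a \<gamma>"
    by (simp add: zero_J_def abs_minus_commute)
qed

section \<open>Gelfand-Tsetlin decompositions\<close>

locale su3_gt = su3_irrep p \<rho> for p and \<rho> :: "complex^3^3 \<Rightarrow> complex^'n^'n" +
  fixes m :: "nat \<times> nat \<Rightarrow> nat"
    and V :: "nat \<times> nat \<Rightarrow> nat \<Rightarrow> (complex^'n^'n) set"
    and e :: "nat \<times> nat \<Rightarrow> nat \<Rightarrow> int \<times> int \<times> int \<Rightarrow> real \<Rightarrow> complex^'n^'n"
  assumes gt_decomposition: "gt_decomposition p \<rho> m V e"
begin

definition E :: "nat \<times> nat \<Rightarrow> nat \<Rightarrow> gt_label \<Rightarrow> complex^'n^'n" where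
  "E a \<sigma> l = e a \<sigma> (fst l) (snd l)"

lemmas gtd = gt_decomposition[unfolded gt_decomposition_def]

lemma V_irrep: "\<sigma> \<in> {1..m a} \<Longrightarrow> is_irrep cscale (conj_act \<rho>) (V a \<sigma>) a"
  using gtd[THEN conjunct1] by blast

lemma V_orthogonal: "\<sigma> \<in> {1..m a} \<Longrightarrow> \<tau> \<in> {1..m b} \<Longrightarrow> (a, \<sigma>) \<noteq> (b, \<tau>) \<Longrightarrow> A \<in> V a \<sigma> \<Longrightarrow> C \<in> V b \<tau> \<Longrightarrow>
      hs_inner A C = 0"
  using gtd[THEN conjunct2, THEN conjunct1] by blast

lemma V_span: "B.vs.span (\<Union>a. \<Union>\<sigma>\<in>{1..m a}. V a \<sigma>) = UNIV"
  using gtd[THEN conjunct2, THEN conjunct2, THEN conjunct1] by blast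

lemma V_basis: "\<sigma> \<in> {1..m a} \<Longrightarrow> gt_basis (conj_act \<rho>) (V a \<sigma>) a (e a \<sigma>)"
  using gtd[THEN conjunct2, THEN conjunct2, THEN conjunct2, THEN conjunct1] by blast

lemma e_adj:
  assumes "\<sigma> \<in> {1..m a}" "((\<nu>1, \<nu>2, \<nu>3), J) \<in> gt_labels a"
  shows "adj (e a \<sigma> (\<nu>1, \<nu>2, \<nu>3) J) =
          cscale ((-1) powi (\<nu>1 - \<nu>3)) (e (prod.swap a) \<sigma> (dual_label a (\<nu>1, \<nu>2, \<nu>3)) J)"
  using bspec[OF bspec[OF spec[OF gtd[THEN conjunct2, THEN conjunct2, THEN conjunct2, THEN conjunct2, THEN conjunct1]]
      assms(1)] assms(2)] by (simp only: prod.case)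

lemma e_one: "e (0, 0) 1 (0, 0, 0) 0 = cscale (of_real (1 / sqrt (irrep_dim p))) (mat 1)"
  using gtd[THEN conjunct2, THEN conjunct2, THEN conjunct2, THEN conjunct2, THEN conjunct2] .

lemma E_span: "\<sigma> \<in> {1..m a} \<Longrightarrow> V a \<sigma> = B.vs.span (E a \<sigma> ` gt_labels a)"
proof -
  assume \<sigma>: "\<sigma> \<in> {1..m a}"
  have "{e a \<sigma> \<nu> J |\<nu> J. (\<nu>, J) \<in> gt_labels a} = E a \<sigma> ` gt_labels a"
    by (force simp: E_def)
  then show ?thesis
    using V_basis[OF \<sigma>] by (simp add: gt_basis_def)
qed

lemma E_in: "\<sigma> \<in> {1..m a} \<Longrightarrow> l \<in> gt_labels a \<Longrightarrow> E a \<sigma> l \<in> V a \<sigma>"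
  by (simp add: E_span B.vs.span_base)

lemma E_ortho_V:
  assumes "\<sigma> \<in> {1..m a}" "l \<in> gt_labels a" "l' \<in> gt_labels a"
  shows "hs_inner (E a \<sigma> l) (E a \<sigma> l') = (if l = l' then 1 else 0)"
proof -
  have "\<forall>(\<nu>, J)\<in>gt_labels a. \<forall>(\<nu>', J')\<in>gt_labels a.
        hs_inner (e a \<sigma> \<nu> J) (e a \<sigma> \<nu>' J') = (if (\<nu>, J) = (\<nu>', J') then 1 else 0)"
    using V_basis[OF assms(1)] by (simp add: gt_basis_def)
  then show ?thesis
    using assms(2,3) by (cases l, cases l') (fastforce simp: E_def)
qed

lemma E_ortho:
  assumes "\<sigma> \<in> {1..m a}" "l \<in> gt_labels a" "\<tau> \<in> {1..m b}" "l' \<in> gt_labels b"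
  shows "hs_inner (E a \<sigma> l) (E b \<tau> l') = (if (a, \<sigma>, l) = (b, \<tau>, l') then 1 else 0)"
proof (cases "(a, \<sigma>) = (b, \<tau>)")
  case True
  then show ?thesis
    using E_ortho_V[of \<sigma> a l l'] assms by auto
next
  case False
  have "hs_inner (E a \<sigma> l) (E b \<tau> l') = 0"
    by (rule V_orthogonal[OF assms(1,3) False E_in[OF assms(1,2)] E_in[OF assms(3,4)]])
  with False show ?thesis
    by auto
qed

lemma E_hw: "\<sigma> \<in> {1..m a} \<Longrightarrow> B.hw a (E a \<sigma> (hwl a))"
  using V_basis[of \<sigma> a] by (simp add: gt_basis_def B.hw_eq E_def hwl_def)

lemma E_lower:
  assumes "\<sigma> \<in> {1..m a}" "l \<in> gt_labels a"
  shows "B.Um (E a \<sigma> l) = cscale (of_real (coefU l)) (E a \<sigma> (lowU l))"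
    and "B.Tm (E a \<sigma> l) = cscale (of_real (coefT1 a l)) (E a \<sigma> (lowT1 l)) +
      cscale (of_real (coefT2 a l)) (E a \<sigma> (lowT2 l))"
proof -
  obtain \<nu>1 \<nu>2 \<nu>3 J where l: "l = ((\<nu>1, \<nu>2, \<nu>3), J)"
    by (metis prod.exhaust)
  have "\<forall>((\<nu>1, \<nu>2, \<nu>3), J)\<in>gt_labels a.
        let p = real (fst a); q = real (snd a); u = real_of_int (\<nu>2 - \<nu>3) / 2; n3 = real_of_int \<nu>3 in
        U_minus cscale (conj_act \<rho>) (e a \<sigma> (\<nu>1, \<nu>2, \<nu>3) J) =
          cscale (of_real (sqrt ((J + u) * (J - u + 1)))) (e a \<sigma> (\<nu>1, \<nu>2 - 1, \<nu>3 + 1) J) \<and>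
        T_minus cscale (conj_act \<rho>) (e a \<sigma> (\<nu>1, \<nu>2, \<nu>3) J) =
          cscale (of_real (sqrt ((J - u) * (p + q + J - u - n3 + 1) * (q + J - u - n3) * (u - J + n3 + 1)
                                  / (2 * J * (2 * J + 1)))))
            (e a \<sigma> (\<nu>1 - 1, \<nu>2 + 1, \<nu>3) (J - 1/2)) +
          cscale (of_real (sqrt ((J + u + 1) * (p + q - J - u - n3) * (J + u + 1 + n3 - q) * (J + u + 2 + n3)
                                  / (2 * (J + 1) * (2 * J + 1)))))
            (e a \<sigma> (\<nu>1 - 1, \<nu>2 + 1, \<nu>3) (J + 1/2))"
    using V_basis[OF assms(1)] unfolding gt_basis_def by (elim conjE)
  from bspec[OF this assms(2)]
  show "B.Um (E a \<sigma> l) = cscale (of_real (coefU l)) (E a \<sigma> (lowU l))"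
    "B.Tm (E a \<sigma> l) = cscale (of_real (coefT1 a l)) (E a \<sigma> (lowT1 l)) +
      cscale (of_real (coefT2 a l)) (E a \<sigma> (lowT2 l))"
    unfolding l E_def coefU_def coefT1_def coefT2_def lab_u_def lab_n_def lowU_def lowT1_def lowT2_def Let_def
      B.ladder_eq prod.case fst_conv snd_conv by blast+
qed

section \<open>Coordinates in the Gelfand-Tsetlin basis and ladder matrices\<close>

lemma operator_eqI:
  assumes "\<And>a \<sigma> l. \<sigma> \<in> {1..m a} \<Longrightarrow> l \<in> gt_labels a \<Longrightarrow> hs_inner (E a \<sigma> l) A = hs_inner (E a \<sigma> l) C"
  shows "A = C"
proof -
  have V0: "hs_inner x (A - C) = 0" if "\<sigma> \<in> {1..m a}" "x \<in> V a \<sigma>" for a \<sigma> x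
    using that(2) unfolding E_span[OF that(1)]
  proof (rule B.ip_span_zero[rotated])
    fix y assume "y \<in> E a \<sigma> ` gt_labels a"
    then obtain l where "l \<in> gt_labels a" "y = E a \<sigma> l"
      by blast
    then show "hs_inner y (A - C) = 0"
      using assms[OF that(1)] by (simp add: B.ip_diff)
  qed
  have "A - C \<in> B.vs.span (\<Union>a. \<Union>\<sigma>\<in>{1..m a}. V a \<sigma>)"
    using V_span by simp
  then have "hs_inner (A - C) (A - C) = 0"
    by (rule B.ip_span_zero[rotated]) (use V0 in blast)
  then show ?thesis
    by simp
qed

lemma operator_nonzero:
  assumes "A \<noteq> 0"
  obtains a \<sigma> l where "\<sigma> \<in> {1..m a}" "l \<in> gt_labels a" "hs_inner (E a \<sigma> l) A \<noteq> 0"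
proof (rule ccontr)
  assume *: "\<not> thesis"
  have "A = 0"
  proof (rule operator_eqI)
    fix a \<sigma> l assume "\<sigma> \<in> {1..m a}" "l \<in> gt_labels a"
    then have "hs_inner (E a \<sigma> l) A = 0"
      using that * by blast
    then show "hs_inner (E a \<sigma> l) A = hs_inner (E a \<sigma> l) 0"
      by simp
  qed
  with assms show False
    by simp
qed

lemma V_expansion:
  assumes \<sigma>: "\<sigma> \<in> {1..m a}" and A: "A \<in> V a \<sigma>"
  shows "A = (\<Sum>l\<in>gt_labels a. cscale (hs_inner (E a \<sigma> l) A) (E a \<sigma> l))"
proof (rule operator_eqI)
  fix b \<tau> l assume *: "\<tau> \<in> {1..m b}" "l \<in> gt_labels b"
  show "hs_inner (E b \<tau> l) A = hs_inner (E b \<tau> l) (\<Sum>l\<in>gt_labels a. cscale (hs_inner (E a \<sigma> l) A) (E a \<sigma> l))"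
  proof (cases "(b, \<tau>) = (a, \<sigma>)")
    case True
    have "(\<Sum>l'\<in>gt_labels a. hs_inner (E a \<sigma> l') A * hs_inner (E a \<sigma> l) (E a \<sigma> l')) =
        (\<Sum>l'\<in>gt_labels a. if l' = l then hs_inner (E a \<sigma> l) A else 0)"
      using * True by (intro sum.cong) (auto simp: E_ortho_V[OF \<sigma>])
    then show ?thesis
      using * True by (simp add: B.ip_sum_right B.ip_scale_right finite_gt_labels)
  next
    case False
    have "hs_inner (E b \<tau> l) (E a \<sigma> l') = 0" if "l' \<in> gt_labels a" for l'
      using False E_ortho[OF * \<sigma> that] by auto
    then show ?thesis
      using V_orthogonal[OF *(1) \<sigma> False E_in[OF *] A] by (simp add: B.ip_sum_right B.ip_scale_right)
  qed
qed

lemma V_invariant: "\<sigma> \<in> {1..m a} \<Longrightarrow> invariant_subspace cscale (conj_act \<rho>) (V a \<sigma>)"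
  using V_irrep by (auto simp: is_irrep_def)

text \<open>Matrix elements of the lowering operators. They do not depend on \<sigma>: all copies of
  an irrep carry the same matrices, so linear combinations over copies behave like a single
  copy.\<close>

definition matU :: "gt_label \<Rightarrow> gt_label \<Rightarrow> real" where
  "matU l' l = (if l' = lowU l then coefU l else 0)"

definition matT :: "nat \<times> nat \<Rightarrow> gt_label \<Rightarrow> gt_label \<Rightarrow> real" where
  "matT a l' l = (if l' = lowT1 l then coefT1 a l else 0) + (if l' = lowT2 l then coefT2 a l else 0)"

lemma hs_low:
  assumes "\<sigma> \<in> {1..m a}" "l \<in> gt_labels a" "l' \<in> gt_labels a"
  shows "hs_inner (E a \<sigma> l') (cscale (of_real (coefU l)) (E a \<sigma> (lowU l))) = of_real (if l' = lowU l then coefU l else 0)"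
    "hs_inner (E a \<sigma> l') (cscale (of_real (coefT1 a l)) (E a \<sigma> (lowT1 l))) = of_real (if l' = lowT1 l then coefT1 a l else 0)"
    "hs_inner (E a \<sigma> l') (cscale (of_real (coefT2 a l)) (E a \<sigma> (lowT2 l))) = of_real (if l' = lowT2 l then coefT2 a l else 0)"
proof -
  have "hs_inner (E a \<sigma> l') (cscale (of_real c) (E a \<sigma> k)) = of_real (if l' = k then c else 0)"
    if "c \<noteq> 0 \<Longrightarrow> k \<in> gt_labels a" for c k
    using that E_ortho_V[OF assms(1,3), of k] by (cases "c = 0") (simp_all add: B.ip_scale_right)
  from this[OF low_in_labels(1)[OF assms(2)]] this[OF low_in_labels(2)[OF assms(2)]]
    this[OF low_in_labels(3)[OF assms(2)]]
  show "hs_inner (E a \<sigma> l') (cscale (of_real (coefU l)) (E a \<sigma> (lowU l))) = of_real (if l' = lowU l then coefU l else 0)"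
    "hs_inner (E a \<sigma> l') (cscale (of_real (coefT1 a l)) (E a \<sigma> (lowT1 l))) = of_real (if l' = lowT1 l then coefT1 a l else 0)"
    "hs_inner (E a \<sigma> l') (cscale (of_real (coefT2 a l)) (E a \<sigma> (lowT2 l))) = of_real (if l' = lowT2 l then coefT2 a l else 0)"
    by blast+
qed

lemma hs_lower:
  assumes "\<sigma> \<in> {1..m a}" "l \<in> gt_labels a" "l' \<in> gt_labels a"
  shows "hs_inner (E a \<sigma> l') (B.Um (E a \<sigma> l)) = of_real (matU l' l)"
    "hs_inner (E a \<sigma> l') (B.Tm (E a \<sigma> l)) = of_real (matT a l' l)"
  unfolding E_lower[OF assms(1,2)] B.ip_add_right hs_low[OF assms] matU_def matT_def by simp_all

text \<open>Only the lowering formulas are prescribed; the raising operators are their adjoints and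
  act by the transposed real matrices.\<close>

lemma E_raise:
  assumes "\<sigma> \<in> {1..m a}" "l \<in> gt_labels a"
  shows "B.Up (E a \<sigma> l) = (\<Sum>l'\<in>gt_labels a. cscale (of_real (matU l l')) (E a \<sigma> l'))"
    "B.Tp (E a \<sigma> l) = (\<Sum>l'\<in>gt_labels a. cscale (of_real (matT a l l')) (E a \<sigma> l'))"
proof -
  have "B.Up (E a \<sigma> l) \<in> V a \<sigma>" "B.Tp (E a \<sigma> l) \<in> V a \<sigma>"
    using B.invariant_imp_sl[OF V_invariant[OF assms(1)] _ E_in[OF assms]] good_Eij by blast+
  note exp = this[THEN V_expansion[OF assms(1)]]
  have "hs_inner (E a \<sigma> l') (B.Up (E a \<sigma> l)) = of_real (matU l l')"
    "hs_inner (E a \<sigma> l') (B.Tp (E a \<sigma> l)) = of_real (matT a l l')" if "l' \<in> gt_labels a" for l'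
    using B.ip_cnj[of "B.Um (E a \<sigma> l')" "E a \<sigma> l"] B.ip_cnj[of "B.Tm (E a \<sigma> l')" "E a \<sigma> l"]
    by (simp_all only: hs_lower[OF assms(1) that assms(2)] B.ladder_adj(2,4) complex_cnj_complex_of_real)
  then show "B.Up (E a \<sigma> l) = (\<Sum>l'\<in>gt_labels a. cscale (of_real (matU l l')) (E a \<sigma> l'))"
    "B.Tp (E a \<sigma> l) = (\<Sum>l'\<in>gt_labels a. cscale (of_real (matT a l l')) (E a \<sigma> l'))"
    by (subst exp, intro sum.cong refl, simp only:)+
qed

subsection \<open>Weights and highest weight vectors\<close>

lemma V_words: "\<sigma> \<in> {1..m a} \<Longrightarrow> V a \<sigma> = B.vs.span (B.lws (E a \<sigma> (hwl a)))"
  by (rule B.irrep_words[OF V_irrep E_hw E_in]) (auto simp: hwl_in)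

text \<open>The lowering formulas connect only labels whose values of (t, u) differ by the weight of
  the operator, so by induction a word is supported on labels of its own weight.\<close>

lemma word_labels:
  assumes \<sigma>: "\<sigma> \<in> {1..m a}" and w: "B.lw (E a \<sigma> (hwl a)) i j w"
    and l: "l \<in> gt_labels a" "hs_inner (E a \<sigma> l) w \<noteq> 0"
  shows "lab_t l = real (fst a) / 2 - i + j / 2 \<and> lab_u l = real (snd a) / 2 + i / 2 - j"
  using w l
proof (induction arbitrary: l rule: B.lw.induct)
  case lw_base
  then show ?case
    using E_ortho_V[OF \<sigma> lw_base(1) hwl_in] by (auto simp: lab_hwl split: if_splits)
next
  case (lw_T i j w)
  have "hs_inner (E a \<sigma> l) (B.Tm w) = (\<Sum>l'\<in>gt_labels a. of_real (matT a l l') * hs_inner (E a \<sigma> l') w)"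
    by (simp add: E_raise[OF \<sigma> lw_T(3)] B.ip_sum_left B.ip_scale_left flip: B.ladder_adj(1))
  then obtain l' where l': "l' \<in> gt_labels a" "matT a l l' \<noteq> 0" "hs_inner (E a \<sigma> l') w \<noteq> 0"
    using lw_T(4) by (metis (no_types, lifting) mult_eq_0_iff of_real_eq_0_iff sum.neutral)
  have "l = lowT1 l' \<or> l = lowT2 l'"
    using l'(2) by (auto simp: matT_def split: if_splits)
  then show ?case
    using lw_T(2)[OF l'(1,3)] by (auto simp: lab_low field_simps)
next
  case (lw_U i j w)
  have "hs_inner (E a \<sigma> l) (B.Um w) = (\<Sum>l'\<in>gt_labels a. of_real (matU l l') * hs_inner (E a \<sigma> l') w)"
    by (simp add: E_raise[OF \<sigma> lw_U(3)] B.ip_sum_left B.ip_scale_left flip: B.ladder_adj(3))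
  then obtain l' where l': "l' \<in> gt_labels a" "matU l l' \<noteq> 0" "hs_inner (E a \<sigma> l') w \<noteq> 0"
    using lw_U(4) by (metis (no_types, lifting) mult_eq_0_iff of_real_eq_0_iff sum.neutral)
  have "l = lowU l'"
    using l'(2) by (auto simp: matU_def split: if_splits)
  then show ?case
    using lw_U(2)[OF l'(1,3)] by (auto simp: lab_low field_simps)
qed

text \<open>\<open>gt_basis\<close> prescribes a weight at the highest label only. The defect y (or
  z) is orthogonal to every word, because a word overlapping \<open>E a \<sigma> l\<close> has the
  weight of l; and the words span the space that contains the defect.\<close>

lemma E_weights:
  assumes \<sigma>: "\<sigma> \<in> {1..m a}" and l: "l \<in> gt_labels a"
  shows "B.T3 (E a \<sigma> l) = cscale (of_real (lab_t l)) (E a \<sigma> l)"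
    and "B.U3 (E a \<sigma> l) = cscale (of_real (lab_u l)) (E a \<sigma> l)"
proof -
  define y where "y = B.T3 (E a \<sigma> l) - cscale (of_real (lab_t l)) (E a \<sigma> l)"
  define z where "z = B.U3 (E a \<sigma> l) - cscale (of_real (lab_u l)) (E a \<sigma> l)"
  have "hs_inner w y = 0 \<and> hs_inner w z = 0" if w0: "w \<in> B.lws (E a \<sigma> (hwl a))" for w
  proof -
    obtain i j where w: "B.lw (E a \<sigma> (hwl a)) i j w"
      using w0 by auto
    have "hs_inner (E a \<sigma> l) w = 0 \<longleftrightarrow> hs_inner w (E a \<sigma> l) = 0"
      using B.ip_cnj[of w "E a \<sigma> l"] by simp
    then show ?thesis
      using word_labels[OF \<sigma> w l] B.lw_weights[OF E_hw[OF \<sigma>] w]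
      by (cases "hs_inner w (E a \<sigma> l) = 0")
         (auto simp: y_def z_def B.ip_diff B.ip_scale_right B.ip_scale_left simp flip: B.ladder_adj(5,6))
  qed
  moreover have "y \<in> V a \<sigma>" "z \<in> V a \<sigma>"
    unfolding y_def z_def
    using V_invariant[OF \<sigma>] E_in[OF \<sigma> l] B.invariant_imp_sl[OF V_invariant[OF \<sigma>] _ E_in[OF \<sigma> l]]
    by (auto intro!: B.vs.subspace_diff B.vs.subspace_scale simp: good_Eij invariant_subspace_def)
  ultimately have "hs_inner y y = 0" "hs_inner z z = 0"
    unfolding V_words[OF \<sigma>] using B.ip_span_zero by blast+
  then show "B.T3 (E a \<sigma> l) = cscale (of_real (lab_t l)) (E a \<sigma> l)"
    "B.U3 (E a \<sigma> l) = cscale (of_real (lab_u l)) (E a \<sigma> l)"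
    by (simp_all add: y_def z_def)
qed

lemma hs_T3_U3:
  assumes "\<sigma> \<in> {1..m a}" "l \<in> gt_labels a"
  shows "hs_inner (E a \<sigma> l) (B.T3 A) = of_real (lab_t l) * hs_inner (E a \<sigma> l) A"
    "hs_inner (E a \<sigma> l) (B.U3 A) = of_real (lab_u l) * hs_inner (E a \<sigma> l) A"
  using E_weights[OF assms] by (simp_all add: B.ip_scale_left flip: B.ladder_adj(5,6))

text \<open>Every other word is orthogonal both to A and to the highest weight vector v, so on the
  whole copy pairing with A factors through v. Note that A may have components in many
  copies.\<close>

lemma hw_component:
  assumes \<sigma>: "\<sigma> \<in> {1..m a}" and l: "l \<in> gt_labels a" "l \<noteq> hwl a" and A: "B.Tp A = 0" "B.Up A = 0"
  shows "hs_inner (E a \<sigma> l) A = 0"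
proof -
  let ?v = "E a \<sigma> (hwl a)"
  have v: "B.Tp ?v = 0" "B.Up ?v = 0" "hs_inner ?v ?v = 1"
    using E_hw[OF \<sigma>] by (simp_all add: B.hw_def E_ortho_V[OF \<sigma>] hwl_in)
  have "hs_inner x A = hs_inner x ?v * hs_inner ?v A" if "x \<in> V a \<sigma>" for x
    using that unfolding V_words[OF \<sigma>]
  proof (induction rule: B.vs.span_induct_alt)
    case (step c w y)
    then obtain i j where w: "B.lw ?v i j w"
      by blast
    have "hs_inner w A = hs_inner w ?v * hs_inner ?v A"
      using B.lw_orthogonal[OF w A] B.lw_orthogonal[OF w v(1,2)] v(3) by (cases "w = ?v") auto
    with step show ?case
      by (simp add: B.ip_add_left B.ip_scale_left algebra_simps)
  qed simp
  from this[OF E_in[OF \<sigma> l(1)]] show ?thesis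
    using E_ortho_V[OF \<sigma> l(1) hwl_in] l(2) by simp
qed

text \<open>The weight constraints on operators are applied to a highest weight vector. For (k, k)
  the second bound reads k <= |p|, which is why the real factors of the product stop at |p|.\<close>

lemma multiplicity_bounds:
  assumes "0 < m a"
  shows "3 dvd int (fst a) - int (snd a)" "fst a + snd a \<le> 2 * (fst p + snd p)"
proof -
  have \<sigma>: "1 \<in> {1..m a}"
    using assms by simp
  have hw: "E a 1 (hwl a) \<noteq> 0" "B.T3 (E a 1 (hwl a)) = cscale (of_real (real (fst a) / 2)) (E a 1 (hwl a))"
    "B.U3 (E a 1 (hwl a)) = cscale (of_real (real (snd a) / 2)) (E a 1 (hwl a))"
    using E_hw[OF \<sigma>] by (simp_all add: B.hw_def)
  obtain k :: int where "2 * (real (fst a) / 2) - 2 * (real (snd a) / 2) = 3 * of_int k"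
    using operator_weights(2)[OF hw] by blast
  then have "real_of_int (int (fst a) - int (snd a)) = real_of_int (3 * k)"
    by simp
  then have "int (fst a) - int (snd a) = 3 * k"
    using of_int_eq_iff by blast
  then show "3 dvd int (fst a) - int (snd a)"
    by simp
  have "real (fst a + snd a) \<le> real (2 * (fst p + snd p))"
    using operator_weights(1)[OF hw] by simp
  then show "fst a + snd a \<le> 2 * (fst p + snd p)"
    using of_nat_le_iff by blast
qed

lemma finite_multiplicity: "finite {a. 0 < m a}"
proof (rule finite_subset)
  let ?N = "2 * (fst p + snd p)"
  show "{a. 0 < m a} \<subseteq> {..?N} \<times> {..?N}"
  proof
    fix a assume "a \<in> {a. 0 < m a}"
    then have "fst a + snd a \<le> ?N"
      using multiplicity_bounds(2) by blast
    then show "a \<in> {..?N} \<times> {..?N}"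
      by (cases a) simp
  qed
qed simp

subsection \<open>Multiplicities of dual and trivial representations\<close>

lemma dact_adj:
  assumes "tangent c X" shows "B.dact X (adj A) = adj (B.dact X A)"
proof (rule B.dact_eqI[OF assms])
  have "conj_act \<rho> (c t) (adj A) = adj (conj_act \<rho> (c t) A)" for t
    using assms by (simp add: tangent_def conj_act_eq adj_mult matrix_mul_assoc)
  then show "((\<lambda>t. conj_act \<rho> (c t) (adj A)) has_vector_derivative adj (B.dact X A)) (at 0)"
    using bounded_linear.has_vector_derivative[OF bounded_linear_adj B.dact_spec(2)[OF assms, of A]] by simp
qed

lemma sl_adj: "good Z \<Longrightarrow> B.sl Z (adj A) = - adj (B.sl (adj Z) A)"
  by (erule B.good_tangents)
     (simp add: B.sl_def dact_adj parts_adj B.dact_minus_left adj_add adj_uminus adj_cscale,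
      simp add: veq)

lemma ladder_of_adj:
  "B.Tp (adj A) = - adj (B.Tm A)" "B.Up (adj A) = - adj (B.Um A)"
  "B.T3 (adj A) = - adj (B.T3 A)" "B.U3 (adj A) = - adj (B.U3 A)"
proof -
  have "adj (Eij 1 2) = Eij 2 1" "adj (Eij 2 3) = Eij 3 2"
    "adj (cscale (1/2) (Eij 1 1 - Eij 2 2)) = cscale (1/2) (Eij 1 1 - Eij 2 2)"
    "adj (cscale (1/2) (Eij 2 2 - Eij 3 3)) = cscale (1/2) (Eij 2 2 - Eij 3 3)"
    by (simp_all add: mat3_simps)
  then show "B.Tp (adj A) = - adj (B.Tm A)" "B.Up (adj A) = - adj (B.Um A)"
    "B.T3 (adj A) = - adj (B.T3 A)" "B.U3 (adj A) = - adj (B.U3 A)"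
    by (simp_all add: sl_adj good_Eij)
qed

text \<open>At weight zero the first and third entries of the label agree, so the sign in the
  adjoint rule is 1.\<close>

lemma E_adj_zlab:
  assumes "\<sigma> \<in> {1..m a}" "\<gamma> \<in> {1..zero_mult a}"
  shows "adj (E a \<sigma> (zlab a \<gamma>)) = E (prod.swap a) \<sigma> (zlab (prod.swap a) \<gamma>)"
proof -
  have d: "3 dvd int (fst a) - int (snd a)"
    using multiplicity_bounds(1)[of a] assms(1) by simp
  obtain c where c: "zero_label a = (c, c, c)"
    by (simp add: zero_label_def Let_def)
  have "((c, c, c), zero_J a \<gamma>) \<in> gt_labels a"
    using zlab_in[OF d assms(2)] by (simp add: zlab_def c)
  from e_adj[OF assms(1) this] show ?thesis
    by (simp add: E_def zlab_def dual_zlab[OF d] c[symmetric])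
qed

lemma E_adj_lwl:
  assumes "\<sigma> \<in> {1..m a}"
  obtains c where "c \<noteq> 0" "E (prod.swap a) \<sigma> (hwl (prod.swap a)) = cscale c (adj (E a \<sigma> (lwl a)))"
proof -
  let ?c = "(-1) powi (0 - (int (fst a) + int (snd a))) :: complex"
  have "((0, int (snd a), int (fst a) + int (snd a)), real (fst a) / 2) \<in> gt_labels a"
    using lwl_in by (simp add: lwl_def)
  from e_adj[OF assms this]
  have *: "adj (E a \<sigma> (lwl a)) = cscale ?c (E (prod.swap a) \<sigma> (hwl (prod.swap a)))"
    unfolding E_def dual_hwl[symmetric] by (simp add: lwl_def)
  have "?c \<noteq> 0"
    by simp
  then have "E (prod.swap a) \<sigma> (hwl (prod.swap a)) = cscale (1 / ?c) (adj (E a \<sigma> (lwl a)))"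
    unfolding * cscale_cscale by (simp add: veq)
  with \<open>?c \<noteq> 0\<close> show ?thesis
    by (intro that[of "1 / ?c"]) auto
qed

text \<open>Otherwise take the adjoint X of the lowest weight vector of the last copy of a. It has
  the highest weight of the dual irrep, but is orthogonal to the highest weight vectors of all
  copies of the dual, these being adjoints of lowest weight vectors of earlier copies. So X would be
  zero.\<close>

lemma multiplicity_swap_le: "m a \<le> m (prod.swap a)"
proof (rule ccontr)
  assume "\<not> ?thesis"
  then have \<sigma>: "m a \<in> {1..m a}" and less: "m (prod.swap a) < m a"
    by auto
  define X where "X = adj (E a (m a) (lwl a))"
  have low: "B.Tm (E a (m a) (lwl a)) = 0" "B.Um (E a (m a) (lwl a)) = 0"
    using E_lower[OF \<sigma> lwl_in] by (simp_all add: lwl_coef)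
  have hw: "B.Tp X = 0" "B.Up X = 0"
    using low by (simp_all add: X_def ladder_of_adj) (simp_all add: veq)
  have w: "B.T3 X = cscale (of_real (real (snd a) / 2)) X" "B.U3 X = cscale (of_real (real (fst a) / 2)) X"
    by (simp_all add: X_def ladder_of_adj E_weights[OF \<sigma> lwl_in] lab_lwl) (simp_all add: veq)
  have "X = 0"
  proof (rule operator_eqI)
    fix b \<tau> l assume *: "\<tau> \<in> {1..m b}" "l \<in> gt_labels b"
    have "hs_inner (E b \<tau> l) X = 0"
    proof (rule ccontr)
      assume nz: "hs_inner (E b \<tau> l) X \<noteq> 0"
      then have l: "l = hwl b"
        using hw_component[OF * _ hw] by blast
      have "lab_t l = real (snd a) / 2" "lab_u l = real (fst a) / 2"
        using B.T3_ortho[OF E_weights(1)[OF *] w(1) nz] B.U3_ortho[OF E_weights(2)[OF *] w(2) nz] by simp_all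
      then have b: "b = prod.swap a"
        by (cases a, cases b) (simp add: l lab_hwl)
      have \<tau>: "\<tau> \<in> {1..m a}" "\<tau> \<noteq> m a"
        using *(1) less by (auto simp: b)
      obtain c where "E b \<tau> l = cscale c (adj (E a \<tau> (lwl a)))"
        using E_adj_lwl[OF \<tau>(1)] by (metis b l)
      then have "hs_inner (E b \<tau> l) X = cnj c * hs_inner (E a (m a) (lwl a)) (E a \<tau> (lwl a))"
        by (simp add: X_def B.ip_scale_left hs_inner_adj)
      also have "\<dots> = 0"
        using E_ortho[OF \<sigma> lwl_in \<tau>(1) lwl_in] \<tau>(2) by simp
      finally show False
        using nz by simp
    qed
    then show "hs_inner (E b \<tau> l) X = hs_inner (E b \<tau> l) 0"
      by simp
  qed
  then have "adj X = 0"
    by (simp add: veq)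
  then have "E a (m a) (lwl a) = 0"
    by (simp add: X_def)
  then show False
    using E_ortho_V[OF \<sigma> lwl_in lwl_in] by simp
qed

lemma multiplicity_swap: "m (prod.swap a) = m a"
  using multiplicity_swap_le[of a] multiplicity_swap_le[of "prod.swap a"] by simp

lemma killed_imp_scalar:
  assumes "B.Tp A = 0" "B.Tm A = 0" "B.Up A = 0" "B.Um A = 0"
  obtains c where "A = cscale c (mat 1)"
proof -
  have "conj_act \<rho> g A = A" if "g \<in> SU3" for g
    using that
    by (induction rule: SU3_induct)
       (simp_all add: B.act_mult B.flow_fixed rotgen_gen B.dact_ladder assms)
  then show ?thesis
    using invariant_operator_scalar that by blast
qed

lemma sl_one: "good Z \<Longrightarrow> B.sl Z (mat 1) = 0"
proof -
  assume Z: "good Z"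
  have "B.sl Z (mat 1) *v x = 0 *v x" for x
    by (simp add: sl_commutator[OF Z] matvec.zero_left)
  then show ?thesis
    by (rule matrix_eq_vec)
qed

lemma hs_one: "hs_inner (mat 1) (mat 1 :: complex^'n^'n) = of_nat CARD('n)"
  by (simp add: hs_inner_def trace_def mat_nth)

lemma one_nz: "(mat 1 :: complex^'n^'n) \<noteq> 0"
  using hs_one B.ip_self_eq_0[of "mat 1"] by auto

lemma label_00: "l \<in> gt_labels (0, 0) \<longleftrightarrow> l = ((0, 0, 0), 0)"
  by (auto simp: gt_labels_iff lbl_ok_def lbl_def)

text \<open>The identity is annihilated by the raising operators and has weight zero, so it has a
  component in a copy of (0, 0). Every such copy consists of scalars, and two of them could not be
  orthogonal.\<close>

lemma trivial_multiplicity: "m (0, 0) = 1"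
proof -
  obtain a \<sigma> l where *: "\<sigma> \<in> {1..m a}" "l \<in> gt_labels a" "hs_inner (E a \<sigma> l) (mat 1) \<noteq> 0"
    using operator_nonzero[OF one_nz] .
  have l: "l = hwl a"
    using hw_component[OF *(1,2) _ sl_one sl_one] *(3) good_Eij by blast
  have "lab_t l = 0" "lab_u l = 0"
    using hs_T3_U3[OF *(1,2), of "mat 1"] *(3) by (auto simp: sl_one good_Eij)
  then have "a = (0, 0)"
    by (cases a) (simp add: l lab_hwl)
  then have m1: "m (0, 0) \<ge> 1"
    using *(1) by auto
  have False if "m (0, 0) \<ge> 2"
  proof -
    let ?z = "((0, 0, 0), 0) :: gt_label"
    \<comment> \<open>The only label of (0, 0) is highest and lowest at once, so all four ladder
      operators annihilate its vector.\<close>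
    have z: "?z = hwl (0, 0)" "?z = lwl (0, 0)" "?z \<in> gt_labels (0, 0)"
      by (simp_all add: hwl_def lwl_def label_00)
    have "\<exists>c. E (0, 0) \<sigma> ?z = cscale c (mat 1)" if \<sigma>: "\<sigma> \<in> {1..m (0, 0)}" for \<sigma>
    proof -
      have "B.Tp (E (0, 0) \<sigma> ?z) = 0" "B.Up (E (0, 0) \<sigma> ?z) = 0"
        using E_hw[OF \<sigma>] by (simp_all add: z(1) B.hw_def)
      moreover have "B.Tm (E (0, 0) \<sigma> ?z) = 0" "B.Um (E (0, 0) \<sigma> ?z) = 0"
        unfolding E_lower[OF \<sigma> z(3)] unfolding z(2) lwl_coef by simp_all
      ultimately show ?thesis
        using killed_imp_scalar by metis
    qed
    then obtain c d where cd: "E (0, 0) 1 ?z = cscale c (mat 1)" "E (0, 0) 2 ?z = cscale d (mat 1)"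
      using \<open>m (0, 0) \<ge> 2\<close> by fastforce
    have "cnj c * (d * of_nat CARD('n)) = 0" "cnj c * (c * of_nat CARD('n)) = 1" "cnj d * (d * of_nat CARD('n)) = 1"
      using E_ortho[of 1 "(0, 0)" ?z 2 "(0, 0)" ?z] E_ortho[of 1 "(0, 0)" ?z 1 "(0, 0)" ?z]
        E_ortho[of 2 "(0, 0)" ?z 2 "(0, 0)" ?z] \<open>m (0, 0) \<ge> 2\<close> z(3)
      by (simp_all add: cd cd(1)[unfolded One_nat_def] B.ip_scale_left B.ip_scale_right hs_one mult_ac)
    then show False
      by auto
  qed
  then have "\<not> 2 \<le> m (0, 0)"
    by blast
  with m1 show ?thesis
    by linarith
qed

lemma irrep_dim_pos: "0 < irrep_dim a"
  by (simp add: irrep_dim_def)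

lemma E_trivial: "E (0, 0) 1 ((0, 0, 0), 0) = cscale (of_real (1 / sqrt (irrep_dim p))) (mat 1)"
  using e_one by (simp add: E_def)

text \<open>Read off from the unit norm of the identity divided by the square root of the dimension,
  the normalization fixed in \<open>gt_decomposition\<close>.\<close>

lemma irrep_dim_eq: "irrep_dim p = of_nat CARD('n)"
proof -
  have "hs_inner (E (0, 0) 1 ((0, 0, 0), 0)) (E (0, 0) 1 ((0, 0, 0), 0)) = 1"
    using E_ortho_V[of 1 "(0, 0)"] by (simp add: trivial_multiplicity label_00)
  then have "of_real (1 / sqrt (irrep_dim p)) * (of_real (1 / sqrt (irrep_dim p)) * of_nat CARD('n)) = (1::complex)"
    unfolding E_trivial by (simp only: B.ip_scale_left B.ip_scale_right hs_one complex_cnj_complex_of_real)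
  then have "complex_of_real (1 / sqrt (irrep_dim p) * (1 / sqrt (irrep_dim p) * of_nat CARD('n))) = of_real 1"
    by (simp only: of_real_mult of_real_of_nat_eq of_real_1)
  then have "1 / sqrt (irrep_dim p) * (1 / sqrt (irrep_dim p) * of_nat CARD('n)) = (1::real)"
    using of_real_eq_iff by blast
  then show ?thesis
    using irrep_dim_pos[of p] by (simp add: field_simps)
qed

end

context su3_gt
begin

subsection \<open>Invariant subspaces of the operator space\<close>

text \<open>For fixed nonzero coefficients these vectors span a further copy of the irrep, placed
  obliquely in the sum of the chosen copies.\<close>

definition combo :: "(nat \<Rightarrow> complex) \<Rightarrow> nat \<times> nat \<Rightarrow> gt_label \<Rightarrow> complex^'n^'n" where
  "combo \<xi> a l = (\<Sum>\<sigma>\<in>{1..m a}. cscale (\<xi> \<sigma>) (E a \<sigma> l))"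

lemma hs_combo:
  assumes "\<tau> \<in> {1..m b}" "l' \<in> gt_labels b" "l \<in> gt_labels a"
  shows "hs_inner (E b \<tau> l') (combo \<xi> a l) = (if b = a \<and> l' = l then \<xi> \<tau> else 0)"
proof -
  have "hs_inner (E b \<tau> l') (combo \<xi> a l) = (\<Sum>\<sigma>\<in>{1..m a}. \<xi> \<sigma> * hs_inner (E b \<tau> l') (E a \<sigma> l))"
    by (simp add: combo_def B.ip_sum_right B.ip_scale_right)
  also have "\<dots> = (\<Sum>\<sigma>\<in>{1..m a}. if \<sigma> = \<tau> then (if b = a \<and> l' = l then \<xi> \<tau> else 0) else 0)"
    using assms by (intro sum.cong refl) (simp add: E_ortho)
  also have "\<dots> = (if b = a \<and> l' = l then \<xi> \<tau> else 0)"
    using assms(1) by (auto simp: sum.delta)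
  finally show ?thesis .
qed

lemma combo_lower:
  assumes "l \<in> gt_labels a"
  shows "B.Um (combo \<xi> a l) = cscale (of_real (coefU l)) (combo \<xi> a (lowU l))"
    and "B.Tm (combo \<xi> a l) = cscale (of_real (coefT1 a l)) (combo \<xi> a (lowT1 l)) +
      cscale (of_real (coefT2 a l)) (combo \<xi> a (lowT2 l))"
  by (simp_all add: combo_def B.sl_sum B.sl_scale good_Eij E_lower assms B.vs.scale_sum_right
      B.vs.scale_right_distrib sum.distrib mult.commute)

lemma combo_raise:
  assumes "l \<in> gt_labels a"
  shows "B.Up (combo \<xi> a l) = (\<Sum>l'\<in>gt_labels a. cscale (of_real (matU l l')) (combo \<xi> a l'))"
    "B.Tp (combo \<xi> a l) = (\<Sum>l'\<in>gt_labels a. cscale (of_real (matT a l l')) (combo \<xi> a l'))"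
proof -
  have *: "(\<Sum>\<sigma>\<in>{1..m a}. cscale (\<xi> \<sigma>) (\<Sum>l'\<in>gt_labels a. cscale (c l') (E a \<sigma> l'))) =
      (\<Sum>l'\<in>gt_labels a. cscale (c l') (\<Sum>\<sigma>\<in>{1..m a}. cscale (\<xi> \<sigma>) (E a \<sigma> l')))" for c
    unfolding B.vs.scale_sum_right by (subst sum.swap) (simp add: mult.commute)
  have "B.Up (combo \<xi> a l) = (\<Sum>\<sigma>\<in>{1..m a}. cscale (\<xi> \<sigma>) (B.Up (E a \<sigma> l)))"
    "B.Tp (combo \<xi> a l) = (\<Sum>\<sigma>\<in>{1..m a}. cscale (\<xi> \<sigma>) (B.Tp (E a \<sigma> l)))"
    by (simp_all add: combo_def B.sl_sum B.sl_scale good_Eij)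
  moreover have "(\<Sum>\<sigma>\<in>{1..m a}. cscale (\<xi> \<sigma>) (B.Tp (E a \<sigma> l))) =
      (\<Sum>\<sigma>\<in>{1..m a}. cscale (\<xi> \<sigma>) (\<Sum>l'\<in>gt_labels a. cscale (of_real (matT a l l')) (E a \<sigma> l')))"
    by (intro sum.cong refl) (simp only: E_raise[OF _ assms])
  moreover have "(\<Sum>\<sigma>\<in>{1..m a}. cscale (\<xi> \<sigma>) (B.Up (E a \<sigma> l))) =
      (\<Sum>\<sigma>\<in>{1..m a}. cscale (\<xi> \<sigma>) (\<Sum>l'\<in>gt_labels a. cscale (of_real (matU l l')) (E a \<sigma> l')))"
    by (intro sum.cong refl) (simp only: E_raise[OF _ assms])
  ultimately show "B.Up (combo \<xi> a l) = (\<Sum>l'\<in>gt_labels a. cscale (of_real (matU l l')) (combo \<xi> a l'))"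
    "B.Tp (combo \<xi> a l) = (\<Sum>l'\<in>gt_labels a. cscale (of_real (matT a l l')) (combo \<xi> a l'))"
    unfolding * by (simp_all only: combo_def)
qed

lemma combo_span_invariant:
  "invariant_subspace cscale (conj_act \<rho>) (B.vs.span (combo \<xi> a ` gt_labels a))"
proof (rule B.stable_imp_invariant)
  let ?S = "B.vs.span (combo \<xi> a ` gt_labels a)"
  have c: "cscale (of_real c) (combo \<xi> a k) \<in> ?S" if "c \<noteq> 0 \<Longrightarrow> k \<in> gt_labels a" for c k
    using that by (cases "c = 0") (auto intro: B.vs.span_scale B.vs.span_base B.vs.span_zero)
  show "B.Tm x \<in> ?S" if x: "x \<in> ?S" for x
  proof (rule B.span_map_closed[OF good_Eij(2) _ x])
    fix y assume "y \<in> combo \<xi> a ` gt_labels a"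
    then obtain l where l: "l \<in> gt_labels a" "y = combo \<xi> a l" by blast
    show "B.Tm y \<in> ?S"
      unfolding l(2) combo_lower[OF l(1)] using low_in_labels[OF l(1)] by (intro B.vs.span_add c)
  qed
  show "B.Um x \<in> ?S" if x: "x \<in> ?S" for x
  proof (rule B.span_map_closed[OF good_Eij(4) _ x])
    fix y assume "y \<in> combo \<xi> a ` gt_labels a"
    then obtain l where l: "l \<in> gt_labels a" "y = combo \<xi> a l" by blast
    show "B.Um y \<in> ?S"
      unfolding l(2) combo_lower[OF l(1)] using low_in_labels[OF l(1)] by (intro c)
  qed
  show "B.Tp x \<in> ?S" if x: "x \<in> ?S" for x
  proof (rule B.span_map_closed[OF good_Eij(1) _ x])
    fix y assume "y \<in> combo \<xi> a ` gt_labels a"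
    then obtain l where l: "l \<in> gt_labels a" "y = combo \<xi> a l" by blast
    show "B.Tp y \<in> ?S"
      unfolding l(2) combo_raise[OF l(1)] by (intro B.vs.span_sum c)
  qed
  show "B.Up x \<in> ?S" if x: "x \<in> ?S" for x
  proof (rule B.span_map_closed[OF good_Eij(3) _ x])
    fix y assume "y \<in> combo \<xi> a ` gt_labels a"
    then obtain l where l: "l \<in> gt_labels a" "y = combo \<xi> a l" by blast
    show "B.Up y \<in> ?S"
      unfolding l(2) combo_raise[OF l(1)] by (intro B.vs.span_sum c)
  qed
qed simp

text \<open>The map \<open>\<Phi>\<close> sends the first copy to the oblique one and commutes with
  the lowering operators. Since words in these span the first copy, its image is generated from the
  highest weight combination and stays in R.\<close>

lemma combo_mem:
  assumes R: "invariant_subspace cscale (conj_act \<rho>) R" and hw: "combo \<xi> a (hwl a) \<in> R"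
    and a: "0 < m a" and l: "l \<in> gt_labels a"
  shows "combo \<xi> a l \<in> R"
proof -
  have 1: "1 \<in> {1..m a}"
    using a by simp
  have sR: "B.vs.subspace R"
    using R by (simp add: invariant_subspace_def)
  define \<Phi> where "\<Phi> x = (\<Sum>l\<in>gt_labels a. cscale (hs_inner (E a 1 l) x) (combo \<xi> a l))" for x
  have \<Phi>_add: "\<Phi> (x + y) = \<Phi> x + \<Phi> y" for x y
    by (simp add: \<Phi>_def B.ip_add_right B.vs.scale_left_distrib sum.distrib)
  have \<Phi>_scale: "\<Phi> (cscale c x) = cscale c (\<Phi> x)" for c x
    by (simp add: \<Phi>_def B.ip_scale_right B.vs.scale_sum_right)
  have \<Phi>_zero: "\<Phi> 0 = 0"
    by (simp add: \<Phi>_def)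
  have \<Phi>_E: "\<Phi> (E a 1 k) = combo \<xi> a k" if k: "k \<in> gt_labels a" for k
  proof -
    have "\<Phi> (E a 1 k) = (\<Sum>l\<in>gt_labels a. if l = k then combo \<xi> a k else 0)"
      unfolding \<Phi>_def using E_ortho_V[OF 1 _ k] by (intro sum.cong) auto
    then show ?thesis
      using k finite_gt_labels by simp
  qed
  have \<Phi>_low: "\<Phi> (cscale (of_real c) (E a 1 k)) = cscale (of_real c) (combo \<xi> a k)"
    if "c \<noteq> 0 \<Longrightarrow> k \<in> gt_labels a" for c k
    using that \<Phi>_E by (cases "c = 0") (simp_all add: \<Phi>_scale \<Phi>_zero)
  have \<Phi>_ladder: "\<Phi> (B.Tm x) = B.Tm (\<Phi> x) \<and> \<Phi> (B.Um x) = B.Um (\<Phi> x)" if "x \<in> V a 1" for x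
    using that unfolding E_span[OF 1]
  proof (induction rule: B.vs.span_induct_alt)
    case base
    show ?case by (simp add: \<Phi>_zero B.sl_zero good_Eij)
  next
    case (step c y z)
    then obtain k where k: "k \<in> gt_labels a" "y = E a 1 k" by blast
    have low: "\<Phi> (cscale (of_real (coefU k)) (E a 1 (lowU k))) = cscale (of_real (coefU k)) (combo \<xi> a (lowU k))"
      "\<Phi> (cscale (of_real (coefT1 a k)) (E a 1 (lowT1 k))) = cscale (of_real (coefT1 a k)) (combo \<xi> a (lowT1 k))"
      "\<Phi> (cscale (of_real (coefT2 a k)) (E a 1 (lowT2 k))) = cscale (of_real (coefT2 a k)) (combo \<xi> a (lowT2 k))"
      by (rule \<Phi>_low, erule low_in_labels[OF k(1)])+
    have "\<Phi> (B.Tm y) = B.Tm (\<Phi> y)" "\<Phi> (B.Um y) = B.Um (\<Phi> y)"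
      unfolding k(2) \<Phi>_E[OF k(1)] combo_lower[OF k(1)] E_lower[OF 1 k(1)] \<Phi>_add low by (rule refl)+
    with step show ?case
      by (simp add: B.sl_add B.sl_scale good_Eij \<Phi>_add \<Phi>_scale)
  qed
  have word: "w \<in> V a 1 \<and> \<Phi> w \<in> R" if "B.lw (E a 1 (hwl a)) i j w" for i j w
    using that
  proof (induction rule: B.lw.induct)
    case lw_base
    show ?case using hw E_in[OF 1 hwl_in] unfolding \<Phi>_E[OF hwl_in] by blast
  next
    case (lw_T i j w)
    then show ?case
      using \<Phi>_ladder B.invariant_imp_sl[OF R good_Eij(2)] B.invariant_imp_sl[OF V_invariant[OF 1] good_Eij(2)] by simp
  next
    case (lw_U i j w)
    then show ?case
      using \<Phi>_ladder B.invariant_imp_sl[OF R good_Eij(4)] B.invariant_imp_sl[OF V_invariant[OF 1] good_Eij(4)] by simp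
  qed
  have "\<Phi> x \<in> R" if "x \<in> V a 1" for x
    using that unfolding V_words[OF 1]
  proof (induction rule: B.vs.span_induct_alt)
    case base
    show ?case using sR by (simp add: \<Phi>_zero B.vs.subspace_0)
  next
    case (step c y z)
    then obtain i j where "B.lw (E a 1 (hwl a)) i j y" by blast
    with word step show ?case
      using sR by (simp add: \<Phi>_add \<Phi>_scale B.vs.subspace_add B.vs.subspace_scale)
  qed
  from this[OF E_in[OF 1 l]] show ?thesis
    by (simp only: \<Phi>_E[OF l])
qed

text \<open>A nonzero invariant subspace contains a highest weight vector: a nonzero element whose maximal
  grade is minimal is annihilated by the raising operators.\<close>

lemma raised_out:
  assumes R: "invariant_subspace cscale (conj_act \<rho>) R" and A: "A \<in> R" "A \<noteq> 0"
  obtains A' where "A' \<in> R" "A' \<noteq> 0" "B.Tp A' = 0" "B.Up A' = 0"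
proof -
  define Q where "Q N A \<longleftrightarrow> A \<in> R \<and> A \<noteq> 0 \<and>
     (\<forall>b \<tau> l. \<tau> \<in> {1..m b} \<longrightarrow> l \<in> gt_labels b \<longrightarrow> hs_inner (E b \<tau> l) A \<noteq> 0 \<longrightarrow> grade l \<le> N)" for N A
  have "finite (\<Union>b\<in>{b. 0 < m b}. grade ` gt_labels b)"
    using finite_multiplicity finite_gt_labels by blast
  then obtain N0 where N0: "\<forall>x\<in>(\<Union>b\<in>{b. 0 < m b}. grade ` gt_labels b). x \<le> N0"
    unfolding finite_nat_set_iff_bounded_le by blast
  have "grade l \<le> N0" if "\<tau> \<in> {1..m b}" "l \<in> gt_labels b" for b \<tau> l
  proof -
    have "0 < m b"
      using that(1) by simp
    then show ?thesis
      using N0 that(2) by blast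
  qed
  then have "\<exists>A. Q N0 A"
    using A unfolding Q_def by blast
  then have "\<exists>N. (\<exists>A. Q N A) \<and> (\<forall>N'<N. \<not> (\<exists>A. Q N' A))"
    using exists_least_iff[of "\<lambda>N. \<exists>A. Q N A"] by blast
  then obtain N A' where Q: "Q N A'" and least: "\<And>N' A. N' < N \<Longrightarrow> \<not> Q N' A"
    by blast
  \<comment> \<open>By minimality of N an element of R with all grades strictly below N vanishes;
    for N = 0 the hypothesis leaves it no components at all.\<close>
  have kill: "X = 0"
    if X: "X \<in> R" and low: "\<And>b \<tau> l. \<tau> \<in> {1..m b} \<Longrightarrow> l \<in> gt_labels b \<Longrightarrow> hs_inner (E b \<tau> l) X \<noteq> 0 \<Longrightarrow> Suc (grade l) \<le> N"
    for X
  proof (rule ccontr)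
    assume "X \<noteq> 0"
    then obtain b \<tau> l where "\<tau> \<in> {1..m b}" "l \<in> gt_labels b" "hs_inner (E b \<tau> l) X \<noteq> 0"
      by (rule operator_nonzero)
    then have "N - 1 < N"
      using low by fastforce
    moreover have "Q (N - 1) X"
      unfolding Q_def using X \<open>X \<noteq> 0\<close> low by fastforce
    ultimately show False
      using least by blast
  qed
  have A': "A' \<in> R" "A' \<noteq> 0"
    and bound: "\<And>b \<tau> l. \<tau> \<in> {1..m b} \<Longrightarrow> l \<in> gt_labels b \<Longrightarrow> hs_inner (E b \<tau> l) A' \<noteq> 0 \<Longrightarrow> grade l \<le> N"
    using Q unfolding Q_def by blast+
  have "B.Tp A' = 0"
  proof (rule kill)
    show "B.Tp A' \<in> R"
      by (rule B.invariant_imp_sl[OF R good_Eij(1) A'(1)])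
    fix b \<tau> l assume *: "\<tau> \<in> {1..m b}" "l \<in> gt_labels b" "hs_inner (E b \<tau> l) (B.Tp A') \<noteq> 0"
    have "hs_inner (E b \<tau> l) (B.Tp A') = of_real (coefT1 b l) * hs_inner (E b \<tau> (lowT1 l)) A' +
        of_real (coefT2 b l) * hs_inner (E b \<tau> (lowT2 l)) A'"
      by (simp add: E_lower[OF *(1,2)] B.ip_add_left B.ip_scale_left flip: B.ladder_adj(2))
    then consider "coefT1 b l \<noteq> 0" "hs_inner (E b \<tau> (lowT1 l)) A' \<noteq> 0" | "coefT2 b l \<noteq> 0" "hs_inner (E b \<tau> (lowT2 l)) A' \<noteq> 0"
      using *(3) by fastforce
    then show "Suc (grade l) \<le> N"
    proof cases
      case 1
      then show ?thesis
        using bound[OF *(1) low_in_labels(2)[OF *(2) 1(1)] 1(2)] by (simp add: grade_low[OF *(2)])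
    next
      case 2
      then show ?thesis
        using bound[OF *(1) low_in_labels(3)[OF *(2) 2(1)] 2(2)] by (simp add: grade_low[OF *(2)])
    qed
  qed
  moreover have "B.Up A' = 0"
  proof (rule kill)
    show "B.Up A' \<in> R"
      by (rule B.invariant_imp_sl[OF R good_Eij(3) A'(1)])
    fix b \<tau> l assume *: "\<tau> \<in> {1..m b}" "l \<in> gt_labels b" "hs_inner (E b \<tau> l) (B.Up A') \<noteq> 0"
    have "hs_inner (E b \<tau> l) (B.Up A') = of_real (coefU l) * hs_inner (E b \<tau> (lowU l)) A'"
      by (simp add: E_lower[OF *(1,2)] B.ip_scale_left flip: B.ladder_adj(4))
    then have "coefU l \<noteq> 0" "hs_inner (E b \<tau> (lowU l)) A' \<noteq> 0"
      using *(3) by auto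
    then show "Suc (grade l) \<le> N"
      using bound[OF *(1) low_in_labels(1)[OF *(2)]] by (simp add: grade_low[OF *(2)])
  qed
  ultimately show ?thesis
    using that[OF A'] by blast
qed

text \<open>Among the nonzero elements of R supported on highest weight labels, take one that meets
  the fewest types. If it met a and another type b, their weights would differ for \<open>T3\<close>
  or \<open>U3\<close>, and subtracting the eigenvalue at a would remove a but keep b.\<close>

lemma hw_in_invariant:
  assumes R: "invariant_subspace cscale (conj_act \<rho>) R" and A: "A \<in> R" "A \<noteq> 0"
  obtains a \<xi> \<sigma> where "\<sigma> \<in> {1..m a}" "\<xi> \<sigma> \<noteq> 0" "combo \<xi> a (hwl a) \<in> R"
proof -
  have sR: "B.vs.subspace R"
    using R by (simp add: invariant_subspace_def)
  obtain A1 where A1: "A1 \<in> R" "A1 \<noteq> 0" "B.Tp A1 = 0" "B.Up A1 = 0"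
    using raised_out[OF R A] .
  define Q where "Q A \<longleftrightarrow> A \<in> R \<and> A \<noteq> 0 \<and>
     (\<forall>b \<tau> l. \<tau> \<in> {1..m b} \<longrightarrow> l \<in> gt_labels b \<longrightarrow> l \<noteq> hwl b \<longrightarrow> hs_inner (E b \<tau> l) A = 0)" for A
  define S where "S A = {b. \<exists>\<tau>\<in>{1..m b}. hs_inner (E b \<tau> (hwl b)) A \<noteq> 0}" for A
  have "Q A1"
    using A1 hw_component unfolding Q_def by blast
  then obtain A2 where Q: "Q A2" and least: "\<And>X. Q X \<Longrightarrow> card (S A2) \<le> card (S X)"
    using ex_has_least_nat[of Q A1 "\<lambda>A. card (S A)"] by blast
  have A2: "A2 \<in> R" "A2 \<noteq> 0"
    and comp: "\<And>b \<tau> l. \<tau> \<in> {1..m b} \<Longrightarrow> l \<in> gt_labels b \<Longrightarrow> l \<noteq> hwl b \<Longrightarrow> hs_inner (E b \<tau> l) A2 = 0"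
    using Q unfolding Q_def by blast+
  have finS: "finite (S A2)"
    by (rule finite_subset[OF _ finite_multiplicity]) (auto simp: S_def)
  obtain a \<sigma> l where a: "\<sigma> \<in> {1..m a}" "l \<in> gt_labels a" "hs_inner (E a \<sigma> l) A2 \<noteq> 0"
    using operator_nonzero[OF A2(2)] .
  then have l: "l = hwl a"
    using comp by blast
  have aS: "a \<in> S A2"
    using a by (auto simp: S_def l)
  have reduce: False
    if b: "b \<in> S A2" and X: "X \<in> R" and c: "c b \<noteq> (0::complex)" "c a = 0"
      and coef: "\<And>d \<tau>. \<tau> \<in> {1..m d} \<Longrightarrow> hs_inner (E d \<tau> (hwl d)) X = c d * hs_inner (E d \<tau> (hwl d)) A2"
      and coef0: "\<And>d \<tau> l. \<tau> \<in> {1..m d} \<Longrightarrow> l \<in> gt_labels d \<Longrightarrow> l \<noteq> hwl d \<Longrightarrow> hs_inner (E d \<tau> l) X = 0"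
    for b X c
  proof -
    obtain \<tau> where \<tau>: "\<tau> \<in> {1..m b}" "hs_inner (E b \<tau> (hwl b)) A2 \<noteq> 0"
      using b by (auto simp: S_def)
    then have "hs_inner (E b \<tau> (hwl b)) X \<noteq> 0"
      using coef[OF \<tau>(1)] c(1) by simp
    then have "X \<noteq> 0"
      by auto
    then have "Q X"
      using X coef0 unfolding Q_def by blast
    moreover have "S X \<subseteq> S A2 - {a}"
      using coef c(2) unfolding S_def by fastforce
    then have "card (S X) < card (S A2)"
      using finS aS by (metis card_Diff1_less card_mono finite_Diff le_less_trans)
    ultimately show False
      using least by fastforce
  qed
  have only_a: "b = a" if b: "b \<in> S A2" for b
  proof (rule ccontr)
    assume "b \<noteq> a"
    then consider "fst b \<noteq> fst a" | "snd b \<noteq> snd a"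
      by (meson prod_eqI)
    then show False
    proof cases
      case 1
      let ?X = "B.T3 A2 - cscale (of_real (real (fst a) / 2)) A2"
      have "?X \<in> R"
        using B.invariant_imp_sl[OF R good_Eij(5) A2(1)] sR A2(1) by (simp add: B.vs.subspace_diff B.vs.subspace_scale)
      then show False
        by (rule reduce[OF b, where c = "\<lambda>d. of_real ((real (fst d) - real (fst a)) / 2)"])
           (use 1 comp in \<open>auto simp: B.ip_diff B.ip_scale_right hs_T3_U3 hwl_in lab_hwl algebra_simps diff_divide_distrib\<close>)
    next
      case 2
      let ?X = "B.U3 A2 - cscale (of_real (real (snd a) / 2)) A2"
      have "?X \<in> R"
        using B.invariant_imp_sl[OF R good_Eij(6) A2(1)] sR A2(1) by (simp add: B.vs.subspace_diff B.vs.subspace_scale)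
      then show False
        by (rule reduce[OF b, where c = "\<lambda>d. of_real ((real (snd d) - real (snd a)) / 2)"])
           (use 2 comp in \<open>auto simp: B.ip_diff B.ip_scale_right hs_T3_U3 hwl_in lab_hwl algebra_simps diff_divide_distrib\<close>)
    qed
  qed
  define \<xi> where "\<xi> \<tau> = hs_inner (E a \<tau> (hwl a)) A2" for \<tau>
  have "A2 = combo \<xi> a (hwl a)"
  proof (rule operator_eqI)
    fix b \<tau> l assume *: "\<tau> \<in> {1..m b}" "l \<in> gt_labels b"
    show "hs_inner (E b \<tau> l) A2 = hs_inner (E b \<tau> l) (combo \<xi> a (hwl a))"
    proof (cases "b = a \<and> l = hwl a")
      case True
      then show ?thesis
        using hs_combo[OF * hwl_in, of \<xi> a] by (simp add: \<xi>_def)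
    next
      case False
      have "hs_inner (E b \<tau> l) A2 = 0"
      proof (cases "l = hwl b")
        case True
        then have "b \<notin> S A2"
          using False only_a by blast
        then show ?thesis
          using *(1) True unfolding S_def by blast
      qed (rule comp[OF *])
      then show ?thesis
        using False hs_combo[OF * hwl_in, of \<xi> a] by auto
    qed
  qed
  then show ?thesis
    using that[of \<sigma> a \<xi>] a A2(1) by (simp add: \<xi>_def l)
qed

subsection \<open>Injectivity of a symbol in terms of coefficients\<close>

definition kc :: "complex^'n^'n \<Rightarrow> nat \<times> nat \<Rightarrow> nat \<Rightarrow> nat \<Rightarrow> complex" where
  "kc K a \<sigma> \<gamma> = hs_inner (E a \<sigma> (zlab a \<gamma>)) K"

text \<open>Independence of the columns of the characteristic matrix, up to complex conjugation and
  a positive factor. The conjugate of \<xi> comes from the left slot of the inner product.\<close>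

definition independent_columns :: "complex^'n^'n \<Rightarrow> nat \<times> nat \<Rightarrow> bool" where
  "independent_columns K a \<longleftrightarrow>
     (\<forall>\<xi>. (\<forall>\<gamma>\<in>{1..zero_mult a}. (\<Sum>\<sigma>\<in>{1..m a}. cnj (\<xi> \<sigma>) * kc K a \<sigma> \<gamma>) = 0) \<longrightarrow> (\<forall>\<sigma>\<in>{1..m a}. \<xi> \<sigma> = 0))"

definition injective_kernel :: "complex^'n^'n \<Rightarrow> bool" where
  "injective_kernel K \<longleftrightarrow> (\<forall>A. (\<forall>g\<in>SU3. trace (A ** conj_act \<rho> g K) = 0) \<longrightarrow> A = 0)"

lemma hs_combo_left: "hs_inner (combo \<xi> a (zlab a \<gamma>)) K = (\<Sum>\<sigma>\<in>{1..m a}. cnj (\<xi> \<sigma>) * kc K a \<sigma> \<gamma>)"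
  by (simp add: combo_def B.ip_sum_left B.ip_scale_left kc_def)

lemma torus_fixed_component:
  assumes "\<And>t. t \<in> torus \<Longrightarrow> conj_act \<rho> t K = K"
    and "\<sigma> \<in> {1..m a}" "l \<in> gt_labels a" "hs_inner (E a \<sigma> l) K \<noteq> 0"
  obtains \<gamma> where "\<gamma> \<in> {1..zero_mult a}" "l = zlab a \<gamma>"
proof -
  have "B.T3 K = 0 \<and> B.U3 K = 0"
    using B.torus_fixed_iff assms(1) by blast
  then have "lab_t l = 0" "lab_u l = 0"
    using hs_T3_U3[OF assms(2,3), of K] assms(4) by auto
  then show ?thesis
    using zlab_surj[OF assms(3)] that by blast
qed

lemma independent_imp_injective:
  assumes "\<And>a. 0 < m a \<Longrightarrow> independent_columns K a"
  shows "injective_kernel K"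
  unfolding injective_kernel_def
proof (intro allI impI)
  fix A assume A: "\<forall>g\<in>SU3. trace (A ** conj_act \<rho> g K) = 0"
  define R where "R = {C. \<forall>g\<in>SU3. hs_inner C (conj_act \<rho> g K) = 0}"
  have "hs_inner (conj_act \<rho> h C) (conj_act \<rho> g K) = 0" if "C \<in> R" "g \<in> SU3" "h \<in> SU3" for C g h
    using that by (simp add: R_def B.ip_act SU3_adj SU3_mult flip: B.act_mult)
  then have R: "invariant_subspace cscale (conj_act \<rho>) R"
    unfolding invariant_subspace_def B.vs.subspace_def by (auto simp: R_def B.ip_add_left B.ip_scale_left)
  have AR: "adj A \<in> R"
    using A by (simp add: R_def trace_mult_hs)
  show "A = 0"
  proof (rule ccontr)
    assume "A \<noteq> 0"
    then have "adj A \<noteq> 0"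
      by (auto simp: veq)
    then obtain a \<xi> \<sigma> where \<xi>: "\<sigma> \<in> {1..m a}" "\<xi> \<sigma> \<noteq> 0" "combo \<xi> a (hwl a) \<in> R"
      using hw_in_invariant[OF R AR] by blast
    then have a: "0 < m a"
      by simp
    have "(\<Sum>\<sigma>\<in>{1..m a}. cnj (\<xi> \<sigma>) * kc K a \<sigma> \<gamma>) = 0" if \<gamma>: "\<gamma> \<in> {1..zero_mult a}" for \<gamma>
    proof -
      have "combo \<xi> a (zlab a \<gamma>) \<in> R"
        by (rule combo_mem[OF R \<xi>(3) a zlab_in[OF multiplicity_bounds(1)[OF a] \<gamma>]])
      then have "hs_inner (combo \<xi> a (zlab a \<gamma>)) (conj_act \<rho> (mat 1) K) = 0"
        unfolding R_def using SU3_one by blast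
      then show ?thesis
        by (simp add: B.act_one hs_combo_left)
    qed
    then show False
      using assms[OF a] \<xi>(1,2) unfolding independent_columns_def by blast
  qed
qed

text \<open>A dependence \<xi> makes the whole oblique copy \<open>combo \<xi> a\<close> orthogonal
  to K: at weight zero by hypothesis, elsewhere because K is fixed by the torus. Since the copy is
  invariant, it is orthogonal to the orbit of K, and adjoints of its elements have zero
  symbol.\<close>

lemma injective_imp_independent:
  assumes fixed: "\<And>t. t \<in> torus \<Longrightarrow> conj_act \<rho> t K = K" and inj: "injective_kernel K" and a: "0 < m a"
  shows "independent_columns K a"
  unfolding independent_columns_def
proof (intro allI impI, rule ccontr)
  fix \<xi> assume z: "\<forall>\<gamma>\<in>{1..zero_mult a}. (\<Sum>\<sigma>\<in>{1..m a}. cnj (\<xi> \<sigma>) * kc K a \<sigma> \<gamma>) = 0"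
    and nz: "\<not> (\<forall>\<sigma>\<in>{1..m a}. \<xi> \<sigma> = 0)"
  let ?S = "B.vs.span (combo \<xi> a ` gt_labels a)"
  let ?C = "combo \<xi> a (hwl a)"
  have "hs_inner (combo \<xi> a l) K = 0" if l: "l \<in> gt_labels a" for l
  proof (cases "\<exists>\<gamma>\<in>{1..zero_mult a}. l = zlab a \<gamma>")
    case True
    then show ?thesis
      using z by (auto simp: hs_combo_left)
  next
    case False
    have "hs_inner (E a \<sigma> l) K = 0" if "\<sigma> \<in> {1..m a}" for \<sigma>
      using torus_fixed_component[OF fixed that l] False by blast
    then show ?thesis
      by (simp add: combo_def B.ip_sum_left B.ip_scale_left)
  qed
  then have "hs_inner y K = 0" if "y \<in> combo \<xi> a ` gt_labels a" for y
    using that by blast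
  then have S0: "hs_inner x K = 0" if "x \<in> ?S" for x
    using B.ip_span_zero[OF _ that] by blast
  have CS: "?C \<in> ?S"
    by (simp add: B.vs.span_base hwl_in)
  have "trace (adj ?C ** conj_act \<rho> g K) = 0" if g: "g \<in> SU3" for g
  proof -
    have "conj_act \<rho> (adj g) ?C \<in> ?S"
      using combo_span_invariant CS SU3_adj[OF g] unfolding invariant_subspace_def by blast
    then show ?thesis
      using S0 B.ip_act[OF SU3_adj[OF g], of ?C K] by (simp add: trace_mult_hs)
  qed
  then have "adj ?C = 0"
    using inj unfolding injective_kernel_def by blast
  then have "adj (adj ?C) = 0"
    by (simp add: veq)
  then have "?C = 0"
    by simp
  then have "\<xi> \<sigma> = 0" if "\<sigma> \<in> {1..m a}" for \<sigma>
    using hs_combo[OF that hwl_in hwl_in[of a], of \<xi>] by simp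
  with nz show False
    by blast
qed

end

section \<open>Smoothness and measurability of symbols\<close>

lemma Ck_on_imp_continuous: "Ck_on k U f \<Longrightarrow> continuous_on U f"
  by (cases k) (auto intro!: continuous_at_imp_continuous_on dest: has_derivative_continuous)

lemma Ck_on_Suc_imp: "Ck_on (Suc k) U f \<Longrightarrow> Ck_on k U f"
proof (induction k arbitrary: f)
  case 0
  then show ?case
    using Ck_on_imp_continuous by fastforce
next
  case (Suc k)
  obtain f' where "\<forall>x\<in>U. (f has_derivative f' x) (at x)" "\<forall>v. Ck_on (Suc k) U (\<lambda>x. f' x v)"
    using Suc.prems by (subst (asm) Ck_on.simps(2)) blast
  then show ?case
    using Suc.IH by (subst Ck_on.simps(2)) blast
qed

lemma Ck_on_add: "Ck_on k U f \<Longrightarrow> Ck_on k U g \<Longrightarrow> Ck_on k U (\<lambda>x. f x + g x)"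
proof (induction k arbitrary: f g)
  case 0
  then show ?case
    by (auto intro: continuous_on_add)
next
  case (Suc k)
  obtain f' g' where d: "\<forall>x\<in>U. (f has_derivative f' x) (at x)" "\<forall>v. Ck_on k U (\<lambda>x. f' x v)"
    "\<forall>x\<in>U. (g has_derivative g' x) (at x)" "\<forall>v. Ck_on k U (\<lambda>x. g' x v)"
    using Suc.prems by auto
  show ?case
    unfolding Ck_on.simps
    by (rule exI[of _ "\<lambda>x v. f' x v + g' x v"]) (use d Suc.IH in \<open>auto intro: has_derivative_add\<close>)
qed

lemma Ck_on_bilinear:
  assumes "bounded_bilinear bl"
  shows "Ck_on k U f \<Longrightarrow> Ck_on k U g \<Longrightarrow> Ck_on k U (\<lambda>x. bl (f x) (g x))"
proof (induction k arbitrary: f g)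
  case 0
  then show ?case
    by (auto intro: bounded_bilinear.continuous_on[OF assms])
next
  case (Suc k)
  obtain f' g' where d: "\<forall>x\<in>U. (f has_derivative f' x) (at x)" "\<forall>v. Ck_on k U (\<lambda>x. f' x v)"
    "\<forall>x\<in>U. (g has_derivative g' x) (at x)" "\<forall>v. Ck_on k U (\<lambda>x. g' x v)"
    using Suc.prems by auto
  have fg: "Ck_on k U f" "Ck_on k U g"
    using Suc.prems Ck_on_Suc_imp by blast+
  show ?case
    unfolding Ck_on.simps
    by (rule exI[of _ "\<lambda>x v. bl (f x) (g' x v) + bl (f' x v) (g x)"])
       (use d Suc.IH fg in \<open>auto intro!: bounded_bilinear.FDERIV[OF assms] Ck_on_add\<close>)
qed

lemma Ck_on_linear:
  assumes "bounded_linear L" shows "Ck_on k U f \<Longrightarrow> Ck_on k U (\<lambda>x. L (f x))"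
proof (induction k arbitrary: f)
  case 0
  then show ?case
    by (auto intro: bounded_linear.continuous_on[OF assms])
next
  case (Suc k)
  obtain f' where d: "\<forall>x\<in>U. (f has_derivative f' x) (at x)" "\<forall>v. Ck_on k U (\<lambda>x. f' x v)"
    using Suc.prems by auto
  show ?case
    unfolding Ck_on.simps
    by (rule exI[of _ "\<lambda>x v. L (f' x v)"])
       (use d Suc.IH in \<open>auto intro!: bounded_linear.has_derivative[OF assms]\<close>)
qed

lemma smooth_submfd_continuous_on:
  assumes "smooth_submfd S f" shows "continuous_on S f"
  unfolding continuous_on_eq_continuous_within
proof
  fix x assume x: "x \<in> S"
  obtain U F where U: "open U" "x \<in> U" "\<forall>k. Ck_on k U F" "\<forall>y\<in>U \<inter> S. F y = f y"
    using assms x unfolding smooth_submfd_def by blast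
  have "continuous_on U F"
    using U(3) Ck_on_imp_continuous by blast
  then have "continuous (at x within S) F"
    using U(1,2) by (simp add: continuous_on_eq_continuous_at continuous_at_imp_continuous_within)
  moreover have "\<forall>\<^sub>F y in at x within S. F y = f y"
    using U by (auto simp: eventually_at_topological)
  ultimately show "continuous (at x within S) f"
    using U(2,4) x unfolding continuous_within by (auto intro: Lim_transform_eventually)
qed

section \<open>The flag manifold as a Borel space with SU(3) action\<close>

lemma torus_SU3: "t \<in> torus \<Longrightarrow> t \<in> SU3"
  by (simp add: torus_def)

lemma one_torus: "mat 1 \<in> torus"
  by (simp add: torus_def mat_nth)

lemma flag_act_base: "flag_act g flag_base = flag_proj g"
  by (simp add: flag_act_def flag_base_def flag_proj_def)

lemma flag_act_proj: "flag_act g (flag_proj h) = flag_proj (g ** h)"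
  by (simp add: flag_act_def flag_proj_def image_image matrix_mul_assoc)

lemma flag_proj_in: "g \<in> SU3 \<Longrightarrow> flag_proj g \<in> flags"
  by (simp add: flags_def)

lemma openin_flag: "openin flag_topology U \<longleftrightarrow> U \<subseteq> flags \<and> openin (top_of_set SU3) {g \<in> SU3. flag_proj g \<in> U}"
  by (simp add: flag_topology_def openin_quot_topology flags_def)

lemma openin_flags: "{U. openin flag_topology U} \<subseteq> Pow flags"
  by (auto simp: openin_flag)

lemma space_flag_borel: "space flag_borel = flags"
  by (simp add: flag_borel_def openin_flags)

lemma sets_flag_borel: "sets flag_borel = sigma_sets flags {U. openin flag_topology U}"
  by (simp add: flag_borel_def openin_flags)

text \<open>It suffices to test preimages of generating open sets, and left multiplication is
  continuous.\<close>

lemma measurable_flag_act: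
  assumes "g \<in> SU3" shows "flag_act g \<in> measurable flag_borel flag_borel"
  unfolding flag_borel_def
proof (rule measurable_measure_of)
  show "{U. openin flag_topology U} \<subseteq> Pow flags"
    by (rule openin_flags)
  show "flag_act g \<in> space (sigma flags {U. openin flag_topology U}) \<rightarrow> flags"
    using assms space_flag_borel[unfolded flag_borel_def]
    by (auto simp: flag_act_proj flags_def intro!: imageI SU3_mult)
  fix U assume "U \<in> {U. openin flag_topology U}"
  then have U: "U \<subseteq> flags" "openin (top_of_set SU3) {h \<in> SU3. flag_proj h \<in> U}"
    by (auto simp: openin_flag)
  have "continuous_on SU3 ((**) g)"
    by (intro linear_continuous_on matmul.bounded_linear_right)
  then have "openin (top_of_set SU3) (SU3 \<inter> (**) g -` {h \<in> SU3. flag_proj h \<in> U})"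
    using assms by (intro continuous_openin_preimage[OF _ _ U(2)]) (auto intro: SU3_mult)
  moreover have "SU3 \<inter> (**) g -` {h \<in> SU3. flag_proj h \<in> U} = {h \<in> SU3. flag_proj h \<in> flag_act g -` U \<inter> flags}"
    using assms by (auto simp: flag_act_proj flag_proj_in SU3_mult)
  ultimately have "openin flag_topology (flag_act g -` U \<inter> flags)"
    by (simp add: openin_flag)
  then show "flag_act g -` U \<inter> space (sigma flags {U. openin flag_topology U})
      \<in> sets (sigma flags {U. openin flag_topology U})"
    by (simp add: openin_flags sigma_sets.Basic)
qed

section \<open>Symbols of torus-fixed operators and their means\<close>

locale su3_symbols = su3_gt p \<rho> m V e for p and \<rho> :: "complex^3^3 \<Rightarrow> complex^'n^'n" and m V e +
  fixes \<mu> :: "(complex^3^3) set measure"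
  assumes invariant_prob: "invariant_prob \<mu>"
begin

lemma sets_mu: "sets \<mu> = sets flag_borel" and mass_mu: "emeasure \<mu> flags = 1"
  and distr_mu: "g \<in> SU3 \<Longrightarrow> distr \<mu> \<mu> (flag_act g) = \<mu>"
  using invariant_prob by (auto simp: invariant_prob_def)

lemma space_mu: "space \<mu> = flags"
  using sets_eq_imp_space_eq[OF sets_mu] by (simp add: space_flag_borel)

lemma finite_measure_mu: "finite_measure \<mu>"
  by (rule finite_measureI) (simp add: space_mu mass_mu)

lemma integral_const_mu: "(\<integral>z. c \<partial>\<mu>) = (c :: complex)"
  using mass_mu by (simp add: measure_def space_mu)

lemma trace_conj_act: "g \<in> SU3 \<Longrightarrow> trace (conj_act \<rho> g A) = trace A"
proof -
  assume g: "g \<in> SU3"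
  have "trace (conj_act \<rho> g A) = trace (\<rho> g ** (A ** adj (\<rho> g)))"
    by (simp add: conj_act_eq g matrix_mul_assoc)
  also have "\<dots> = trace (A ** adj (\<rho> g) ** \<rho> g)"
    by (rule trace_mul_sym)
  also have "\<dots> = trace A"
    by (simp add: rho_unitary g flip: matrix_mul_assoc)
  finally show ?thesis .
qed

text \<open>For a K fixed by the torus the chosen representative g is immaterial. The value off the
  flag manifold makes the function extensional, as \<open>Cinf_flags\<close> demands.\<close>

definition symbol :: "complex^'n^'n \<Rightarrow> complex^'n^'n \<Rightarrow> (complex^3^3) set \<Rightarrow> complex" where
  "symbol K A z = (if z \<in> flags then trace (A ** conj_act \<rho> (SOME g. g \<in> SU3 \<and> flag_proj g = z) K) else undefined)"

context
  fixes K :: "complex^'n^'n"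
  assumes fixed: "\<And>t. t \<in> torus \<Longrightarrow> conj_act \<rho> t K = K"
begin

lemma symbol_proj:
  assumes g: "g \<in> SU3" shows "symbol K A (flag_proj g) = trace (A ** conj_act \<rho> g K)"
proof -
  define h where "h = (SOME h. h \<in> SU3 \<and> flag_proj h = flag_proj g)"
  have h: "h \<in> SU3 \<and> flag_proj h = flag_proj g"
    unfolding h_def by (rule someI[of _ g]) (simp add: g)
  have "h \<in> flag_proj g"
    using h one_torus by (force simp: flag_proj_def)
  then obtain t where t: "t \<in> torus" "h = g ** t"
    by (auto simp: flag_proj_def)
  then have "conj_act \<rho> h K = conj_act \<rho> g K"
    using g by (simp add: B.act_mult torus_SU3 fixed)
  then show ?thesis
    using g by (simp add: symbol_def flag_proj_in flip: h_def)
qed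

lemma symbol_Cinf: "symbol K A \<in> Cinf_flags"
  unfolding Cinf_flags_def
proof (intro CollectI conjI)
  show "symbol K A \<in> extensional flags"
    by (simp add: symbol_def extensional_def)
  show "smooth_submfd SU3 (\<lambda>g. symbol K A (flag_proj g))"
    unfolding smooth_submfd_def
  proof
    fix x :: "complex^3^3" assume "x \<in> SU3"
    then obtain U F where U: "open U" "x \<in> U" "\<forall>k. Ck_on k U F" "\<forall>y\<in>U \<inter> SU3. F y = \<rho> y"
      using rho_smooth unfolding smooth_submfd_def by blast
    have "Ck_on k U (\<lambda>y. hs_inner (adj A) (F y ** K ** adj (F y)))" for k
      using U(3)
      by (intro Ck_on_linear[OF bounded_bilinear.bounded_linear_right[OF B.bounded_bilinear_ip]]
          Ck_on_bilinear[OF bounded_bilinear_matrix_mult] Ck_on_linear[OF matmul.bounded_linear_left]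
          Ck_on_linear[OF bounded_linear_adj]) auto
    moreover have "hs_inner (adj A) (F y ** K ** adj (F y)) = symbol K A (flag_proj y)" if "y \<in> U \<inter> SU3" for y
      using that U(4) by (simp add: symbol_proj conj_act_eq hs_inner_def)
    ultimately show "\<exists>U F. open U \<and> x \<in> U \<and> (\<forall>k. Ck_on k U F) \<and> (\<forall>y\<in>U \<inter> SU3. F y = symbol K A (flag_proj y))"
      using U(1,2) by blast
  qed
qed

lemma symbol_measurable: "symbol K A \<in> borel_measurable \<mu>"
proof (rule borel_measurableI)
  fix S :: "complex set" assume S: "open S"
  have "continuous_on SU3 (\<lambda>g. symbol K A (flag_proj g))"
    using symbol_Cinf smooth_submfd_continuous_on by (auto simp: Cinf_flags_def)
  then have "openin (top_of_set SU3) (SU3 \<inter> (\<lambda>g. symbol K A (flag_proj g)) -` S)"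
    using S continuous_openin_preimage_gen by blast
  moreover have "SU3 \<inter> (\<lambda>g. symbol K A (flag_proj g)) -` S = {g \<in> SU3. flag_proj g \<in> symbol K A -` S \<inter> flags}"
    by (auto simp: flag_proj_in)
  ultimately have "openin flag_topology (symbol K A -` S \<inter> flags)"
    by (simp add: openin_flag)
  then show "symbol K A -` S \<inter> space \<mu> \<in> sets \<mu>"
    by (simp add: space_mu sets_mu sets_flag_borel sigma_sets.Basic)
qed

text \<open>Bounded on a space of mass 1, since conjugation preserves the norm of K.\<close>

lemma symbol_integrable: "integrable \<mu> (symbol K A)"
proof -
  obtain C where C: "\<And>x y. norm (hs_inner x (y :: complex^'n^'n)) \<le> norm x * norm y * C"
    using bounded_bilinear.bounded[OF B.bounded_bilinear_ip] by blast
  have "norm (symbol K A z) \<le> norm (adj A) * norm K * C" if z: "z \<in> flags" for z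
  proof -
    obtain g where g: "g \<in> SU3" "z = flag_proj g"
      using z by (auto simp: flags_def)
    have "conj_act \<rho> g K \<bullet> conj_act \<rho> g K = K \<bullet> K"
      using B.act_ip[OF g(1), of K K] by (simp flip: B.ip_Re)
    then have "norm (conj_act \<rho> g K) = norm K"
      by (simp add: norm_eq_sqrt_inner)
    then show ?thesis
      using C[of "adj A" "conj_act \<rho> g K"] g by (simp add: symbol_proj trace_mult_hs)
  qed
  then have "AE z in \<mu>. norm (symbol K A z) \<le> norm (adj A) * norm K * C"
    by (intro AE_I2) (simp add: space_mu)
  then show ?thesis
    by (rule finite_measure.integrable_const_bound[OF finite_measure_mu _ symbol_measurable])
qed

lemma symbol_add: "z \<in> flags \<Longrightarrow> symbol K (A + C) z = symbol K A z + symbol K C z"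
  by (auto simp: flags_def symbol_proj trace_mult_hs adj_add B.ip_add_left)

lemma symbol_scale: "z \<in> flags \<Longrightarrow> symbol K (cscale c A) z = c * symbol K A z"
  by (auto simp: flags_def symbol_proj trace_mult_hs adj_cscale B.ip_scale_left)

lemma symbol_covariant:
  assumes g: "g \<in> SU3" and z: "z \<in> flags"
  shows "symbol K (conj_act \<rho> g A) z = symbol K A (flag_act (adj g) z)"
proof -
  obtain h where h: "h \<in> SU3" "z = flag_proj h"
    using z by (auto simp: flags_def)
  have "adj (conj_act \<rho> g A) = conj_act \<rho> g (adj A)"
    by (simp add: conj_act_eq g adj_mult matrix_mul_assoc)
  then show ?thesis
    using g h by (simp add: flag_act_proj symbol_proj SU3_mult SU3_adj trace_mult_hs B.ip_act B.act_mult)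
qed

definition mean :: "complex^'n^'n \<Rightarrow> complex" where
  "mean A = (\<integral>z. symbol K A z \<partial>\<mu>)"

lemma mean_add: "mean (A + C) = mean A + mean C"
proof -
  have "mean (A + C) = (\<integral>z. symbol K A z + symbol K C z \<partial>\<mu>)"
    unfolding mean_def by (intro Bochner_Integration.integral_cong) (auto simp: space_mu symbol_add)
  then show ?thesis
    by (simp add: mean_def symbol_integrable)
qed

lemma mean_scale: "mean (cscale c A) = c * mean A"
proof -
  have "mean (cscale c A) = (\<integral>z. c * symbol K A z \<partial>\<mu>)"
    unfolding mean_def by (intro Bochner_Integration.integral_cong) (auto simp: space_mu symbol_scale)
  then show ?thesis
    by (simp add: mean_def)
qed

lemma mean_invariant: "g \<in> SU3 \<Longrightarrow> mean (conj_act \<rho> g A) = mean A"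
proof -
  assume g: "g \<in> SU3"
  have m: "flag_act (adj g) \<in> measurable \<mu> \<mu>"
    using measurable_flag_act[OF SU3_adj[OF g]] measurable_cong_sets[OF sets_mu sets_mu] by blast
  have "mean (conj_act \<rho> g A) = (\<integral>z. symbol K A (flag_act (adj g) z) \<partial>\<mu>)"
    unfolding mean_def by (intro Bochner_Integration.integral_cong) (auto simp: space_mu symbol_covariant g)
  also have "\<dots> = (\<integral>z. symbol K A z \<partial>distr \<mu> \<mu> (flag_act (adj g)))"
    by (rule integral_distr[OF m symbol_measurable, symmetric])
  finally show ?thesis
    by (simp add: distr_mu SU3_adj g mean_def)
qed

text \<open>By irreducibility an invariant functional vanishes on all nontrivial components.\<close>

lemma mean_trace:
  assumes tr: "trace K = 1" shows "mean A = trace A / of_real (irrep_dim p)"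
proof -
  define D where "D = {A. mean A = trace A / of_real (irrep_dim p)}"
  have tr_hs: "trace A = hs_inner (mat 1) A" for A :: "complex^'n^'n"
    by (simp add: hs_inner_def)
  have mean0: "mean 0 = 0"
    using mean_scale[of 0 0] by simp
  have D: "B.vs.subspace D"
    unfolding B.vs.subspace_def D_def
    by (auto simp: mean0 mean_add mean_scale tr_hs B.ip_add_right B.ip_scale_right add_divide_distrib)
  have "mean (mat 1) = 1"
  proof -
    have "symbol K (mat 1) z = 1" if z: "z \<in> flags" for z
    proof -
      obtain g where g: "g \<in> SU3" "z = flag_proj g"
        using z by (auto simp: flags_def)
      then show ?thesis
        using tr by (simp add: symbol_proj trace_conj_act)
    qed
    then have "mean (mat 1) = (\<integral>z. 1 \<partial>\<mu>)"
      unfolding mean_def by (intro Bochner_Integration.integral_cong) (auto simp: space_mu)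
    then show ?thesis
      by (simp only: integral_const_mu)
  qed
  then have one: "mat 1 \<in> D"
    using hs_one irrep_dim_pos[of p] by (simp add: D_def tr_hs irrep_dim_eq)
  have "V a \<sigma> \<subseteq> D" if \<sigma>: "\<sigma> \<in> {1..m a}" for a \<sigma>
  proof (cases "a = (0, 0)")
    case True
    then have s1: "\<sigma> = 1"
      using \<sigma> by (simp add: trivial_multiplicity)
    have inD: "E (0, 0) 1 ((0, 0, 0), 0) \<in> D"
      unfolding E_trivial using D one by (rule B.vs.subspace_scale)
    have L: "gt_labels (0, 0) = {((0, 0, 0), 0)}"
      using label_00 by blast
    have VE: "V a \<sigma> = B.vs.span (E (0, 0) 1 ` gt_labels (0, 0))"
      using E_span[OF \<sigma>] by (simp only: True s1)
    show ?thesis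
      unfolding VE L by (rule B.vs.span_minimal[OF _ D]) (use inD in blast)
  next
    case False
    define N where "N = {x \<in> V a \<sigma>. mean x = 0}"
    have sV: "B.vs.subspace (V a \<sigma>)"
      using V_invariant[OF \<sigma>] by (simp add: invariant_subspace_def)
    have "invariant_subspace cscale (conj_act \<rho>) N"
      using V_invariant[OF \<sigma>] sV unfolding invariant_subspace_def B.vs.subspace_def N_def
      by (auto simp: mean0 mean_add mean_scale mean_invariant)
    then have "N = {0} \<or> N = V a \<sigma>"
      using V_irrep[OF \<sigma>] by (simp add: is_irrep_def N_def)
    moreover have "N \<noteq> {0}"
    proof
      assume N0: "N = {0}"
      let ?v = "E a \<sigma> (hwl a)"
      have v: "?v \<in> V a \<sigma>"
        by (rule E_in[OF \<sigma> hwl_in])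
      \<comment> \<open>The difference of both sides has mean zero, hence lies in N. A highest
        weight vector fixed by the group would have weight zero.\<close>
      have "conj_act \<rho> g ?v = ?v" if g: "g \<in> SU3" for g
      proof -
        have "conj_act \<rho> g ?v - ?v \<in> V a \<sigma>"
          using V_invariant[OF \<sigma>] v g sV by (simp add: invariant_subspace_def B.vs.subspace_diff)
        moreover have "mean (conj_act \<rho> g ?v - ?v) = 0"
        proof -
          have "mean (conj_act \<rho> g ?v - ?v) + mean ?v = mean (conj_act \<rho> g ?v)"
            using mean_add[of "conj_act \<rho> g ?v - ?v" ?v] by simp
          then show ?thesis
            using mean_invariant[OF g] by simp
        qed
        ultimately have "conj_act \<rho> g ?v - ?v \<in> N"
          by (simp add: N_def)
        then show ?thesis
          using N0 by simp
      qed
      then have "B.T3 ?v = 0 \<and> B.U3 ?v = 0"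
        using B.torus_fixed_iff torus_SU3 by blast
      then have "lab_t (hwl a) = 0" "lab_u (hwl a) = 0"
        using hs_T3_U3[OF \<sigma> hwl_in, of ?v] E_ortho_V[OF \<sigma> hwl_in[of a] hwl_in] by auto
      then show False
        using False by (cases a) (simp add: lab_hwl)
    qed
    ultimately have N: "N = V a \<sigma>"
      by blast
    have "trace x = 0" if x: "x \<in> V a \<sigma>" for x
    proof -
      have "hs_inner (E (0, 0) 1 ((0, 0, 0), 0)) x = 0"
        using False by (intro V_orthogonal[OF _ \<sigma> _ E_in x]) (auto simp: trivial_multiplicity label_00)
      then show ?thesis
        using irrep_dim_pos[of p] unfolding E_trivial by (simp add: tr_hs B.ip_scale_left)
    qed
    then show ?thesis
      using N by (auto simp: N_def D_def)
  qed
  then have "B.vs.span (\<Union>a. \<Union>\<sigma>\<in>{1..m a}. V a \<sigma>) \<subseteq> D"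
    by (intro B.vs.span_minimal D) blast
  then have "A \<in> D"
    unfolding V_span by blast
  then show ?thesis
    by (simp add: D_def)
qed

end

section \<open>Characterization of operator kernels\<close>

theorem moduli_space_iff:
  "K \<in> moduli_space p \<rho> \<mu> \<longleftrightarrow>
     (\<forall>t\<in>torus. conj_act \<rho> t K = K) \<and> adj K = K \<and> trace K = 1 \<and> injective_kernel K"
proof
  assume "K \<in> moduli_space p \<rho> \<mu>"
  then obtain W where W: "symbol_correspondence p \<rho> \<mu> W" "operator_kernel \<rho> W K"
    by (auto simp: moduli_space_def)
  have fixed: "\<forall>t\<in>torus. conj_act \<rho> t K = K" and
    WK: "\<And>A g. g \<in> SU3 \<Longrightarrow> W A (flag_proj g) = trace (A ** conj_act \<rho> g K)"
    using W(2) by (auto simp: operator_kernel_def flag_act_base)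
  have Wext: "W A \<in> extensional flags" and Winj: "inj W"
    and Wadj: "z \<in> flags \<Longrightarrow> W (adj A) z = cnj (W A z)"
    and Wint: "(\<integral>z. W A z \<partial>\<mu>) = trace A / of_real (irrep_dim p)" for A z
    using W(1) by (auto simp: symbol_correspondence_def Cinf_flags_def)
  have "adj K = K"
  proof (rule B.ip_ext)
    fix A
    have "hs_inner A K = W (adj A) (flag_proj (mat 1))"
      by (simp add: WK B.act_one hs_inner_def)
    also have "\<dots> = cnj (W A (flag_proj (mat 1)))"
      by (rule Wadj[OF flag_proj_in[OF SU3_one]])
    also have "\<dots> = cnj (trace (A ** K))"
      by (simp add: WK B.act_one)
    also have "\<dots> = cnj (hs_inner (adj A) (adj (adj K)))"
      by (simp add: hs_inner_def)
    also have "\<dots> = hs_inner A (adj K)"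
      by (simp only: hs_inner_adj) (metis B.ip_cnj)
    finally show "hs_inner A (adj K) = hs_inner A K"
      by simp
  qed
  moreover have "trace K = 1"
  proof -
    \<comment> \<open>The symbol of the identity is constant, so its mean, prescribed to be 1, is
      the trace of K.\<close>
    have "W (mat 1) z = trace K" if z: "z \<in> flags" for z
    proof -
      obtain g where g: "g \<in> SU3" "z = flag_proj g"
        using z by (auto simp: flags_def)
      then show ?thesis
        by (simp add: WK trace_conj_act)
    qed
    then have "(\<integral>z. W (mat 1) z \<partial>\<mu>) = (\<integral>z. trace K \<partial>\<mu>)"
      by (intro Bochner_Integration.integral_cong) (auto simp: space_mu)
    then have "trace K = trace (mat 1 :: complex^'n^'n) / of_real (irrep_dim p)"
      by (simp only: integral_const_mu Wint)
    then show ?thesis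
      by (simp add: irrep_dim_eq trace_def mat_nth)
  qed
  moreover have "injective_kernel K"
    unfolding injective_kernel_def
  proof (intro allI impI)
    fix A assume A: "\<forall>g\<in>SU3. trace (A ** conj_act \<rho> g K) = 0"
    have "W A = W 0"
    proof (rule extensionalityI[OF Wext Wext])
      fix z assume "z \<in> flags"
      then obtain g where "g \<in> SU3" "z = flag_proj g"
        by (auto simp: flags_def)
      then show "W A z = W 0 z"
        using A by (simp add: WK matmul.zero_left) (simp add: trace_def)
    qed
    then show "A = 0"
      using Winj by (simp add: inj_def)
  qed
  ultimately show "(\<forall>t\<in>torus. conj_act \<rho> t K = K) \<and> adj K = K \<and> trace K = 1 \<and> injective_kernel K"
    using fixed by blast
next
  assume K: "(\<forall>t\<in>torus. conj_act \<rho> t K = K) \<and> adj K = K \<and> trace K = 1 \<and> injective_kernel K"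
  then have fixed: "\<And>t. t \<in> torus \<Longrightarrow> conj_act \<rho> t K = K"
    by blast
  have "symbol_correspondence p \<rho> \<mu> (symbol K)"
    unfolding symbol_correspondence_def
  proof (intro conjI allI ballI)
    show "symbol K A \<in> Cinf_flags" for A
      by (rule symbol_Cinf[OF fixed])
    show "symbol K (A + C) z = symbol K A z + symbol K C z" if "z \<in> flags" for A C z
      by (rule symbol_add[OF fixed that])
    show "symbol K (cscale c A) z = c * symbol K A z" if "z \<in> flags" for c A z
      by (rule symbol_scale[OF fixed that])
    show "symbol K (conj_act \<rho> g A) z = symbol K A (flag_act (matrix_inv g) z)" if "g \<in> SU3" "z \<in> flags" for g A z
      using symbol_covariant[OF fixed that] by (simp add: SU3_matrix_inv that)
    show "symbol K (adj A) z = cnj (symbol K A z)" if z: "z \<in> flags" for A z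
    proof -
      obtain g where g: "g \<in> SU3" "z = flag_proj g"
        using z by (auto simp: flags_def)
      have h: "adj (conj_act \<rho> g K) = conj_act \<rho> g K"
        using K by (simp add: conj_act_eq g adj_mult matrix_mul_assoc)
      have "hs_inner A (conj_act \<rho> g K) = hs_inner (adj (conj_act \<rho> g K)) (adj A)"
        by (rule hs_inner_adj[symmetric])
      also have "\<dots> = cnj (hs_inner (adj A) (conj_act \<rho> g K))"
        unfolding h by (rule B.ip_cnj)
      finally show ?thesis
        by (simp add: g symbol_proj[OF fixed] trace_mult_hs)
    qed
    show "(\<integral>z. symbol K A z \<partial>\<mu>) = trace A / of_real (irrep_dim p)" for A
      using mean_trace[OF fixed, of A] K by (simp add: mean_def[OF fixed])
    show "inj (symbol K)"
    proof (rule injI)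
      fix A C assume eq: "symbol K A = symbol K C"
      have "trace ((A - C) ** conj_act \<rho> g K) = 0" if g: "g \<in> SU3" for g
        using fun_cong[OF eq, of "flag_proj g"] g
        by (simp add: symbol_proj[OF fixed] trace_mult_hs adj_diff B.ip_diff)
      then have "A - C = 0"
        using K unfolding injective_kernel_def by blast
      then show "A = C"
        by simp
    qed
  qed
  moreover have "operator_kernel \<rho> (symbol K) K"
    using fixed by (simp add: operator_kernel_def flag_act_base symbol_proj[OF fixed])
  ultimately show "K \<in> moduli_space p \<rho> \<mu>"
    by (auto simp: moduli_space_def)
qed

end

section \<open>Noncompact Stiefel manifolds\<close>

text \<open>The entries form a bare function, so columns can be appended and rows replaced without
  changing a matrix size.\<close>

definition colindep :: "nat \<Rightarrow> nat \<Rightarrow> (nat \<Rightarrow> nat \<Rightarrow> 'a::field) \<Rightarrow> bool" where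
  "colindep n k C \<longleftrightarrow> (\<forall>x. (\<forall>i<n. (\<Sum>j<k. C i j * x j) = 0) \<longrightarrow> (\<forall>j<k. x j = 0))"

lemma colindep_cong: "(\<And>i j. i < n \<Longrightarrow> j < k \<Longrightarrow> C i j = D i j) \<Longrightarrow> colindep n k C = colindep n k D"
  by (simp add: colindep_def)

lemma det_eq_0_iff_kernel:
  fixes f :: "nat \<Rightarrow> nat \<Rightarrow> 'a::field"
  shows "Determinant.det (Matrix.mat n n (\<lambda>(i, j). f i j)) = 0 \<longleftrightarrow> \<not> colindep n n f"
proof -
  let ?M = "Matrix.mat n n (\<lambda>(i, j). f i j)"
  have "Determinant.det ?M = 0 \<longleftrightarrow> (\<exists>v. v \<in> carrier_vec n \<and> v \<noteq> 0\<^sub>v n \<and> ?M *\<^sub>v v = 0\<^sub>v n)"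
    by (rule det_0_iff_vec_prod_zero) simp
  also have "\<dots> \<longleftrightarrow> \<not> colindep n n f"
  proof
    assume "\<exists>v. v \<in> carrier_vec n \<and> v \<noteq> 0\<^sub>v n \<and> ?M *\<^sub>v v = 0\<^sub>v n"
    then obtain v where v: "v \<in> carrier_vec n" "v \<noteq> 0\<^sub>v n" "?M *\<^sub>v v = 0\<^sub>v n" by blast
    have "(\<Sum>j<n. f i j * vec_index v j) = 0" if "i < n" for i
    proof -
      have "vec_index (?M *\<^sub>v v) i = 0"
        using v(3) that by simp
      then show ?thesis
        using v(1) that by (simp add: scalar_prod_def lessThan_atLeast0)
    qed
    moreover obtain j where "j < n" "vec_index v j \<noteq> 0"
      using v(1,2) by (metis carrier_vecD eq_vecI index_zero_vec(1) index_zero_vec(2))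
    ultimately show "\<not> colindep n n f"
      unfolding colindep_def by blast
  next
    assume "\<not> colindep n n f"
    then obtain x j where x: "\<forall>i<n. (\<Sum>j<n. f i j * x j) = 0" "j < n" "x j \<noteq> 0"
      by (auto simp: colindep_def)
    let ?v = "Matrix.vec n x"
    have "?M *\<^sub>v ?v = 0\<^sub>v n"
      using x(1) by (intro eq_vecI) (simp_all add: scalar_prod_def lessThan_atLeast0)
    moreover have "?v \<noteq> 0\<^sub>v n"
      using x(2,3) by (metis index_vec index_zero_vec(1))
    ultimately show "\<exists>v. v \<in> carrier_vec n \<and> v \<noteq> 0\<^sub>v n \<and> ?M *\<^sub>v v = 0\<^sub>v n"
      by (intro exI[of _ ?v]) simp
  qed
  finally show ?thesis .
qed

text \<open>Padding the system with zero equations makes it square with determinant zero.\<close>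

lemma underdetermined_system:
  fixes f :: "nat \<Rightarrow> nat \<Rightarrow> 'a::field"
  assumes "r < n" shows "\<not> colindep r n f"
proof -
  define f' where "f' i j = (if i < r then f i j else 0)" for i j
  \<comment> \<open>Row r of \<open>f'\<close> is zero, so the transpose annihilates the unit vector
    r; the determinant does not see the transposition.\<close>
  have "\<not> colindep n n (\<lambda>i j. f' j i)"
  proof
    assume *: "colindep n n (\<lambda>i j. f' j i)"
    have "(\<Sum>j<n. f' j i * (if j = r then 1 else 0)) = 0" for i
      by (intro sum.neutral) (auto simp: f'_def)
    from *[unfolded colindep_def, rule_format, OF this assms] show False
      by simp
  qed
  then have "Determinant.det (Matrix.mat n n (\<lambda>(i, j). f' j i)) = 0"
    by (simp add: det_eq_0_iff_kernel)
  moreover have "Matrix.mat n n (\<lambda>(i, j). f' j i) = transpose_mat (Matrix.mat n n (\<lambda>(i, j). f' i j))"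
    by (intro eq_matI) auto
  moreover have "Determinant.det (transpose_mat (Matrix.mat n n (\<lambda>(i, j). f' i j))) =
      Determinant.det (Matrix.mat n n (\<lambda>(i, j). f' i j))"
    by (rule det_transpose[of _ n]) simp
  ultimately have "\<not> colindep n n f'"
    by (simp only: det_eq_0_iff_kernel[symmetric])
  then obtain x j where x: "\<forall>i<n. (\<Sum>j<n. f' i j * x j) = 0" "j < n" "x j \<noteq> 0"
    by (auto simp: colindep_def)
  have "(\<Sum>j<n. f i j * x j) = 0" if "i < r" for i
    using x(1)[rule_format, of i] that assms by (simp add: f'_def)
  with x(2,3) show ?thesis
    unfolding colindep_def by blast
qed

lemma colindep_le: "colindep n k C \<Longrightarrow> k \<le> n"
  using underdetermined_system not_le by blast

text \<open>One column at a time: for k < n some nonzero y annihilates all present columns, and a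
  unit vector at a position where y is nonzero is not annihilated, so it can be appended.\<close>

lemma colindep_extend:
  fixes C :: "nat \<Rightarrow> nat \<Rightarrow> 'a::field"
  assumes "colindep n k C" "k \<le> n"
  shows "\<exists>G. (\<forall>i. \<forall>j<k. G i j = C i j) \<and> colindep n n G"
  using assms
proof (induction "n - k" arbitrary: k C)
  case 0
  then have "k = n"
    by simp
  with 0 show ?case
    by blast
next
  case (Suc d)
  then have kn: "k < n"
    by simp
  then obtain y i0 where y: "\<forall>j<k. (\<Sum>i<n. C i j * y i) = 0" "i0 < n" "y i0 \<noteq> 0"
    using underdetermined_system[of k n "\<lambda>j i. C i j"] by (auto simp: colindep_def)
  define C' where "C' i j = (if j = k then (if i = i0 then 1 else 0) else C i j)" for i j
  have "colindep n (Suc k) C'"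
    unfolding colindep_def
  proof (intro allI impI)
    fix x j assume x: "\<forall>i<n. (\<Sum>j<Suc k. C' i j * x j) = 0" and j: "j < Suc k"
    have eq: "(\<Sum>j<k. C i j * x j) + (if i = i0 then x k else 0) = 0" if "i < n" for i
    proof -
      have "(\<Sum>j<k. C' i j * x j) = (\<Sum>j<k. C i j * x j)"
        by (intro sum.cong) (auto simp: C'_def)
      then show ?thesis
        using x that by (auto simp: C'_def)
    qed
    have "0 = (\<Sum>i<n. y i * ((\<Sum>j<k. C i j * x j) + (if i = i0 then x k else 0)))"
      by (simp add: eq)
    also have "\<dots> = (\<Sum>i<n. \<Sum>j<k. y i * (C i j * x j)) + (\<Sum>i<n. if i = i0 then y i0 * x k else 0)"
      unfolding distrib_left sum.distrib sum_distrib_left by (intro arg_cong2[of _ _ _ _ "(+)"] sum.cong) auto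
    also have "(\<Sum>i<n. \<Sum>j<k. y i * (C i j * x j)) = (\<Sum>j<k. x j * (\<Sum>i<n. C i j * y i))"
      by (subst sum.swap) (simp add: sum_distrib_left mult_ac)
    also have "\<dots> = 0"
      using y(1) by simp
    finally have "x k = 0"
      using y(2,3) by simp
    then have "(\<Sum>j<k. C i j * x j) = 0" if "i < n" for i
      using eq[OF that] by (simp split: if_splits)
    then have "\<forall>j<k. x j = 0"
      using Suc.prems(1) by (simp add: colindep_def)
    then show "x j = 0"
      using j \<open>x k = 0\<close> by (auto simp: less_Suc_eq)
  qed
  then obtain G where "\<forall>i. \<forall>j<Suc k. G i j = C' i j" "colindep n n G"
    using Suc.hyps(1)[of "Suc k" C'] Suc.hyps(2) kn by (metis Suc_leI diff_Suc_Suc diff_Suc_1 Suc_diff_Suc)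
  moreover have "C' i j = C i j" if "j < k" for i j
    using that by (simp add: C'_def)
  ultimately show ?case
    by (metis less_SucI)
qed

section \<open>Invertible matrices, cosets and frames\<close>

lemma GL_iff:
  fixes A :: "'a::real_normed_field Matrix.mat"
  shows "A \<in> GL n \<longleftrightarrow> A \<in> carrier_mat n n \<and> Determinant.det A \<noteq> 0"
proof -
  have "invertible_mat A \<longleftrightarrow> Determinant.det A \<noteq> 0" if A: "A \<in> carrier_mat n n"
  proof
    assume "invertible_mat A"
    then obtain B where B: "A * B = 1\<^sub>m n" "B * A = 1\<^sub>m (dim_row B)"
      using A by (auto simp: invertible_mat_def inverts_mat_def)
    have "B \<in> carrier_mat n n"
      using arg_cong[OF B(1), of dim_col] arg_cong[OF B(2), of dim_col] A by auto
    then have "Determinant.det A * Determinant.det B = 1"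
      using det_mult[OF A] B(1) by (metis det_one)
    then show "Determinant.det A \<noteq> 0"
      by auto
  next
    assume "Determinant.det A \<noteq> 0"
    then have "A \<in> Units (ring_mat TYPE('a) n undefined)"
      by (rule det_non_zero_imp_unit[OF A])
    then show "invertible_mat A"
      using A by (auto simp: Units_def ring_mat_def invertible_mat_def inverts_mat_def)
  qed
  then show ?thesis
    by (auto simp: GL_def)
qed

lemma GL_iff_colindep:
  fixes A :: "'a::real_normed_field Matrix.mat"
  shows "A \<in> GL n \<longleftrightarrow> A \<in> carrier_mat n n \<and> colindep n n (\<lambda>i j. A $$ (i, j))"
proof -
  have "Matrix.mat n n (\<lambda>(i, j). A $$ (i, j)) = A" if "A \<in> carrier_mat n n"
    using that by (intro eq_matI) auto
  then show ?thesis
    using det_eq_0_iff_kernel[of n "\<lambda>i j. A $$ (i, j)"] by (auto simp: GL_iff)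
qed

lemma colindep_subset:
  assumes "colindep n l C" "k \<le> l" shows "colindep n k C"
  unfolding colindep_def
proof (intro allI impI)
  fix x j assume x: "\<forall>i<n. (\<Sum>j<k. C i j * x j) = 0" and j: "j < k"
  define x' where "x' j = (if j < k then x j else 0)" for j
  have "(\<Sum>j<l. C i j * x' j) = (\<Sum>j<k. C i j * x j)" for i
    by (rule sum.mono_neutral_cong_right) (use assms(2) in \<open>auto simp: x'_def\<close>)
  then have "\<forall>j<l. x' j = 0"
    using assms(1) x by (simp add: colindep_def)
  then show "x j = 0"
    using j assms(2) by (metis x'_def order_less_le_trans)
qed

definition frames :: "nat \<Rightarrow> nat \<Rightarrow> 'a::real_normed_field Matrix.mat set" where
  "frames n k = {C \<in> carrier_mat n k. colindep n k (\<lambda>i j. C $$ (i, j))}"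

definition first_cols :: "nat \<Rightarrow> nat \<Rightarrow> 'a Matrix.mat \<Rightarrow> 'a Matrix.mat" where
  "first_cols n k g = Matrix.mat n k (\<lambda>ij. g $$ ij)"

definition mat_coset :: "nat \<Rightarrow> nat \<Rightarrow> 'a::real_normed_field Matrix.mat \<Rightarrow> 'a Matrix.mat set" where
  "mat_coset n k C = {g \<in> GL n. \<forall>i<n. \<forall>j<k. g $$ (i, j) = C $$ (i, j)}"

lemma first_cols_frames: "k \<le> n \<Longrightarrow> g \<in> GL n \<Longrightarrow> first_cols n k g \<in> frames n k"
  using colindep_subset[of n n "\<lambda>i j. g $$ (i, j)" k]
  by (simp add: frames_def first_cols_def GL_iff_colindep colindep_def)

lemma frames_first_cols:
  assumes "C \<in> frames n k" obtains g where "g \<in> GL n" "first_cols n k g = C"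
proof -
  have C: "C \<in> carrier_mat n k" "colindep n k (\<lambda>i j. C $$ (i, j))"
    using assms by (auto simp: frames_def)
  have kn: "k \<le> n"
    using C(2) by (rule colindep_le)
  obtain G where G: "\<forall>i. \<forall>j<k. G i j = C $$ (i, j)" "colindep n n G"
    using colindep_extend[OF C(2) kn] by blast
  let ?g = "Matrix.mat n n (\<lambda>(i, j). G i j)"
  have "colindep n n (\<lambda>i j. ?g $$ (i, j)) = colindep n n G"
    by (rule colindep_cong) simp
  then have "?g \<in> GL n"
    using G(2) by (simp add: GL_iff_colindep)
  moreover have "first_cols n k ?g = C"
    using C(1) G(1) kn by (intro eq_matI) (auto simp: first_cols_def)
  ultimately show ?thesis
    by (rule that)
qed

text \<open>Right multiplication by h keeps the first k columns of g when h fixes the first k unit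
  vectors; conversely, if x shares these columns, the inverse of g times x is such an h. Cosets are
  thus frames.\<close>

lemma GL_fix_mult:
  fixes g :: "'a::real_normed_field Matrix.mat"
  assumes g: "g \<in> GL n" and k: "k \<le> n"
  shows "stiefel_proj n k g = mat_coset n k (first_cols n k g)"
proof -
  have gc: "g \<in> carrier_mat n n" and gd: "Determinant.det g \<noteq> 0"
    using g by (auto simp: GL_iff)
  obtain b where b: "g * b = 1\<^sub>m n" "b * g = 1\<^sub>m (dim_row b)"
    using g by (auto simp: GL_def invertible_mat_def inverts_mat_def)
  have bc: "b \<in> carrier_mat n n"
    using arg_cong[OF b(1), of dim_col] arg_cong[OF b(2), of dim_col] gc by auto
  have bg: "b * g = 1\<^sub>m n"
    using b(2) bc by simp
  have bd: "Determinant.det b \<noteq> 0"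
    using det_mult[OF bc gc] by (metis bg det_one mult_zero_left zero_neq_one)
  show ?thesis
  proof (intro Set.equalityI Set.subsetI)
    fix x assume "x \<in> stiefel_proj n k g"
    then obtain h where h: "h \<in> GL_fix n k" "x = g * h"
      by (auto simp: stiefel_proj_def)
    have hG: "h \<in> GL n" and hfix: "\<And>v. v \<in> carrier_vec n \<Longrightarrow> (\<forall>i. k \<le> i \<and> i < n \<longrightarrow> vec_index v i = 0) \<Longrightarrow> h *\<^sub>v v = v"
      using h(1) by (auto simp: GL_fix_def)
    have hc: "h \<in> carrier_mat n n" "Determinant.det h \<noteq> 0"
      using hG by (auto simp: GL_iff)
    have xG: "x \<in> GL n"
      using gc gd hc det_mult[OF gc hc(1)] by (simp add: GL_iff h(2))
    have "x $$ (i, j) = g $$ (i, j)" if ij: "i < n" "j < k" for i j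
    proof -
      have j: "j < n"
        using ij k by simp
      have "h *\<^sub>v unit_vec n j = unit_vec n j"
        using ij(2) by (intro hfix) auto
      then have "vec_index (h *\<^sub>v unit_vec n j) l = vec_index (unit_vec n j) l" for l
        by simp
      then have "h $$ (l, j) = vec_index (unit_vec n j) l" if "l < n" for l
        using that j hc(1) by (metis carrier_matD(1) carrier_matD(2) index_mult_mat_vec index_row(1) row_carrier
            scalar_prod_right_unit)
      then have "Matrix.col h j = unit_vec n j"
        using hc(1) j by (intro eq_vecI) auto
      then show ?thesis
        using ij(1) j gc hc(1) by (simp add: h(2) scalar_prod_right_unit)
    qed
    then show "x \<in> mat_coset n k (first_cols n k g)"
      using xG by (simp add: mat_coset_def first_cols_def)
  next
    fix x assume "x \<in> mat_coset n k (first_cols n k g)"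
    then have xG: "x \<in> GL n" and agree: "\<And>i j. i < n \<Longrightarrow> j < k \<Longrightarrow> x $$ (i, j) = g $$ (i, j)"
      by (auto simp: mat_coset_def first_cols_def)
    have xc: "x \<in> carrier_mat n n" "Determinant.det x \<noteq> 0"
      using xG by (auto simp: GL_iff)
    have "b * x \<in> GL_fix n k"
      unfolding GL_fix_def
    proof (intro CollectI conjI ballI impI)
      show "b * x \<in> GL n"
        using bc bd xc det_mult[OF bc xc(1)] by (simp add: GL_iff)
      fix v :: "'a Matrix.vec" assume v: "v \<in> carrier_vec n" "\<forall>i. k \<le> i \<and> i < n \<longrightarrow> vec_index v i = 0"
      have "x *\<^sub>v v = g *\<^sub>v v"
      proof (rule eq_vecI)
        fix i assume i: "i < dim_vec (g *\<^sub>v v)"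
        then have i: "i < n"
          using gc by simp
        have "x $$ (i, j) * vec_index v j = g $$ (i, j) * vec_index v j" if "j < n" for j
          using agree[OF i, of j] v(2) that by (cases "j < k") auto
        then have "(\<Sum>j=0..<n. x $$ (i, j) * vec_index v j) = (\<Sum>j=0..<n. g $$ (i, j) * vec_index v j)"
          by (intro sum.cong) auto
        then show "vec_index (x *\<^sub>v v) i = vec_index (g *\<^sub>v v) i"
          using i v(1) xc(1) gc by (simp add: scalar_prod_def)
      qed (use xc gc in simp)
      then have "b * x *\<^sub>v v = b * g *\<^sub>v v"
        using assoc_mult_mat_vec[OF bc xc(1) v(1)] assoc_mult_mat_vec[OF bc gc v(1)] by simp
      then show "b * x *\<^sub>v v = v"
        using v(1) by (simp add: bg)
    qed
    moreover have "x = g * (b * x)"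
      using assoc_mult_mat[OF gc bc xc(1)] xc(1) by (simp add: b(1))
    ultimately show "x \<in> stiefel_proj n k g"
      unfolding stiefel_proj_def by blast
  qed
qed

subsection \<open>Topology of frames\<close>

lemma topspace_mat_topology [simp]: "topspace (mat_topology n k) = carrier_mat n k"
  by (auto simp: mat_topology_def topspace_pullback_topology)

lemma continuous_map_entry:
  assumes "i < n" "j < k"
  shows "continuous_map (mat_topology n k) euclidean (\<lambda>A. A $$ (i, j))"
proof -
  let ?I = "{..<n} \<times> {..<k}"
  have "continuous_map (product_topology (\<lambda>_. euclidean) ?I) euclidean (\<lambda>f. f (i, j))"
    using assms by (intro continuous_map_product_projection) auto
  from continuous_map_pullback[OF this, of "carrier_mat n k" "\<lambda>A. restrict (\<lambda>ij. A $$ ij) ?I"]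
  have "continuous_map (mat_topology n k) euclidean ((\<lambda>f. f (i, j)) \<circ> (\<lambda>A. restrict (\<lambda>ij. A $$ ij) ?I))"
    by (simp add: mat_topology_def)
  then show ?thesis
    using assms by (simp add: o_def)
qed

lemma continuous_map_into_mat:
  assumes "\<And>x. x \<in> topspace X \<Longrightarrow> h x \<in> carrier_mat n k"
    and "\<And>i j. i < n \<Longrightarrow> j < k \<Longrightarrow> continuous_map X euclidean (\<lambda>x. h x $$ (i, j))"
  shows "continuous_map X (mat_topology n k) h"
  unfolding mat_topology_def
proof (rule continuous_map_pullback')
  show "continuous_map X (product_topology (\<lambda>_. euclidean) ({..<n} \<times> {..<k}))
      ((\<lambda>A. restrict (\<lambda>ij. A $$ ij) ({..<n} \<times> {..<k})) \<circ> h)"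
    unfolding continuous_map_componentwise using assms(2) by (auto simp: o_def)
  show "topspace X \<subseteq> h -` carrier_mat n k"
    using assms(1) by auto
qed

lemma continuous_map_times:
  fixes f g :: "'a \<Rightarrow> 'b::real_normed_field"
  shows "continuous_map X euclidean f \<Longrightarrow> continuous_map X euclidean g \<Longrightarrow> continuous_map X euclidean (\<lambda>x. f x * g x)"
  by (simp add: continuous_map_atin tendsto_mult)

lemma continuous_map_product_times:
  fixes f :: "'a \<Rightarrow> 'i \<Rightarrow> 'b::real_normed_field"
  assumes "finite I" "\<And>i. i \<in> I \<Longrightarrow> continuous_map X euclidean (\<lambda>x. f x i)"
  shows "continuous_map X euclidean (\<lambda>x. prod (f x) I)"
  using assms by (induction I rule: finite_induct) (simp_all add: continuous_map_times)

lemma openin_GL: "openin (mat_topology n n) (GL n :: 'a::real_normed_field Matrix.mat set)"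
proof -
  have "continuous_map (mat_topology n n) euclidean
      (\<lambda>A :: 'a Matrix.mat. \<Sum>p\<in>{p. p permutes {0..<n}}. signof p * (\<Prod>i=0..<n. A $$ (i, p i)))"
  proof (intro continuous_map_sum continuous_map_times continuous_map_product_times continuous_map_entry)
    show "finite {p. p permutes {0..<n}}"
      by (simp add: finite_permutations)
    show "p i < n" if "p \<in> {p. p permutes {0..<n}}" "i \<in> {0..<n}" for p i
      using that permutes_in_image[of p "{0..<n}" i] by auto
  qed auto
  then have "continuous_map (mat_topology n n) euclidean (\<lambda>A :: 'a Matrix.mat. Determinant.det A)"
    by (rule continuous_map_eq) (simp add: det_def')
  then have "openin (mat_topology n n) {A \<in> topspace (mat_topology n n). Determinant.det (A :: 'a Matrix.mat) \<in> - {0}}"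
    by (rule openin_continuous_map_preimage) auto
  moreover have "{A \<in> topspace (mat_topology n n). Determinant.det (A :: 'a Matrix.mat) \<in> - {0}} = GL n"
    by (auto simp: GL_iff)
  ultimately show ?thesis
    by simp
qed

lemma GL_carrier: "GL n \<subseteq> carrier_mat n n"
  by (auto simp: GL_def)

lemma quotient_map_first_cols:
  assumes k: "k \<le> n"
  shows "quotient_map (subtopology (mat_topology n n) (GL n))
     (subtopology (mat_topology n k) (frames n k)) (first_cols n k :: 'a::real_normed_field Matrix.mat \<Rightarrow> _)"
    (is "quotient_map ?X ?Y ?f")
proof (rule continuous_open_imp_quotient_map)
  have tX: "topspace ?X = GL n" and tY: "topspace ?Y = frames n k"
    using GL_carrier by (auto simp: frames_def)
  have "continuous_map ?X (mat_topology n k) ?f"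
    by (intro continuous_map_from_subtopology continuous_map_into_mat)
       (use k in \<open>auto simp: first_cols_def intro: continuous_map_entry\<close>)
  then show "continuous_map ?X ?Y ?f"
    unfolding continuous_map_in_subtopology tX using first_cols_frames[OF k] by blast
  show "?f ` topspace ?X = topspace ?Y"
    unfolding tX tY using first_cols_frames[OF k] frames_first_cols by blast
  show "open_map ?X ?Y ?f"
    unfolding open_map_def
  proof (intro allI impI)
    fix U :: "'a Matrix.mat set" assume U: "openin ?X U"
    have UG: "U \<subseteq> GL n"
      using openin_subset[OF U] tX by simp
    have U': "openin (mat_topology n n) U"
      using U openin_GL by (auto simp: openin_subtopology)
    show "openin ?Y (?f ` U)"
    proof (subst openin_subopen, intro ballI)
      fix C assume "C \<in> ?f ` U"
      then obtain g0 where g0: "g0 \<in> U" "C = ?f g0"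
        by blast
      \<comment> \<open>A continuous local section through g0: overwrite its first k columns by D.
        The preimage of U under it is a neighbourhood of C inside the image of U.\<close>
      define s where "s D = Matrix.mat n n (\<lambda>(i, j). if j < k then D $$ (i, j) else g0 $$ (i, j))" for D :: "'a Matrix.mat"
      have "continuous_map (mat_topology n k) (mat_topology n n) s"
      proof (rule continuous_map_into_mat)
        fix i j assume ij: "i < n" "j < n"
        show "continuous_map (mat_topology n k) euclidean (\<lambda>x. s x $$ (i, j))"
          by (cases "j < k") (use ij in \<open>simp_all add: s_def continuous_map_entry\<close>)
      qed (simp add: s_def)
      then have "openin (mat_topology n k) {D \<in> topspace (mat_topology n k). s D \<in> U}"
        using U' by (rule openin_continuous_map_preimage)
      then have o: "openin ?Y (frames n k \<inter> {D \<in> carrier_mat n k. s D \<in> U})"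
        by (auto simp: openin_subtopology_Int2)
      have fs: "?f (s D) = D" if "D \<in> carrier_mat n k" for D
        using that k by (intro eq_matI) (auto simp: first_cols_def s_def)
      have "g0 \<in> carrier_mat n n"
        using g0(1) UG GL_carrier by blast
      then have "s C = g0"
        by (intro eq_matI) (auto simp: first_cols_def s_def g0(2))
      then have "C \<in> frames n k \<inter> {D \<in> carrier_mat n k. s D \<in> U}"
        using g0 first_cols_frames[OF k] UG by (auto simp: frames_def)
      moreover have "frames n k \<inter> {D \<in> carrier_mat n k. s D \<in> U} \<subseteq> ?f ` U"
        using fs by force
      ultimately show "\<exists>T. openin ?Y T \<and> C \<in> T \<and> T \<subseteq> ?f ` U"
        using o by blast
    qed
  qed
qed

lemma topspace_stiefel:
  "topspace (stiefel n k :: 'a::real_normed_field Matrix.mat set topology) = stiefel_proj n k ` GL n"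
proof -
  have "topspace (subtopology (mat_topology n n) (GL n)) = (GL n :: 'a Matrix.mat set)"
    using GL_carrier by auto
  then show ?thesis
    using quotient_imp_surjective_map[OF quotient_map_quot_topology[of "subtopology (mat_topology n n) (GL n :: 'a Matrix.mat set)"
        "stiefel_proj n k"]]
    unfolding stiefel_def by simp
qed

text \<open>\<open>first_cols\<close> is a quotient map, so continuity can be tested on GL, where
  the composite is the projection onto cosets.\<close>

lemma continuous_mat_coset:
  assumes k: "k \<le> n"
  shows "continuous_map (subtopology (mat_topology n k) (frames n k)) (stiefel n k) (mat_coset n k)"
proof (rule continuous_compose_quotient_map[OF quotient_map_first_cols[OF k]])
  have "continuous_map (subtopology (mat_topology n n) (GL n)) (stiefel n k) (stiefel_proj n k)"
    unfolding stiefel_def using quotient_map_quot_topology by (rule quotient_imp_continuous_map)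
  then show "continuous_map (subtopology (mat_topology n n) (GL n)) (stiefel n k) (mat_coset n k \<circ> first_cols n k)"
    by (rule continuous_map_eq) (simp add: GL_fix_mult[OF _ k])
qed

text \<open>In the first k columns all members of a coset agree, so there the choice is
  harmless.\<close>

definition coset_entry :: "'a Matrix.mat set \<Rightarrow> nat \<Rightarrow> nat \<Rightarrow> 'a" where
  "coset_entry Q i j = (SOME g. g \<in> Q) $$ (i, j)"

lemma coset_entry_frame:
  assumes "C \<in> frames n k" "i < n" "j < k"
  shows "coset_entry (mat_coset n k C) i j = C $$ (i, j)"
proof -
  obtain g where g: "g \<in> GL n" "first_cols n k g = C"
    using assms(1) by (rule frames_first_cols)
  then have "g \<in> mat_coset n k C"
    by (auto simp: mat_coset_def first_cols_def)
  then have "(SOME g. g \<in> mat_coset n k C) \<in> mat_coset n k C"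
    by (rule someI)
  then show ?thesis
    using assms(2,3) by (simp add: coset_entry_def mat_coset_def)
qed

lemma continuous_coset_entry:
  assumes k: "k \<le> n" and ij: "i < n" "j < k"
  shows "continuous_map (stiefel n k) euclidean (\<lambda>Q :: 'a::real_normed_field Matrix.mat set. coset_entry Q i j)"
  unfolding stiefel_def
proof (rule continuous_compose_quotient_map[OF quotient_map_quot_topology])
  have j: "j < n"
    using ij k by simp
  have "continuous_map (subtopology (mat_topology n n) (GL n)) euclidean (\<lambda>g :: 'a Matrix.mat. g $$ (i, j))"
    by (intro continuous_map_from_subtopology continuous_map_entry ij(1) j)
  then show "continuous_map (subtopology (mat_topology n n) (GL n)) euclidean
      ((\<lambda>Q :: 'a Matrix.mat set. coset_entry Q i j) \<circ> stiefel_proj n k)"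
  proof (rule continuous_map_eq)
    fix g :: "'a Matrix.mat" assume "g \<in> topspace (subtopology (mat_topology n n) (GL n))"
    then have g: "g \<in> GL n"
      by simp
    have "coset_entry (stiefel_proj n k g) i j = first_cols n k g $$ (i, j)"
      unfolding GL_fix_mult[OF g k] by (rule coset_entry_frame[OF first_cols_frames[OF k g] ij])
    then show "g $$ (i, j) = ((\<lambda>Q :: 'a Matrix.mat set. coset_entry Q i j) \<circ> stiefel_proj n k) g"
      using ij by (simp add: first_cols_def)
  qed
qed

lemma stiefel_elem:
  assumes k: "k \<le> n" and Q: "Q \<in> topspace (stiefel n k :: 'a::real_normed_field Matrix.mat set topology)"
  defines "C \<equiv> Matrix.mat n k (\<lambda>(i, j). coset_entry Q i j)"
  shows "C \<in> frames n k" "Q = mat_coset n k C"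
proof -
  obtain g where g: "g \<in> GL n" "Q = stiefel_proj n k g"
    using Q by (auto simp: topspace_stiefel)
  have Q': "Q = mat_coset n k (first_cols n k g)"
    using g GL_fix_mult[OF g(1) k] by simp
  have "C = first_cols n k g"
    using coset_entry_frame[OF first_cols_frames[OF k g(1)]]
    by (intro eq_matI) (simp_all add: C_def Q', simp_all add: first_cols_def)
  then show "C \<in> frames n k" "Q = mat_coset n k C"
    using first_cols_frames[OF k g(1)] Q' by simp_all
qed

section \<open>Independence over the reals and under conjugation\<close>

lemma colindepD:
  assumes "colindep n k C" "\<And>i. i < n \<Longrightarrow> (\<Sum>j<k. C i j * x j) = 0" "j < k"
  shows "x j = 0"
  using assms(1)[unfolded colindep_def, rule_format, OF assms(2) assms(3)] .

text \<open>A complex relation between real columns splits into its real and imaginary parts. This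
  links the real frames of the types (a, a) with independence over the complex numbers.\<close>

lemma colindep_complex_of_real:
  "colindep n k (\<lambda>i j. complex_of_real (R i j)) \<longleftrightarrow> colindep n k R"
proof
  assume *: "colindep n k (\<lambda>i j. complex_of_real (R i j))"
  show "colindep n k R"
    unfolding colindep_def
  proof (intro allI impI)
    fix x j assume x: "\<forall>i<n. (\<Sum>j<k. R i j * x j) = 0" and j: "j < k"
    have eq: "(\<Sum>j<k. complex_of_real (R i j) * complex_of_real (x j)) = of_real (\<Sum>j<k. R i j * x j)" for i
      by simp
    have "(\<Sum>j<k. complex_of_real (R i j) * complex_of_real (x j)) = 0" if "i < n" for i
      using eq[of i] x[rule_format, OF that] by (simp only: of_real_0)
    from colindepD[OF * this j] have "complex_of_real (x j) = 0" .
    then show "x j = 0"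
      by simp
  qed
next
  assume *: "colindep n k R"
  show "colindep n k (\<lambda>i j. complex_of_real (R i j))"
    unfolding colindep_def
  proof (intro allI impI)
    fix x j assume x: "\<forall>i<n. (\<Sum>j<k. complex_of_real (R i j) * x j) = 0" and j: "j < k"
    have ri: "(\<Sum>j<k. R i j * Re (x j)) = 0" "(\<Sum>j<k. R i j * Im (x j)) = 0" if "i < n" for i
      using arg_cong[OF x[rule_format, OF that], of Re] arg_cong[OF x[rule_format, OF that], of Im] by simp_all
    have "Re (x j) = 0"
      by (rule colindepD[OF * _ j]) (rule ri(1))
    moreover have "Im (x j) = 0"
      by (rule colindepD[OF * _ j]) (rule ri(2))
    ultimately show "x j = 0"
      by (simp add: complex_eq_iff)
  qed
qed

lemma colindep_cnj:
  assumes "colindep n k C" shows "colindep n k (\<lambda>i j. cnj (C i j))"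
  unfolding colindep_def
proof (intro allI impI)
  fix x j assume x: "\<forall>i<n. (\<Sum>j<k. cnj (C i j) * x j) = 0" and j: "j < k"
  have "(\<Sum>j<k. C i j * cnj (x j)) = 0" if "i < n" for i
    using arg_cong[OF x[rule_format, OF that], of cnj] by simp
  from colindepD[OF assms this j] have "cnj (x j) = 0" .
  then show "x j = 0"
    by simp
qed

lemma irrep_dim_swap: "irrep_dim (prod.swap a) = irrep_dim a"
  by (simp add: irrep_dim_def algebra_simps)

lemma zero_mult_swap: "zero_mult (prod.swap a) = zero_mult a"
  by (simp add: zero_mult_def min.commute)

context su3_symbols
begin

section \<open>Characteristic matrices\<close>

definition nrm :: "nat \<times> nat \<Rightarrow> real" where
  "nrm a = sqrt (irrep_dim a / irrep_dim p)"

lemma nrm_pos: "0 < nrm a"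
  using irrep_dim_pos[of a] irrep_dim_pos[of p] by (simp add: nrm_def)

lemma nrm_swap: "nrm (prod.swap a) = nrm a"
  by (simp add: nrm_def irrep_dim_swap)

definition Ksum :: "(nat \<times> nat \<Rightarrow> nat \<Rightarrow> nat \<Rightarrow> complex) \<Rightarrow> complex^'n^'n" where
  "Ksum c = cscale (of_real (1 / irrep_dim p)) (mat 1) +
     (\<Sum>a | a \<noteq> (0, 0) \<and> 0 < m a. \<Sum>\<sigma>=1..m a. \<Sum>\<gamma>=1..zero_mult a.
        cscale (cnj (c a \<sigma> \<gamma>) * of_real (nrm a)) (E a \<sigma> (zlab a \<gamma>)))"

lemma char_coeffs_Ksum: "char_coeffs p m e K = (SOME c. K = Ksum c)"
  by (simp add: char_coeffs_def Ksum_def nrm_def E_def zlab_def)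

lemma finite_types: "finite {a. a \<noteq> (0, 0) \<and> 0 < m a}"
  by (rule finite_subset[OF _ finite_multiplicity]) auto

lemma zlab_in': "0 < m a \<Longrightarrow> \<gamma> \<in> {1..zero_mult a} \<Longrightarrow> zlab a \<gamma> \<in> gt_labels a"
  using zlab_in multiplicity_bounds(1) by blast

lemma hs_trivial: "hs_inner (E (0, 0) 1 ((0, 0, 0), 0)) A = of_real (1 / sqrt (irrep_dim p)) * trace A"
  unfolding E_trivial B.ip_scale_left by (simp add: hs_inner_def)

lemma hs_scalar:
  assumes "\<tau> \<in> {1..m b}" "l \<in> gt_labels b" "b \<noteq> (0, 0)"
  shows "hs_inner (E b \<tau> l) (cscale c (mat 1)) = 0"
proof -
  have "hs_inner (E (0, 0) 1 ((0, 0, 0), 0)) (E b \<tau> l) = 0"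
    using E_ortho[of 1 "(0, 0)" "((0, 0, 0), 0)" \<tau> b l] assms by (simp add: trivial_multiplicity label_00)
  then have "trace (E b \<tau> l) = 0"
    using irrep_dim_pos[of p] unfolding hs_trivial by simp
  then have "hs_inner (mat 1) (E b \<tau> l) = 0"
    by (simp add: hs_inner_def)
  then have "hs_inner (E b \<tau> l) (mat 1) = 0"
    using B.ip_cnj[of "E b \<tau> l" "mat 1"] by simp
  then show ?thesis
    by (simp add: B.ip_scale_right)
qed

lemma hs_Ksum:
  assumes \<tau>: "\<tau> \<in> {1..m b}" and l: "l \<in> gt_labels b"
  shows "hs_inner (E b \<tau> l) (Ksum c) = hs_inner (E b \<tau> l) (cscale (of_real (1 / irrep_dim p)) (mat 1)) +
     (if b = (0, 0) then 0 else \<Sum>\<gamma>=1..zero_mult b. if l = zlab b \<gamma> then cnj (c b \<tau> \<gamma>) * of_real (nrm b) else 0)"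
proof -
  define h where "h a \<sigma> \<gamma> = cnj (c a \<sigma> \<gamma>) * of_real (nrm a) * hs_inner (E b \<tau> l) (E a \<sigma> (zlab a \<gamma>))" for a \<sigma> \<gamma>
  have h: "h a \<sigma> \<gamma> = (if (b, \<tau>, l) = (a, \<sigma>, zlab a \<gamma>) then cnj (c a \<sigma> \<gamma>) * of_real (nrm a) else 0)"
    if "0 < m a" "\<sigma> \<in> {1..m a}" "\<gamma> \<in> {1..zero_mult a}" for a \<sigma> \<gamma>
    unfolding h_def E_ortho[OF \<tau> l that(2) zlab_in'[OF that(1,3)]] by simp
  have b: "0 < m b"
    using \<tau> by simp
  let ?S = "{a. a \<noteq> (0, 0) \<and> 0 < m a}"
  have "(\<Sum>a\<in>?S. \<Sum>\<sigma>=1..m a. \<Sum>\<gamma>=1..zero_mult a. h a \<sigma> \<gamma>) =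
      (\<Sum>a\<in>?S. if a = b then \<Sum>\<sigma>=1..m b. \<Sum>\<gamma>=1..zero_mult b. h b \<sigma> \<gamma> else 0)"
    by (intro sum.cong refl) (auto simp: h intro!: sum.neutral)
  also have "\<dots> = (if b = (0, 0) then 0 else \<Sum>\<sigma>=1..m b. \<Sum>\<gamma>=1..zero_mult b. h b \<sigma> \<gamma>)"
    using finite_types b by (simp add: sum.delta)
  also have "(\<Sum>\<sigma>=1..m b. \<Sum>\<gamma>=1..zero_mult b. h b \<sigma> \<gamma>) =
      (\<Sum>\<sigma>=1..m b. if \<sigma> = \<tau> then \<Sum>\<gamma>=1..zero_mult b. h b \<tau> \<gamma> else 0)"
    using b by (intro sum.cong refl) (auto simp: h intro!: sum.neutral)
  also have "\<dots> = (\<Sum>\<gamma>=1..zero_mult b. h b \<tau> \<gamma>)"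
    using \<tau> by (simp add: sum.delta)
  also have "\<dots> = (\<Sum>\<gamma>=1..zero_mult b. if l = zlab b \<gamma> then cnj (c b \<tau> \<gamma>) * of_real (nrm b) else 0)"
    using \<tau> b by (intro sum.cong refl) (auto simp: h)
  finally show ?thesis
    by (simp add: Ksum_def B.ip_add_right B.ip_sum_right B.ip_scale_right h_def)
qed

lemma kc_Ksum:
  assumes "b \<noteq> (0, 0)" "\<tau> \<in> {1..m b}" "\<gamma> \<in> {1..zero_mult b}"
  shows "kc (Ksum c) b \<tau> \<gamma> = cnj (c b \<tau> \<gamma>) * of_real (nrm b)"
proof -
  have "0 < m b"
    using assms(2) by simp
  note l = zlab_in'[OF this assms(3)]
  have "(\<Sum>\<gamma>'=1..zero_mult b. if zlab b \<gamma> = zlab b \<gamma>' then cnj (c b \<tau> \<gamma>') * of_real (nrm b) else 0) =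
      cnj (c b \<tau> \<gamma>) * of_real (nrm b)"
    using assms(3) by (simp add: zlab_inj sum.delta')
  then show ?thesis
    unfolding kc_def hs_Ksum[OF assms(2) l] using hs_scalar[OF assms(2) l assms(1)] assms(1) by simp
qed

text \<open>The choice in \<open>char_coeffs\<close> is free off the indices of the sum; on them
  orthonormality determines it.\<close>

lemma char_coeffs_eq:
  assumes "K = Ksum c" "b \<noteq> (0, 0)" "\<tau> \<in> {1..m b}" "\<gamma> \<in> {1..zero_mult b}"
  shows "char_coeffs p m e K b \<tau> \<gamma> = c b \<tau> \<gamma>"
proof -
  have "K = Ksum (char_coeffs p m e K)"
    unfolding char_coeffs_Ksum using assms(1) by (rule someI[where P = "\<lambda>c. K = Ksum c"])
  then have "cnj (char_coeffs p m e K b \<tau> \<gamma>) * of_real (nrm b) = cnj (c b \<tau> \<gamma>) * of_real (nrm b)"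
    using kc_Ksum[OF assms(2-4)] assms(1) by metis
  then show ?thesis
    using nrm_pos[of b] by simp
qed

lemma trace_scalar: "trace (cscale (of_real (1 / irrep_dim p)) (mat 1) :: complex^'n^'n) = 1"
  using irrep_dim_pos[of p] by (simp add: trace_def mat_nth irrep_dim_eq)

lemma kernel_expansion:
  assumes fixed: "\<And>t. t \<in> torus \<Longrightarrow> conj_act \<rho> t K = K" and tr: "trace K = 1"
  shows "K = Ksum (\<lambda>a \<sigma> \<gamma>. cnj (kc K a \<sigma> \<gamma>) / of_real (nrm a))" (is "K = Ksum ?c")
proof (rule operator_eqI)
  fix b \<tau> l assume *: "\<tau> \<in> {1..m b}" "l \<in> gt_labels b"
  show "hs_inner (E b \<tau> l) K = hs_inner (E b \<tau> l) (Ksum ?c)"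
  proof (cases "b = (0, 0)")
    case True
    then have z: "\<tau> = 1" "l = ((0, 0, 0), 0)"
      using * by (simp_all add: trivial_multiplicity label_00)
    show ?thesis
      unfolding hs_Ksum[OF *] unfolding True z hs_trivial trace_scalar tr by simp
  next
    case False
    show ?thesis
    proof (cases "\<exists>\<gamma>\<in>{1..zero_mult b}. l = zlab b \<gamma>")
      case True
      then obtain \<gamma> where \<gamma>: "\<gamma> \<in> {1..zero_mult b}" "l = zlab b \<gamma>"
        by blast
      have "kc (Ksum ?c) b \<tau> \<gamma> = kc K b \<tau> \<gamma>"
        using kc_Ksum[OF False *(1) \<gamma>(1)] nrm_pos[of b] by simp
      then show ?thesis
        by (simp add: kc_def \<gamma>(2))
    next
      case none: False
      then have "hs_inner (E b \<tau> l) K = 0"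
        using torus_fixed_component[OF fixed *] by blast
      moreover have "(\<Sum>\<gamma>=1..zero_mult b. if l = zlab b \<gamma> then cnj (?c b \<tau> \<gamma>) * of_real (nrm b) else 0) = 0"
        using none by (intro sum.neutral) auto
      ultimately show ?thesis
        unfolding hs_Ksum[OF *] hs_scalar[OF * False] using False by simp
    qed
  qed
qed

text \<open>Entries of the characteristic matrix as inner products, without the choice in
  \<open>char_coeffs\<close>; in this form their continuity in K is evident.\<close>

definition ch :: "complex^'n^'n \<Rightarrow> nat \<times> nat \<Rightarrow> nat \<Rightarrow> nat \<Rightarrow> complex" where
  "ch K a i j = cnj (kc K a (Suc j) (Suc i)) / of_real (nrm a)"

lemma ch_Ksum:
  assumes "a \<noteq> (0, 0)" "i < zero_mult a" "j < m a"
  shows "ch (Ksum c) a i j = c a (Suc j) (Suc i)"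
  using kc_Ksum[of a "Suc j" "Suc i" c] assms nrm_pos[of a] by (simp add: ch_def)

lemma char_matrix_eq:
  assumes "\<And>t. t \<in> torus \<Longrightarrow> conj_act \<rho> t K = K" "trace K = 1" "a \<noteq> (0, 0)" "i < zero_mult a" "j < m a"
  shows "char_matrix p m e K a $$ (i, j) = ch K a i j"
  using char_coeffs_eq[OF kernel_expansion[OF assms(1,2)] assms(3), of "Suc j" "Suc i"] assms(3-5)
  by (simp add: char_matrix_def ch_def)

lemma independent_columns_iff: "independent_columns K a \<longleftrightarrow> colindep (zero_mult a) (m a) (ch K a)"
proof -
  have S: "(\<Sum>\<sigma>\<in>{1..m a}. cnj (x \<sigma>) * kc K a \<sigma> (Suc i)) =
      of_real (nrm a) * cnj (\<Sum>j<m a. ch K a i j * x (Suc j))" for x i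
    using nrm_pos[of a] by (simp add: sum.atLeast1_atMost_eq ch_def sum_distrib_left mult_ac)
  have ball: "(\<forall>\<gamma>\<in>{1..N}. P \<gamma>) \<longleftrightarrow> (\<forall>i<N. P (Suc i))" for N :: nat and P
  proof (intro iffI allI ballI impI)
    fix \<gamma> assume "\<forall>i<N. P (Suc i)" "\<gamma> \<in> {1..N}"
    then show "P \<gamma>"
      by (cases \<gamma>) auto
  qed simp
  have nz: "of_real (nrm a) * cnj y = 0 \<longleftrightarrow> y = 0" for y
    using nrm_pos[of a] by simp
  have z: "(\<forall>\<gamma>\<in>{1..zero_mult a}. (\<Sum>\<sigma>\<in>{1..m a}. cnj (x \<sigma>) * kc K a \<sigma> \<gamma>) = 0) \<longleftrightarrow>
      (\<forall>i<zero_mult a. (\<Sum>j<m a. ch K a i j * x (Suc j)) = 0)" for x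
    unfolding ball S nz by (rule refl)
  show ?thesis
    unfolding independent_columns_def z unfolding ball colindep_def
  proof (intro iffI allI impI)
    fix x j
    assume *: "\<forall>x. (\<forall>i<zero_mult a. (\<Sum>j<m a. ch K a i j * x (Suc j)) = 0) \<longrightarrow> (\<forall>i<m a. x (Suc i) = 0)"
      and x: "\<forall>i<zero_mult a. (\<Sum>j<m a. ch K a i j * x j) = 0" and j: "j < m a"
    show "x j = 0"
      using *[rule_format, of "\<lambda>\<sigma>. x (\<sigma> - 1)" j] x j by simp
  next
    fix x i
    assume *: "\<forall>x. (\<forall>i<zero_mult a. (\<Sum>j<m a. ch K a i j * x j) = 0) \<longrightarrow> (\<forall>j<m a. x j = 0)"
      and x: "\<forall>i<zero_mult a. (\<Sum>j<m a. ch K a i j * x (Suc j)) = 0" and i: "i < m a"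
    show "x (Suc i) = 0"
      using *[rule_format, of "\<lambda>j. x (Suc j)" i] x i by simp
  qed
qed

lemma moduli_space_frames:
  "K \<in> moduli_space p \<rho> \<mu> \<longleftrightarrow> (\<forall>t\<in>torus. conj_act \<rho> t K = K) \<and> adj K = K \<and> trace K = 1 \<and>
     (\<forall>a. 0 < m a \<longrightarrow> colindep (zero_mult a) (m a) (ch K a))"
  unfolding moduli_space_iff independent_columns_iff[symmetric]
  using independent_imp_injective injective_imp_independent by blast

lemma ch_swap:
  assumes "adj K = K" "i < zero_mult a" "j < m a"
  shows "ch K (prod.swap a) i j = cnj (ch K a i j)"
proof -
  have "kc K (prod.swap a) (Suc j) (Suc i) = hs_inner (adj (E a (Suc j) (zlab a (Suc i)))) (adj K)"
    using assms by (simp add: kc_def E_adj_zlab)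
  also have "\<dots> = cnj (kc K a (Suc j) (Suc i))"
    unfolding hs_inner_adj kc_def by (rule B.ip_cnj)
  finally show ?thesis
    by (simp add: ch_def nrm_swap)
qed

text \<open>The projection onto a highest weight vector is an operator kernel; hence there are no more
  copies of a representation than its weight zero space allows.\<close>

lemma moduli_space_nonempty: "moduli_space p \<rho> \<mu> \<noteq> {}"
proof -
  obtain v where v: "H.hw p v"
    using rho_irrep by (auto simp: is_irrep_def H.hw_eq)
  define w where "w = (1 / norm v) *\<^sub>R v"
  have nv: "0 < norm v"
    using v by (simp add: H.hw_def)
  have ws: "w = of_real (1 / norm v) *s v"
    unfolding w_def by (rule H.s_real[symmetric])
  have w: "H.hw p w"
    using v nv unfolding ws H.hw_def
    by (auto simp: H.sl_scale good_Eij mult.commute)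
  have ww: "vip w w = 1"
  proof -
    have "Re (vip w w) = 1"
      using nv by (simp add: H.ip_Re w_def dot_square_norm power2_eq_square)
    moreover have "Im (vip w w) = 0"
      using H.ip_cnj[of w w] by (simp add: complex_eq_iff)
    ultimately show ?thesis
      by (simp add: complex_eq_iff)
  qed
  have r1: "rank1 w *v x = vip w x *s w" for x
    by (simp add: veq rank1_def matrix_vector_mult_def vip_def sum_distrib_right sum_distrib_left mult_ac)
  have "B.T3 (rank1 w) = 0" "B.U3 (rank1 w) = 0"
  proof -
    \<comment> \<open>The vector w is an eigenvector with real eigenvalue t of a self-adjoint
      operator, so both terms of the commutator equal t times \<open>rank1 w\<close>.\<close>
    have *: "B.sl Z (rank1 w) = 0"
      if Z: "good Z" and ev: "H.sl Z w = of_real t *s w" and sa: "\<And>x y. vip (H.sl Z x) y = vip x (H.sl Z y)" for Z t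
    proof (rule matrix_eq_vec)
      fix x
      have "vip w (H.sl Z x) = of_real t * vip w x"
        using sa[of w x] by (simp add: ev H.ip_scale_left)
      then show "B.sl Z (rank1 w) *v x = 0 *v x"
        by (simp add: sl_commutator[OF Z] r1 H.sl_scale[OF Z] ev matvec.zero_left mult.commute)
    qed
    show "B.T3 (rank1 w) = 0" "B.U3 (rank1 w) = 0"
      using w *[OF good_Eij(5) _ H.ladder_adj(5)] *[OF good_Eij(6) _ H.ladder_adj(6)]
      unfolding H.hw_def by blast+
  qed
  then have "\<forall>t\<in>torus. conj_act \<rho> t (rank1 w) = rank1 w"
    using B.torus_fixed_iff by blast
  moreover have "adj (rank1 w) = rank1 w"
    by (simp add: veq rank1_def mult.commute)
  moreover have "trace (rank1 w) = 1"
    using ww by (simp add: trace_def rank1_def vip_def mult.commute)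
  moreover have "injective_kernel (rank1 w)"
    unfolding injective_kernel_def using rank1_injective[OF w] by blast
  ultimately show ?thesis
    using moduli_space_iff[of "rank1 w"] by blast
qed

lemma multiplicity_le: "m a \<le> zero_mult a"
proof (cases "0 < m a")
  case True
  then show ?thesis
    using moduli_space_nonempty moduli_space_frames colindep_le by blast
qed simp

lemma Ksum_fixed: "t \<in> torus \<Longrightarrow> conj_act \<rho> t (Ksum c) = Ksum c"
proof -
  have "B.T3 (E a \<sigma> (zlab a \<gamma>)) = 0" "B.U3 (E a \<sigma> (zlab a \<gamma>)) = 0"
    if "0 < m a" "\<sigma> \<in> {1..m a}" "\<gamma> \<in> {1..zero_mult a}" for a \<sigma> \<gamma>
    using E_weights[OF that(2) zlab_in'[OF that(1,3)]] zlab_weight[OF multiplicity_bounds(1)[OF that(1)] that(3)]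
    by simp_all
  then have "B.T3 (Ksum c) = 0" "B.U3 (Ksum c) = 0"
    unfolding Ksum_def
    by (simp_all add: B.sl_add B.sl_sum B.sl_scale good_Eij sl_one)
  then show "t \<in> torus \<Longrightarrow> conj_act \<rho> t (Ksum c) = Ksum c"
    using B.torus_fixed_iff by blast
qed

lemma adj_sum: "adj (sum f A) = (\<Sum>i\<in>A. adj (f i))" for f :: "'b \<Rightarrow> complex^'n^'n"
  by (rule linear_sum[OF linear_adj])

text \<open>Taking adjoints permutes the summands by duality of types, under which multiplicities,
  weight zero spaces and normalizing factors are symmetric.\<close>

lemma Ksum_adj:
  assumes c: "\<And>a \<sigma> \<gamma>. 0 < m a \<Longrightarrow> \<sigma> \<in> {1..m a} \<Longrightarrow> \<gamma> \<in> {1..zero_mult a} \<Longrightarrow> c (prod.swap a) \<sigma> \<gamma> = cnj (c a \<sigma> \<gamma>)"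
  shows "adj (Ksum c) = Ksum c"
proof -
  let ?S = "{a. a \<noteq> (0, 0) \<and> 0 < m a}"
  let ?g = "\<lambda>a. \<Sum>\<sigma>=1..m a. \<Sum>\<gamma>=1..zero_mult a. cscale (cnj (c a \<sigma> \<gamma>) * of_real (nrm a)) (E a \<sigma> (zlab a \<gamma>))"
  have "adj (?g a) = ?g (prod.swap a)" if "0 < m a" for a
    unfolding adj_sum multiplicity_swap zero_mult_swap nrm_swap
    by (intro sum.cong refl) (simp add: adj_cscale E_adj_zlab c that)
  then have "(\<Sum>a\<in>?S. adj (?g a)) = (\<Sum>a\<in>?S. ?g (prod.swap a))"
    by (intro sum.cong refl) auto
  also have "\<dots> = (\<Sum>a\<in>?S. ?g a)"
    by (rule sum.reindex_bij_witness[of _ prod.swap prod.swap]) (auto simp: multiplicity_swap prod_eq_iff)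
  finally have "adj (\<Sum>a\<in>?S. ?g a) = (\<Sum>a\<in>?S. ?g a)"
    by (simp only: adj_sum)
  then show ?thesis
    by (simp add: Ksum_def adj_add adj_cscale)
qed

lemma Ksum_trace: "trace (Ksum c) = 1"
proof -
  have "hs_inner (E (0, 0) 1 ((0, 0, 0), 0)) (Ksum c) =
      hs_inner (E (0, 0) 1 ((0, 0, 0), 0)) (cscale (of_real (1 / irrep_dim p)) (mat 1))"
    using hs_Ksum[of 1 "(0, 0)" "((0, 0, 0), 0)" c] by (simp add: trivial_multiplicity label_00)
  then show ?thesis
    unfolding hs_trivial trace_scalar using irrep_dim_pos[of p] by simp
qed

lemma Ksum_cong:
  assumes "\<And>a \<sigma> \<gamma>. a \<noteq> (0, 0) \<Longrightarrow> 0 < m a \<Longrightarrow> \<sigma> \<in> {1..m a} \<Longrightarrow> \<gamma> \<in> {1..zero_mult a} \<Longrightarrow> c a \<sigma> \<gamma> = d a \<sigma> \<gamma>"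
  shows "Ksum c = Ksum d"
  unfolding Ksum_def by (intro arg_cong2[of _ _ _ _ "(+)"] sum.cong refl) (simp add: assms)

text \<open>\<open>moduli_space_frames\<close> also ranges over (0, 0), which has no factor in the
  product; there trace 1 makes the single entry nonzero.\<close>

lemma colindep_trivial:
  assumes "trace K = 1" shows "colindep (zero_mult (0, 0)) (m (0, 0)) (ch K (0, 0))"
proof -
  have "zlab (0, 0) 1 = ((0, 0, 0), 0)"
    by (simp add: zlab_def zero_label_def zero_J_def)
  then have "kc K (0, 0) 1 1 = of_real (1 / sqrt (irrep_dim p))"
    unfolding kc_def using hs_trivial[of K] assms by simp
  then have "ch K (0, 0) 0 0 \<noteq> 0"
    using nrm_pos[of "(0, 0)"] irrep_dim_pos[of p] by (simp add: ch_def)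
  then show ?thesis
    by (simp add: colindep_def zero_mult_def trivial_multiplicity)
qed

section \<open>The homeomorphism\<close>

abbreviation diag_types :: "nat set" where
  "diag_types \<equiv> {1..fst p + snd p}"

abbreviation upper_types :: "(nat \<times> nat) set" where
  "upper_types \<equiv> {(a, b). a < b \<and> 0 < m (a, b)}"

abbreviation target :: "((nat \<Rightarrow> real Matrix.mat set) \<times> (nat \<times> nat \<Rightarrow> complex Matrix.mat set)) topology" where
  "target \<equiv> prod_topology
      (product_topology (\<lambda>a. stiefel (a + 1) (m (a, a)) :: real Matrix.mat set topology) diag_types)
      (product_topology (\<lambda>(a, b). stiefel (a + 1) (m (a, b)) :: complex Matrix.mat set topology) upper_types)"

section \<open>Frames of a kernel and the map into the product\<close>

definition diag_frame :: "complex^'n^'n \<Rightarrow> nat \<Rightarrow> real Matrix.mat" where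
  "diag_frame K a = Matrix.mat (a + 1) (m (a, a)) (\<lambda>(i, j). Re (ch K (a, a) i j))"

definition upper_frame :: "complex^'n^'n \<Rightarrow> nat \<times> nat \<Rightarrow> complex Matrix.mat" where
  "upper_frame K a = Matrix.mat (fst a + 1) (m a) (\<lambda>(i, j). ch K a i j)"

lemma zero_mult_le: "a \<le> b \<Longrightarrow> zero_mult (a, b) = a + 1"
  by (simp add: zero_mult_def)

lemma ch_diag_real:
  assumes "adj K = K" "i < a + 1" "j < m (a, a)"
  shows "ch K (a, a) i j = of_real (Re (ch K (a, a) i j))"
  using ch_swap[of K i "(a, a)" j] assms by (simp add: zero_mult_le complex_eq_iff)

lemma diag_frame_in:
  assumes "K \<in> moduli_space p \<rho> \<mu>" shows "diag_frame K a \<in> frames (a + 1) (m (a, a))"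
proof -
  have K: "adj K = K" "0 < m (a, a) \<Longrightarrow> colindep (zero_mult (a, a)) (m (a, a)) (ch K (a, a))"
    using assms by (auto simp: moduli_space_frames)
  have "colindep (a + 1) (m (a, a)) (\<lambda>i j. Re (ch K (a, a) i j))"
  proof (cases "0 < m (a, a)")
    case True
    then have "colindep (a + 1) (m (a, a)) (ch K (a, a))"
      using K(2) by (simp add: zero_mult_le)
    then have "colindep (a + 1) (m (a, a)) (\<lambda>i j. complex_of_real (Re (ch K (a, a) i j)))"
      using ch_diag_real[OF K(1), of _ a] by (simp add: colindep_def)
    then show ?thesis
      by (simp only: colindep_complex_of_real)
  \<comment> \<open>For m (a, a) = 0 the frame has no columns and independence is vacuous.\<close>
  qed (simp add: colindep_def)
  then show ?thesis
    by (simp add: frames_def diag_frame_def colindep_def)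
qed

lemma upper_frame_in:
  assumes "K \<in> moduli_space p \<rho> \<mu>" "fst a < snd a" "0 < m a"
  shows "upper_frame K a \<in> frames (fst a + 1) (m a)"
proof -
  have "colindep (zero_mult a) (m a) (ch K a)"
    using assms(1,3) unfolding moduli_space_frames by blast
  moreover have "zero_mult a = fst a + 1"
    using assms(2) by (simp add: zero_mult_def)
  ultimately show ?thesis
    by (simp add: frames_def upper_frame_def colindep_def)
qed

text \<open>Hermiticity makes the entries for (a, a) real, so \<open>frame_coset\<close> over the
  reals loses nothing. The type (0, 0) is excluded since \<open>char_matrix\<close> treats it
  separately.\<close>

lemma diag_coset:
  assumes "K \<in> moduli_space p \<rho> \<mu>" "a \<noteq> 0"
  shows "frame_coset complex_of_real (a + 1) (m (a, a)) (char_matrix p m e K (a, a)) =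
    mat_coset (a + 1) (m (a, a)) (diag_frame K a)"
proof -
  have K: "adj K = K" "\<And>t. t \<in> torus \<Longrightarrow> conj_act \<rho> t K = K" "trace K = 1"
    using assms(1) by (auto simp: moduli_space_frames)
  have "complex_of_real x = char_matrix p m e K (a, a) $$ (i, j) \<longleftrightarrow> x = diag_frame K a $$ (i, j)"
    if "i < a + 1" "j < m (a, a)" for x i j
  proof -
    have "char_matrix p m e K (a, a) $$ (i, j) = complex_of_real (Re (ch K (a, a) i j))"
      using char_matrix_eq[OF K(2,3), of "(a, a)" i j] ch_diag_real[OF K(1) that] assms(2) that
      by (simp add: zero_mult_le)
    then show ?thesis
      using that by (simp add: diag_frame_def)
  qed
  then show ?thesis
    by (auto simp: frame_coset_def mat_coset_def)
qed

lemma upper_coset: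
  assumes "K \<in> moduli_space p \<rho> \<mu>" "a < b"
  shows "frame_coset id (a + 1) (m (a, b)) (char_matrix p m e K (a, b)) =
    mat_coset (a + 1) (m (a, b)) (upper_frame K (a, b))"
proof -
  have K: "\<And>t. t \<in> torus \<Longrightarrow> conj_act \<rho> t K = K" "trace K = 1"
    using assms(1) by (auto simp: moduli_space_frames)
  have "char_matrix p m e K (a, b) $$ (i, j) = upper_frame K (a, b) $$ (i, j)"
    if "i < a + 1" "j < m (a, b)" for i j
    using char_matrix_eq[OF K, of "(a, b)" i j] assms(2) that by (simp add: zero_mult_le upper_frame_def)
  then show ?thesis
    by (auto simp: frame_coset_def mat_coset_def)
qed

definition to_target :: "complex^'n^'n \<Rightarrow> (nat \<Rightarrow> real Matrix.mat set) \<times> (nat \<times> nat \<Rightarrow> complex Matrix.mat set)" where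
  "to_target K = (restrict (\<lambda>a. mat_coset (a + 1) (m (a, a)) (diag_frame K a)) diag_types,
     restrict (\<lambda>a. mat_coset (fst a + 1) (m a) (upper_frame K a)) upper_types)"

text \<open>The coefficients of the inverse map: real on the diagonal, read from the coset above it,
  and below it forced by Hermiticity. The subtractions pass from indices counted from 1 to matrix
  positions.\<close>

definition coset_coeffs ::
  "(nat \<Rightarrow> real Matrix.mat set) \<times> (nat \<times> nat \<Rightarrow> complex Matrix.mat set) \<Rightarrow> nat \<times> nat \<Rightarrow> nat \<Rightarrow> nat \<Rightarrow> complex" where
  "coset_coeffs z a \<sigma> \<gamma> =
     (if fst a = snd a then of_real (coset_entry (fst z (fst a)) (\<gamma> - 1) (\<sigma> - 1))
      else if fst a < snd a then coset_entry (snd z a) (\<gamma> - 1) (\<sigma> - 1)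
      else cnj (coset_entry (snd z (prod.swap a)) (\<gamma> - 1) (\<sigma> - 1)))"

lemma diag_type: "0 < m (a, a) \<Longrightarrow> a \<noteq> 0 \<Longrightarrow> a \<in> diag_types"
  using multiplicity_bounds(2)[of "(a, a)"] by simp

lemma continuous_ch: "continuous_on S (\<lambda>K. ch K a i j)"
  unfolding ch_def kc_def using nrm_pos[of a]
  by (intro continuous_intros linear_continuous_on bounded_bilinear.bounded_linear_right[OF B.bounded_bilinear_ip]) simp

lemma continuous_to_target: "continuous_map (top_of_set (moduli_space p \<rho> \<mu>)) target to_target"
proof -
  let ?M = "moduli_space p \<rho> \<mu>"
  have d: "continuous_map (top_of_set ?M) (stiefel (a + 1) (m (a, a))) (\<lambda>K. mat_coset (a + 1) (m (a, a)) (diag_frame K a))" for a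
  proof -
    have "continuous_map (top_of_set ?M) (subtopology (mat_topology (a + 1) (m (a, a))) (frames (a + 1) (m (a, a))))
        (\<lambda>K. diag_frame K a)"
      unfolding continuous_map_in_subtopology
    proof
      show "continuous_map (top_of_set ?M) (mat_topology (a + 1) (m (a, a))) (\<lambda>K. diag_frame K a)"
        by (rule continuous_map_into_mat)
           (simp_all add: diag_frame_def continuous_on_Re[OF continuous_ch])
      show "(\<lambda>K. diag_frame K a) \<in> topspace (top_of_set ?M) \<rightarrow> frames (a + 1) (m (a, a))"
        using diag_frame_in by simp
    qed
    from continuous_map_compose[OF this continuous_mat_coset]
    show ?thesis
      using multiplicity_le[of "(a, a)"] by (simp add: zero_mult_le o_def)
  qed
  have u: "continuous_map (top_of_set ?M) (stiefel (fst a + 1) (m a)) (\<lambda>K. mat_coset (fst a + 1) (m a) (upper_frame K a))"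
    if a: "fst a < snd a" "0 < m a" for a
  proof -
    have "continuous_map (top_of_set ?M) (subtopology (mat_topology (fst a + 1) (m a)) (frames (fst a + 1) (m a)))
        (\<lambda>K. upper_frame K a)"
      unfolding continuous_map_in_subtopology
    proof
      show "continuous_map (top_of_set ?M) (mat_topology (fst a + 1) (m a)) (\<lambda>K. upper_frame K a)"
        by (rule continuous_map_into_mat) (simp_all add: upper_frame_def continuous_ch)
      show "(\<lambda>K. upper_frame K a) \<in> topspace (top_of_set ?M) \<rightarrow> frames (fst a + 1) (m a)"
        using upper_frame_in a by simp
    qed
    from continuous_map_compose[OF this continuous_mat_coset]
    show ?thesis
      using multiplicity_le[of a] a by (simp add: zero_mult_def o_def)
  qed
  show ?thesis
    unfolding to_target_def
  proof (intro continuous_map_pairedI)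
    show "continuous_map (top_of_set ?M) (product_topology (\<lambda>a. stiefel (a + 1) (m (a, a))) diag_types)
        (\<lambda>K. restrict (\<lambda>a. mat_coset (a + 1) (m (a, a)) (diag_frame K a)) diag_types)"
      unfolding continuous_map_componentwise using d by auto
    show "continuous_map (top_of_set ?M) (product_topology (\<lambda>(a, b). stiefel (a + 1) (m (a, b))) upper_types)
        (\<lambda>K. restrict (\<lambda>a. mat_coset (fst a + 1) (m a) (upper_frame K a)) upper_types)"
      unfolding continuous_map_componentwise using u by auto
  qed
qed

section \<open>The inverse map: values, continuity and the two compositions\<close>

lemma target_diag:
  assumes "z \<in> topspace target" "a \<in> diag_types"
  shows "Matrix.mat (a + 1) (m (a, a)) (\<lambda>(i, j). coset_entry (fst z a) i j) \<in> frames (a + 1) (m (a, a))"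
    "fst z a = mat_coset (a + 1) (m (a, a)) (Matrix.mat (a + 1) (m (a, a)) (\<lambda>(i, j). coset_entry (fst z a) i j))"
proof -
  have "fst z a \<in> topspace (stiefel (a + 1) (m (a, a)) :: real Matrix.mat set topology)"
    using assms by (auto simp: PiE_iff)
  moreover have "m (a, a) \<le> a + 1"
    using multiplicity_le[of "(a, a)"] by (simp add: zero_mult_le)
  ultimately show "Matrix.mat (a + 1) (m (a, a)) (\<lambda>(i, j). coset_entry (fst z a) i j) \<in> frames (a + 1) (m (a, a))"
    "fst z a = mat_coset (a + 1) (m (a, a)) (Matrix.mat (a + 1) (m (a, a)) (\<lambda>(i, j). coset_entry (fst z a) i j))"
    using stiefel_elem by blast+
qed

lemma target_upper:
  assumes "z \<in> topspace target" "a \<in> upper_types"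
  shows "Matrix.mat (fst a + 1) (m a) (\<lambda>(i, j). coset_entry (snd z a) i j) \<in> frames (fst a + 1) (m a)"
    "snd z a = mat_coset (fst a + 1) (m a) (Matrix.mat (fst a + 1) (m a) (\<lambda>(i, j). coset_entry (snd z a) i j))"
proof -
  have "snd z a \<in> topspace (stiefel (fst a + 1) (m a) :: complex Matrix.mat set topology)"
    using assms by (cases a) (auto simp: PiE_iff)
  moreover have "m a \<le> fst a + 1"
    using multiplicity_le[of a] assms(2) by (auto simp: zero_mult_def)
  ultimately show "Matrix.mat (fst a + 1) (m a) (\<lambda>(i, j). coset_entry (snd z a) i j) \<in> frames (fst a + 1) (m a)"
    "snd z a = mat_coset (fst a + 1) (m a) (Matrix.mat (fst a + 1) (m a) (\<lambda>(i, j). coset_entry (snd z a) i j))"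
    using stiefel_elem by blast+
qed

lemma colindep_coset_coeffs:
  assumes z: "z \<in> topspace target" and a: "a \<noteq> (0, 0)" "0 < m a"
  shows "colindep (zero_mult a) (m a) (\<lambda>i j. coset_coeffs z a (Suc j) (Suc i))"
proof -
  have upper: "colindep (zero_mult b) (m b) (\<lambda>i j. coset_entry (snd z b) i j)" if b: "b \<in> upper_types" for b
  proof -
    have "zero_mult b = fst b + 1"
      using b by (auto simp: zero_mult_def)
    then show ?thesis
      using target_upper(1)[OF z b] by (simp add: frames_def colindep_def)
  qed
  consider "fst a = snd a" | "fst a < snd a" | "snd a < fst a"
    by linarith
  then show ?thesis
  proof cases
    case 1
    then obtain k where k: "a = (k, k)"
      by (metis prod.collapse)
    have "k \<in> diag_types"
      using diag_type a by (simp add: k)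
    from target_diag(1)[OF z this]
    have "colindep (k + 1) (m (k, k)) (\<lambda>i j. coset_entry (fst z k) i j)"
      by (simp add: frames_def colindep_def)
    then have "colindep (k + 1) (m (k, k)) (\<lambda>i j. complex_of_real (coset_entry (fst z k) i j))"
      by (simp only: colindep_complex_of_real)
    then show ?thesis
      by (simp add: k zero_mult_le coset_coeffs_def)
  next
    case 2
    then have "a \<in> upper_types"
      using a(2) by (cases a) auto
    from upper[OF this] 2 show ?thesis
      by (simp add: coset_coeffs_def)
  next
    case 3
    then have "prod.swap a \<in> upper_types"
      using a(2) multiplicity_swap[of a] by (cases a) auto
    from colindep_cnj[OF upper[OF this]] 3 show ?thesis
      by (simp add: coset_coeffs_def zero_mult_swap multiplicity_swap)
  qed
qed

lemma from_target:
  assumes z: "z \<in> topspace target" shows "Ksum (coset_coeffs z) \<in> moduli_space p \<rho> \<mu>"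
  unfolding moduli_space_frames
proof (intro conjI ballI allI impI)
  show "conj_act \<rho> t (Ksum (coset_coeffs z)) = Ksum (coset_coeffs z)" if "t \<in> torus" for t
    by (rule Ksum_fixed[OF that])
  show "adj (Ksum (coset_coeffs z)) = Ksum (coset_coeffs z)"
    by (rule Ksum_adj) (auto simp: coset_coeffs_def)
  show tr: "trace (Ksum (coset_coeffs z)) = 1"
    by (rule Ksum_trace)
  show "colindep (zero_mult a) (m a) (ch (Ksum (coset_coeffs z)) a)" if a: "0 < m a" for a
  proof (cases "a = (0, 0)")
    case True
    then show ?thesis
      using colindep_trivial[OF tr] by simp
  next
    case False
    have "colindep (zero_mult a) (m a) (ch (Ksum (coset_coeffs z)) a) =
        colindep (zero_mult a) (m a) (\<lambda>i j. coset_coeffs z a (Suc j) (Suc i))"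
      by (rule colindep_cong) (rule ch_Ksum[OF False])
    then show ?thesis
      using colindep_coset_coeffs[OF z False a] by simp
  qed
qed

lemma continuous_coset_coeffs:
  assumes a: "a \<noteq> (0, 0)" "0 < m a" and s: "\<sigma> \<in> {1..m a}" "\<gamma> \<in> {1..zero_mult a}"
  shows "continuous_map target euclidean (\<lambda>z. coset_coeffs z a \<sigma> \<gamma>)"
proof -
  have upper: "continuous_map target euclidean (\<lambda>z. coset_entry (snd z b) (\<gamma> - 1) (\<sigma> - 1))"
    if b: "b \<in> upper_types" "m b = m a" "zero_mult b = zero_mult a" for b
  proof -
    have "continuous_map (product_topology (\<lambda>(a, b). stiefel (a + 1) (m (a, b)) :: complex Matrix.mat set topology) upper_types)
        (stiefel (fst b + 1) (m b)) (\<lambda>f. f b)"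
      using continuous_map_product_projection[OF b(1), of "\<lambda>(a, b). stiefel (a + 1) (m (a, b)) :: complex Matrix.mat set topology"]
      by (cases b) simp
    from continuous_map_compose[OF continuous_map_snd this]
    have "continuous_map target (stiefel (fst b + 1) (m b)) (\<lambda>z. snd z b)"
      by (simp add: o_def)
    moreover have "zero_mult b = fst b + 1"
      using b(1) by (auto simp: zero_mult_def)
    then have "continuous_map (stiefel (fst b + 1) (m b)) euclidean (\<lambda>Q :: complex Matrix.mat set. coset_entry Q (\<gamma> - 1) (\<sigma> - 1))"
      using s b multiplicity_le[of b] by (intro continuous_coset_entry) auto
    ultimately show ?thesis
      using continuous_map_compose by (fastforce simp: o_def)
  qed
  consider "fst a = snd a" | "fst a < snd a" | "snd a < fst a"
    by linarith
  then show ?thesis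
  proof cases
    case 1
    then obtain k where k: "a = (k, k)"
      by (metis prod.collapse)
    have "k \<in> diag_types"
      using diag_type a by (simp add: k)
    from continuous_map_compose[OF continuous_map_fst continuous_map_product_projection[OF this]]
    have "continuous_map target (stiefel (k + 1) (m (k, k))) (\<lambda>z. fst z k)"
      by (simp add: o_def)
    moreover have "continuous_map (stiefel (k + 1) (m (k, k))) euclidean (\<lambda>Q :: real Matrix.mat set. coset_entry Q (\<gamma> - 1) (\<sigma> - 1))"
      using s multiplicity_le[of a] by (intro continuous_coset_entry) (auto simp: k zero_mult_le)
    ultimately have "continuous_map target euclidean ((\<lambda>Q :: real Matrix.mat set. coset_entry Q (\<gamma> - 1) (\<sigma> - 1)) \<circ> (\<lambda>z. fst z k))"
      by (rule continuous_map_compose)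
    moreover have "continuous_map euclidean euclidean complex_of_real"
      by (simp add: continuous_on_of_real_id)
    ultimately have "continuous_map target euclidean
        (complex_of_real \<circ> ((\<lambda>Q :: real Matrix.mat set. coset_entry Q (\<gamma> - 1) (\<sigma> - 1)) \<circ> (\<lambda>z. fst z k)))"
      by (rule continuous_map_compose)
    then show ?thesis
      by (simp add: coset_coeffs_def k o_def)
  next
    case 2
    then have "a \<in> upper_types"
      using a(2) by (cases a) auto
    from upper[OF this] 2 show ?thesis
      by (simp add: coset_coeffs_def)
  next
    case 3
    then have "prod.swap a \<in> upper_types"
      using a(2) multiplicity_swap[of a] by (cases a) auto
    from upper[OF this] have "continuous_map target euclidean (\<lambda>z. coset_entry (snd z (prod.swap a)) (\<gamma> - 1) (\<sigma> - 1))"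
      by (simp add: zero_mult_swap multiplicity_swap)
    moreover have "continuous_map euclidean euclidean cnj"
      by (simp add: continuous_on_cnj)
    ultimately have "continuous_map target euclidean (cnj \<circ> (\<lambda>z. coset_entry (snd z (prod.swap a)) (\<gamma> - 1) (\<sigma> - 1)))"
      by (rule continuous_map_compose)
    then show ?thesis
      using 3 by (simp add: coset_coeffs_def o_def)
  qed
qed

lemma continuous_from_target:
  "continuous_map target (top_of_set (moduli_space p \<rho> \<mu>)) (\<lambda>z. Ksum (coset_coeffs z))"
proof -
  have summand: "continuous_map target euclidean (\<lambda>z. cscale (cnj (coset_coeffs z a \<sigma> \<gamma>) * of_real r) A)"
    if "a \<noteq> (0, 0)" "0 < m a" "\<sigma> \<in> {1..m a}" "\<gamma> \<in> {1..zero_mult a}" for a \<sigma> \<gamma> r and A :: "complex^'n^'n"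
  proof -
    have "linear (\<lambda>x. cscale (cnj x * of_real r) A)"
      by (rule linearI) (simp_all add: veq algebra_simps scaleR_complex)
    then have "continuous_map euclidean euclidean (\<lambda>x. cscale (cnj x * of_real r) A)"
      by (simp add: linear_continuous_on linear_conv_bounded_linear)
    from continuous_map_compose[OF continuous_coset_coeffs[OF that] this] show ?thesis
      by (simp add: o_def)
  qed
  have "continuous_map target euclidean (\<lambda>z. Ksum (coset_coeffs z))"
    unfolding Ksum_def
    by (intro continuous_map_add continuous_map_sum finite_types finite_atLeastAtMost summand) auto
  then show ?thesis
    using from_target by (simp add: continuous_map_in_subtopology)
qed

lemma from_to_target:
  assumes K: "K \<in> moduli_space p \<rho> \<mu>" shows "Ksum (coset_coeffs (to_target K)) = K"
proof -
  have KM: "adj K = K" "\<And>t. t \<in> torus \<Longrightarrow> conj_act \<rho> t K = K" "trace K = 1"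
    using K by (auto simp: moduli_space_frames)
  have upper: "coset_entry (snd (to_target K) b) i j = ch K b i j"
    if b: "b \<in> upper_types" "i < zero_mult b" "j < m b" for b i j
  proof -
    have "zero_mult b = fst b + 1" "fst b < snd b" "0 < m b"
      using b(1) by (auto simp: zero_mult_def)
    with b show ?thesis
      using coset_entry_frame[OF upper_frame_in[OF K, of b], of i j] by (simp add: to_target_def upper_frame_def)
  qed
  have "coset_coeffs (to_target K) a \<sigma> \<gamma> = cnj (kc K a \<sigma> \<gamma>) / of_real (nrm a)"
    if a: "a \<noteq> (0, 0)" "0 < m a" and s: "\<sigma> \<in> {1..m a}" "\<gamma> \<in> {1..zero_mult a}" for a \<sigma> \<gamma>
  proof -
    obtain i j where ij: "\<gamma> = Suc i" "\<sigma> = Suc j" "i < zero_mult a" "j < m a"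
      using s by (metis One_nat_def Suc_le_D Suc_le_lessD atLeastAtMost_iff)
    have rhs: "cnj (kc K a \<sigma> \<gamma>) / of_real (nrm a) = ch K a i j"
      by (simp add: ch_def ij)
    consider "fst a = snd a" | "fst a < snd a" | "snd a < fst a"
      by linarith
    then show ?thesis
      unfolding rhs
    proof cases
      case 1
      then obtain k where k: "a = (k, k)"
        by (metis prod.collapse)
      have kd: "k \<in> diag_types"
        using diag_type a by (simp add: k)
      have "coset_entry (mat_coset (k + 1) (m (k, k)) (diag_frame K k)) i j = diag_frame K k $$ (i, j)"
        using ij by (intro coset_entry_frame diag_frame_in[OF K]) (simp_all add: k zero_mult_le)
      also have "\<dots> = Re (ch K (k, k) i j)"
        using ij by (simp add: diag_frame_def k zero_mult_le)
      finally show "coset_coeffs (to_target K) a \<sigma> \<gamma> = ch K a i j"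
        using kd ch_diag_real[OF KM(1), of i k j] ij by (simp add: coset_coeffs_def to_target_def k zero_mult_le)
    next
      case 2
      then have "a \<in> upper_types"
        using a(2) by (cases a) auto
      from upper[OF this ij(3,4)] 2 show "coset_coeffs (to_target K) a \<sigma> \<gamma> = ch K a i j"
        by (simp add: coset_coeffs_def ij)
    next
      case 3
      then have "prod.swap a \<in> upper_types"
        using a(2) multiplicity_swap[of a] by (cases a) auto
      from upper[OF this, of i j] 3 show "coset_coeffs (to_target K) a \<sigma> \<gamma> = ch K a i j"
        using ch_swap[OF KM(1) ij(3,4)] by (simp add: coset_coeffs_def ij zero_mult_swap multiplicity_swap)
    qed
  qed
  then have "Ksum (coset_coeffs (to_target K)) = Ksum (\<lambda>a \<sigma> \<gamma>. cnj (kc K a \<sigma> \<gamma>) / of_real (nrm a))"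
    by (rule Ksum_cong)
  also have "\<dots> = K"
    by (rule kernel_expansion[OF KM(2,3), symmetric])
  finally show ?thesis .
qed

lemma to_from_target:
  assumes z: "z \<in> topspace target" shows "to_target (Ksum (coset_coeffs z)) = z"
proof (rule prod_eqI)
  let ?K = "Ksum (coset_coeffs z)"
  have ext: "fst z \<in> extensional diag_types" "snd z \<in> extensional upper_types"
    using z by (auto simp: PiE_iff)
  show "fst (to_target ?K) = fst z"
  proof (rule extensionalityI[OF _ ext(1)])
    fix a assume a: "a \<in> diag_types"
    have "diag_frame ?K a = Matrix.mat (a + 1) (m (a, a)) (\<lambda>(i, j). coset_entry (fst z a) i j)"
      using a by (intro eq_matI) (auto simp: diag_frame_def ch_Ksum zero_mult_le coset_coeffs_def)
    then show "fst (to_target ?K) a = fst z a"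
      using target_diag(2)[OF z a] a by (simp add: to_target_def)
  qed (simp add: to_target_def)
  show "snd (to_target ?K) = snd z"
  proof (rule extensionalityI[OF _ ext(2)])
    fix a assume a: "a \<in> upper_types"
    have "upper_frame ?K a = Matrix.mat (fst a + 1) (m a) (\<lambda>(i, j). coset_entry (snd z a) i j)"
      using a by (intro eq_matI) (auto simp: upper_frame_def ch_Ksum zero_mult_le coset_coeffs_def)
    then show "snd (to_target ?K) a = snd z a"
      using target_upper(2)[OF z a] a by (simp add: to_target_def)
  qed (simp add: to_target_def)
qed

theorem moduli_space_homeomorphic:
  "homeomorphic_map (top_of_set (moduli_space p \<rho> \<mu>)) target to_target"
proof -
  have "homeomorphic_maps (top_of_set (moduli_space p \<rho> \<mu>)) target to_target (\<lambda>z. Ksum (coset_coeffs z))"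
    unfolding homeomorphic_maps_def
    using continuous_to_target continuous_from_target from_to_target to_from_target by auto
  then show ?thesis
    using homeomorphic_map_maps by blast
qed

end

theorem corollary5p11:
  fixes p q :: nat
    and \<rho> :: "complex^3^3 \<Rightarrow> complex^'n^'n"
    and \<mu> :: "(complex^3^3) set measure"
    and m :: "nat \<times> nat \<Rightarrow> nat"
    and V :: "nat \<times> nat \<Rightarrow> nat \<Rightarrow> (complex^'n^'n) set"
    and e :: "nat \<times> nat \<Rightarrow> nat \<Rightarrow> int \<times> int \<times> int \<Rightarrow> real \<Rightarrow> complex^'n^'n"
  assumes "(p, q) \<noteq> (0, 0)"
    and "unitary_irrep (p, q) \<rho>"
    and "invariant_prob \<mu>"
    and "gt_decomposition (p, q) \<rho> m V e"
  shows "homeomorphic_map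
    (top_of_set (moduli_space (p, q) \<rho> \<mu>))
    (prod_topology
      (product_topology (\<lambda>a. stiefel (a + 1) (m (a, a)) :: real Matrix.mat set topology) {1..p + q})
      (product_topology (\<lambda>(a, b). stiefel (a + 1) (m (a, b)) :: complex Matrix.mat set topology)
        {(a, b). a < b \<and> 0 < m (a, b)}))
    (\<lambda>K.
      (restrict (\<lambda>a. frame_coset complex_of_real (a + 1) (m (a, a))
                       (char_matrix (p, q) m e K (a, a))) {1..p + q},
       restrict (\<lambda>(a, b). frame_coset id (a + 1) (m (a, b))
                       (char_matrix (p, q) m e K (a, b))) {(a, b). a < b \<and> 0 < m (a, b)}))"
proof -
  interpret su3_symbols "(p, q)" \<rho> m V e \<mu>
    by unfold_locales (fact assms(2), fact assms(4), fact assms(3))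
  show ?thesis
  \<comment> \<open>On the moduli space \<open>to_target\<close>, written with \<open>ch\<close>,
    agrees with the map given by the characteristic matrices.\<close>
  proof (rule homeomorphic_map_eq)
    show "homeomorphic_map (top_of_set (moduli_space (p, q) \<rho> \<mu>))
      (prod_topology
        (product_topology (\<lambda>a. stiefel (a + 1) (m (a, a)) :: real Matrix.mat set topology) {1..p + q})
        (product_topology (\<lambda>(a, b). stiefel (a + 1) (m (a, b)) :: complex Matrix.mat set topology)
          {(a, b). a < b \<and> 0 < m (a, b)})) to_target"
      using moduli_space_homeomorphic by (simp only: fst_conv snd_conv)
    fix K assume "K \<in> topspace (top_of_set (moduli_space (p, q) \<rho> \<mu>))"
    then have "K \<in> moduli_space (p, q) \<rho> \<mu>"
      by simp
    note K = diag_coset[OF this] upper_coset[OF this]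
    show "to_target K =
      (restrict (\<lambda>a. frame_coset complex_of_real (a + 1) (m (a, a))
                       (char_matrix (p, q) m e K (a, a))) {1..p + q},
       restrict (\<lambda>(a, b). frame_coset id (a + 1) (m (a, b))
                       (char_matrix (p, q) m e K (a, b))) {(a, b). a < b \<and> 0 < m (a, b)})"
      unfolding to_target_def fst_conv snd_conv
    proof (intro arg_cong2[of _ _ _ _ Pair] restrict_ext)
      fix a assume "a \<in> {1..p + q}"
      then have "a \<noteq> 0"
        by simp
      from K(1)[OF this] show "mat_coset (a + 1) (m (a, a)) (diag_frame K a) =
          frame_coset complex_of_real (a + 1) (m (a, a)) (char_matrix (p, q) m e K (a, a))"
        by (rule sym)
    next
      fix a assume "a \<in> {(a, b). a < b \<and> 0 < m (a, b)}"
      then obtain b c where a: "a = (b, c)" "b < c"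
        by blast
      from K(2)[OF a(2)] show "mat_coset (fst a + 1) (m a) (upper_frame K a) =
          (case a of (a, b) \<Rightarrow> frame_coset id (a + 1) (m (a, b)) (char_matrix (p, q) m e K (a, b)))"
        by (simp only: a(1) fst_conv prod.case)
    qed
  qed
qed

end
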